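(* Let $d$ be a positive integer, $K$ a number field, and $L$ a totally real subfield of $K_{ab}^{(d)}$ of infinite degree over $\mathbb{Q}$. Then there are no universal quadratic lattices over $L$.
   Context: For a positive integer $d$ and a number field $K$, $K^{(d)}$ denotes the compositum of all extensions of $K$ of degree at most $d$ (inside a fixed algebraic closure), and $K_{ab}^{(d)}$ denotes the maximal abelian subextension of $K^{(d)}/K$. An algebraic number is totally real (resp. totally positive) if all its conjugates, i.e. all roots of its minimal polynomial over $\mathbb{Q}$, are real (resp. positive real). A totally real field is an algebraic extension of $\mathbb{Q}$ (of finite or infinite degree) all of whose elements are totally real. For an algebraic extension $L/\mathbb{Q}$, $\mathcal{O}_L$ is the ring of elements of $L$ integral over $\mathbb{Z}$. Let $L$ be a totally real field. An $\mathcal{O}_L$-lattice is a finitely generated $\mathcal{O}_L$-module $\Lambda\subseteq V$, where $V$ is a finite-dimensional $L$-vector space. A quadratic map on $V$ is a map $Q:V\to L$ with $Q(av)=a^2Q(v)$ for all $a\in L$, $v\in V$, such that $B_Q(v,w)=\frac12(Q(v+w)-Q(v)-Q(w))$ is bilinear. A quadratic lattice over $L$ (quadratic $\mathcal{O}_L$-lattice) is a pair $(\Lambda,Q)$ of an $\mathcal{O}_L$-lattice and the restriction of a quadratic map to $\Lambda$. It is integral if $Q(\Lambda)\subseteq\mathcal{O}_L$; an integral quadratic lattice is positive definite if $Q(v)$ is totally positive for every $0\neq v\in\Lambda$, and universal if it is positive definite and for every totally positive $a\in\mathcal{O}_L$ there is $v\in\Lambda$ with $Q(v)=a$. *)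

theory Defs
  imports
    Complex_Main
    "HOL-Computational_Algebra.Polynomial_Factorial"
    "HOL-Algebra.Generated_Fields"
    "HOL-Algebra.Finite_Extensions"
    "Jordan_Normal_Form.VS_Connect"
begin

section \<open>Fields of algebraic numbers\<close>

text \<open>
  All fields live inside the complex numbers, which contain an algebraic closure of every number
  field. Fields and subrings are sets of complex numbers, equipped with the operations of
  \<open>complex_ring\<close> when a ring structure is needed.
\<close>

abbreviation complex_ring :: "complex ring" where
  "complex_ring \<equiv> class_ring"

abbreviation ring_on :: "complex set \<Rightarrow> complex ring" where
  "ring_on A \<equiv> complex_ring\<lparr>carrier := A\<rparr>"

definition number_field :: "complex set \<Rightarrow> bool" where
  "number_field K \<longleftrightarrow> subfield K complex_ring \<and> ring.finite_dimension complex_ring \<rat> K"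

definition compositum :: "complex set set \<Rightarrow> complex set" where
  "compositum \<F> = generate_field complex_ring (\<Union>\<F>)"

definition bounded_degree_compositum :: "nat \<Rightarrow> complex set \<Rightarrow> complex set" where
  "bounded_degree_compositum d K =
     compositum {E. subfield E complex_ring \<and> K \<subseteq> E
                  \<and> (\<exists>n\<le>d. ring.dimension complex_ring n K E)}"

definition algebraic_extension :: "complex set \<Rightarrow> complex set \<Rightarrow> bool" where
  "algebraic_extension K F \<longleftrightarrow>
     subfield K complex_ring \<and> subfield F complex_ring \<and> K \<subseteq> F
     \<and> (\<forall>x\<in>F. (ring.algebraic complex_ring over K) x)"

text \<open>
  Homomorphisms are total functions of which only the values on the source field matter.
\<close>

definition embeddings :: "complex set \<Rightarrow> complex set \<Rightarrow> (complex \<Rightarrow> complex) set" where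
  "embeddings K F = {\<sigma> \<in> Ring.ring_hom (ring_on F) complex_ring. \<forall>x\<in>K. \<sigma> x = x}"

definition galois_group :: "complex set \<Rightarrow> complex set \<Rightarrow> (complex \<Rightarrow> complex) set" where
  "galois_group K F = {\<sigma> \<in> ring_iso (ring_on F) (ring_on F). \<forall>x\<in>K. \<sigma> x = x}"

text \<open>
  Normality: every \<open>K\<close>-embedding of \<open>F\<close> maps \<open>F\<close> onto itself. Separability is automatic in
  characteristic \<open>0\<close>. The extension may be infinite.
\<close>

definition galois_extension :: "complex set \<Rightarrow> complex set \<Rightarrow> bool" where
  "galois_extension K F \<longleftrightarrow> algebraic_extension K F \<and> (\<forall>\<sigma>\<in>embeddings K F. \<sigma> ` F = F)"

definition abelian_extension :: "complex set \<Rightarrow> complex set \<Rightarrow> bool" where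
  "abelian_extension K F \<longleftrightarrow> galois_extension K F
     \<and> (\<forall>\<sigma>\<in>galois_group K F. \<forall>\<tau>\<in>galois_group K F. \<forall>x\<in>F. \<sigma> (\<tau> x) = \<tau> (\<sigma> x))"

text \<open>
  The greatest element, with respect to inclusion, among the abelian extensions of \<open>K\<close> inside \<open>E\<close>.
  It exists by the lemma \<open>maximal_abelian_subextension_greatest\<close> below.
\<close>

definition maximal_abelian_subextension :: "complex set \<Rightarrow> complex set \<Rightarrow> complex set" where
  "maximal_abelian_subextension K E = (GREATEST F. abelian_extension K F \<and> F \<subseteq> E)"

definition bounded_degree_abelian_compositum :: "nat \<Rightarrow> complex set \<Rightarrow> complex set" where
  "bounded_degree_abelian_compositum d K =
     maximal_abelian_subextension K (bounded_degree_compositum d K)"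

lemma field_complex_ring: "field complex_ring"
  by (rule class_field)

lemma ring_complex_ring: "ring complex_ring"
  by (rule class_ring.ring_axioms)

lemma a_inv_complex: "a_inv complex_ring x = - x"
  by (simp add: class_ring_simps)

lemma m_inv_complex: "x \<noteq> 0 \<Longrightarrow> m_inv complex_ring x = inverse x"
  by (simp add: class_ring_simps)

lemma subfield_closed:
  assumes "subfield F complex_ring"
  shows "1 \<in> F" "x \<in> F \<Longrightarrow> - x \<in> F" "x \<in> F \<Longrightarrow> y \<in> F \<Longrightarrow> x + y \<in> F"
    "x \<in> F \<Longrightarrow> y \<in> F \<Longrightarrow> x * y \<in> F" "x \<in> F \<Longrightarrow> inverse x \<in> F" "0 \<in> F"
proof -
  note sr = subringE[OF subfieldE(1)[OF assms]]
  show "1 \<in> F" "x \<in> F \<Longrightarrow> - x \<in> F" "x \<in> F \<Longrightarrow> y \<in> F \<Longrightarrow> x + y \<in> F"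
    "x \<in> F \<Longrightarrow> y \<in> F \<Longrightarrow> x * y \<in> F" and z: "0 \<in> F"
    using sr(2) sr(3) sr(5)[of x] sr(6)[of x y] sr(7)[of x y] by (simp_all add: a_inv_complex)
  show "x \<in> F \<Longrightarrow> inverse x \<in> F"
    using ring.subfield_m_inv(1)[OF ring_complex_ring assms, of x] z
    by (cases "x = 0") (simp_all add: m_inv_complex)
qed

lemma subfield_compositum: "subfield (compositum \<F>) complex_ring"
  unfolding compositum_def
  by (rule field.generate_field_is_subfield[OF field_complex_ring]) simp

lemma compositum_upper: "F \<in> \<F> \<Longrightarrow> F \<subseteq> compositum \<F>"
  unfolding compositum_def by (auto intro: generate_field.incl)

lemma compositum_least:
  "subfield E complex_ring \<Longrightarrow> (\<And>F. F \<in> \<F> \<Longrightarrow> F \<subseteq> E) \<Longrightarrow> compositum \<F> \<subseteq> E"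
  unfolding compositum_def
  by (rule field.generate_field_min_subfield1[OF field_complex_ring]) auto

lemma compositum_induct [consumes 1, case_names one incl minus inverse add mult]:
  assumes "x \<in> compositum \<F>" "P 1" "\<And>F x. F \<in> \<F> \<Longrightarrow> x \<in> F \<Longrightarrow> P x"
    "\<And>x. x \<in> compositum \<F> \<Longrightarrow> P x \<Longrightarrow> P (- x)"
    "\<And>x. x \<in> compositum \<F> \<Longrightarrow> P x \<Longrightarrow> x \<noteq> 0 \<Longrightarrow> P (inverse x)"
    "\<And>x y. x \<in> compositum \<F> \<Longrightarrow> y \<in> compositum \<F> \<Longrightarrow> P x \<Longrightarrow> P y \<Longrightarrow> P (x + y)"
    "\<And>x y. x \<in> compositum \<F> \<Longrightarrow> y \<in> compositum \<F> \<Longrightarrow> P x \<Longrightarrow> P y \<Longrightarrow> P (x * y)"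
  shows "P x"
  using assms(1) unfolding compositum_def
proof (induction rule: generate_field.induct)
  case (m_inv h)
  then show ?case using assms(5)[unfolded compositum_def, of h] by (simp add: m_inv_complex)
qed (use assms[unfolded compositum_def] in \<open>auto simp: a_inv_complex\<close>)

lemma hom_on_field:
  assumes F: "subfield F complex_ring" and s: "\<sigma> \<in> Ring.ring_hom (ring_on F) complex_ring"
  shows "\<sigma> 1 = 1" "x \<in> F \<Longrightarrow> y \<in> F \<Longrightarrow> \<sigma> (x + y) = \<sigma> x + \<sigma> y"
    "x \<in> F \<Longrightarrow> y \<in> F \<Longrightarrow> \<sigma> (x * y) = \<sigma> x * \<sigma> y"
    "x \<in> F \<Longrightarrow> \<sigma> (- x) = - \<sigma> x" "x \<in> F \<Longrightarrow> \<sigma> (inverse x) = inverse (\<sigma> x)"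
proof -
  show one: "\<sigma> 1 = 1" using ring_hom_one[OF s] by simp
  show add: "\<sigma> (x + y) = \<sigma> x + \<sigma> y" if "x \<in> F" "y \<in> F" for x y
    using ring_hom_add[OF s, of x y] that by simp
  show mult: "\<sigma> (x * y) = \<sigma> x * \<sigma> y" if "x \<in> F" "y \<in> F" for x y
    using ring_hom_mult[OF s, of x y] that by simp
  have zero: "\<sigma> 0 = 0" using add[of 0 0] subfield_closed[OF F] by simp
  show "\<sigma> (- x) = - \<sigma> x" if "x \<in> F"
    using add[of x "- x"] zero subfield_closed[OF F] that by (simp add: eq_neg_iff_add_eq_0 add.commute)
  show "\<sigma> (inverse x) = inverse (\<sigma> x)" if "x \<in> F"
  proof (cases "x = 0")
    case False
    then have "\<sigma> x * \<sigma> (inverse x) = 1"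
      using mult[of x "inverse x"] one subfield_closed[OF F] that by simp
    then show ?thesis by (metis inverse_unique)
  qed (simp add: zero)
qed

lemma galois_groupD:
  assumes "\<sigma> \<in> galois_group K F"
  shows "\<sigma> \<in> Ring.ring_hom (ring_on F) complex_ring" "\<sigma> ` F = F" "\<sigma> \<in> embeddings K F"
  using assms by (auto simp: galois_group_def embeddings_def ring_iso_def Ring.ring_hom_def bij_betw_def)

lemma restrict_embedding:
  "\<sigma> \<in> embeddings K F \<Longrightarrow> F' \<subseteq> F \<Longrightarrow> \<sigma> \<in> embeddings K F'"
  by (auto simp: embeddings_def Ring.ring_hom_def subset_iff)

lemma restrict_galois:
  assumes "\<sigma> \<in> galois_group K F" "F' \<subseteq> F" "galois_extension K F'"
  shows "\<sigma> \<in> galois_group K F'"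
proof -
  have im: "\<sigma> ` F' = F'"
    using assms(3) restrict_embedding[OF galois_groupD(3)[OF assms(1)] assms(2)]
    by (simp add: galois_extension_def)
  have iso: "\<sigma> \<in> ring_iso (ring_on F) (ring_on F)" and fix_K: "\<forall>x\<in>K. \<sigma> x = x"
    using assms(1) by (simp_all add: galois_group_def)
  have "inj_on \<sigma> F'"
    using iso assms(2) by (auto simp: ring_iso_def bij_betw_def intro: inj_on_subset)
  then have "bij_betw \<sigma> F' F'"
    using im by (simp add: bij_betw_def)
  moreover have "\<sigma> \<in> Ring.ring_hom (ring_on F') (ring_on F')"
  proof (rule ring_hom_memI)
    fix x y
    assume "x \<in> carrier (ring_on F')" "y \<in> carrier (ring_on F')"
    then have xy: "x \<in> F'" "y \<in> F'" "x \<in> F" "y \<in> F" using assms(2) by auto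
    show "\<sigma> x \<in> carrier (ring_on F')" using im xy by auto
    show "\<sigma> (x \<otimes>\<^bsub>ring_on F'\<^esub> y) = \<sigma> x \<otimes>\<^bsub>ring_on F'\<^esub> \<sigma> y"
      using ring_iso_memE(2)[OF iso, of x y] xy by simp
    show "\<sigma> (x \<oplus>\<^bsub>ring_on F'\<^esub> y) = \<sigma> x \<oplus>\<^bsub>ring_on F'\<^esub> \<sigma> y"
      using ring_iso_memE(3)[OF iso, of x y] xy by simp
  next
    show "\<sigma> \<one>\<^bsub>ring_on F'\<^esub> = \<one>\<^bsub>ring_on F'\<^esub>" using ring_iso_memE(4)[OF iso] by simp
  qed
  ultimately show ?thesis
    using fix_K by (simp add: galois_group_def ring_iso_def)
qed

lemma abelian_extension_compositum:
  assumes "\<F> \<noteq> {}" and ab: "\<And>F. F \<in> \<F> \<Longrightarrow> abelian_extension K F"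
  shows "abelian_extension K (compositum \<F>)"
proof -
  let ?M = "compositum \<F>"
  note M = subfield_compositum[of \<F>]
  have gal: "galois_extension K F" and alg: "algebraic_extension K F" if "F \<in> \<F>" for F
    using ab[OF that] by (auto simp: abelian_extension_def galois_extension_def)
  obtain F0 where F0: "F0 \<in> \<F>" using assms(1) by blast
  have K: "subfield K complex_ring" "K \<subseteq> ?M"
    using alg[OF F0] compositum_upper[OF F0] by (auto simp: algebraic_extension_def)
  have "?M \<subseteq> {x \<in> carrier complex_ring. (ring.algebraic complex_ring over K) x}"
    by (rule compositum_least[OF field.subfield_of_algebraics[OF field_complex_ring K(1)]])
       (use alg in \<open>auto simp: algebraic_extension_def\<close>)
  then have "algebraic_extension K ?M"
    using K M by (auto simp: algebraic_extension_def)
  moreover have "\<sigma> ` ?M = ?M" if s: "\<sigma> \<in> embeddings K ?M" for \<sigma>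
  proof -
    have hom: "\<sigma> \<in> Ring.ring_hom (ring_on ?M) complex_ring" using s by (simp add: embeddings_def)
    note h = hom_on_field[OF M hom] and c = subfield_closed[OF M]
    have im: "\<sigma> ` F = F" if "F \<in> \<F>" for F
      using gal[OF that] restrict_embedding[OF s compositum_upper[OF that]]
      by (auto simp: galois_extension_def)
    have "\<sigma> x \<in> ?M \<and> x \<in> \<sigma> ` ?M" if "x \<in> ?M" for x
      using that
    proof (induction rule: compositum_induct)
      case one
      then show ?case using h(1) c(1) by (metis image_eqI)
    next
      case (incl F x)
      then show ?case using im[OF incl(1)] compositum_upper[OF incl(1)] by blast
    next
      case (minus x)
      then show ?case using h(4) c(2) by (metis (no_types, lifting) image_iff)
    next
      case (inverse x)
      then show ?case using h(5) c(5) by (metis (no_types, lifting) image_iff)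
    next
      case (add x y)
      then show ?case using h(2) c(3) by (metis (no_types, lifting) image_iff)
    next
      case (mult x y)
      then show ?case using h(3) c(4) by (metis (no_types, lifting) image_iff)
    qed
    then show ?thesis by blast
  qed
  moreover have "\<sigma> (\<tau> x) = \<tau> (\<sigma> x)"
    if s: "\<sigma> \<in> galois_group K ?M" and t: "\<tau> \<in> galois_group K ?M" and x: "x \<in> ?M" for \<sigma> \<tau> x
  proof -
    note hs = hom_on_field[OF M galois_groupD(1)[OF s]]
      and ht = hom_on_field[OF M galois_groupD(1)[OF t]]
      and c = subfield_closed[OF M]
    have in_M: "\<sigma> y \<in> ?M" "\<tau> y \<in> ?M" if "y \<in> ?M" for y
      using galois_groupD(2)[OF s] galois_groupD(2)[OF t] that by blast+
    show ?thesis using x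
    proof (induction rule: compositum_induct)
      case (incl F x)
      have "\<sigma> \<in> galois_group K F" "\<tau> \<in> galois_group K F"
        using restrict_galois[OF s compositum_upper gal] restrict_galois[OF t compositum_upper gal]
          incl(1) by blast+
      then show ?case using ab[OF incl(1)] incl(2) by (simp add: abelian_extension_def)
    qed (simp_all add: hs ht in_M)
  qed
  ultimately show ?thesis
    by (simp add: abelian_extension_def galois_extension_def)
qed

lemma abelian_extension_refl:
  assumes "subfield K complex_ring"
  shows "abelian_extension K K"
proof -
  have "(ring.algebraic complex_ring over K) x" if "x \<in> K" for x
    using domain.algebraic_self[OF field.axioms(1)[OF field_complex_ring] subfieldE(1)[OF assms] that] .
  moreover have "\<sigma> ` K = K" if "\<sigma> \<in> embeddings K K" for \<sigma>
    using that by (auto simp: embeddings_def)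
  moreover have "\<sigma> (\<tau> x) = \<tau> (\<sigma> x)"
    if "\<sigma> \<in> galois_group K K" "\<tau> \<in> galois_group K K" "x \<in> K" for \<sigma> \<tau> x
    using that by (simp add: galois_group_def)
  ultimately show ?thesis
    using assms by (simp add: abelian_extension_def galois_extension_def algebraic_extension_def)
qed

lemma maximal_abelian_subextension_greatest:
  assumes "subfield K complex_ring" "subfield E complex_ring" "K \<subseteq> E"
  shows "abelian_extension K (maximal_abelian_subextension K E)"
    and "maximal_abelian_subextension K E \<subseteq> E"
    and "abelian_extension K F \<Longrightarrow> F \<subseteq> E \<Longrightarrow> F \<subseteq> maximal_abelian_subextension K E"
    and "maximal_abelian_subextension K E = compositum {F. abelian_extension K F \<and> F \<subseteq> E}"
proof -
  let ?\<F> = "{F. abelian_extension K F \<and> F \<subseteq> E}"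
  have ab: "abelian_extension K (compositum ?\<F>)"
    by (rule abelian_extension_compositum) (use abelian_extension_refl[OF assms(1)] assms(3) in auto)
  have le: "compositum ?\<F> \<subseteq> E"
    by (rule compositum_least[OF assms(2)]) simp
  have gr: "F \<subseteq> compositum ?\<F>" if "abelian_extension K F \<and> F \<subseteq> E" for F
    using that compositum_upper[of F ?\<F>] by simp
  show eq: "maximal_abelian_subextension K E = compositum ?\<F>"
    unfolding maximal_abelian_subextension_def
    by (rule Greatest_equality) (use ab le gr in auto)
  show "abelian_extension K (maximal_abelian_subextension K E)"
    "maximal_abelian_subextension K E \<subseteq> E"
    "abelian_extension K F \<Longrightarrow> F \<subseteq> E \<Longrightarrow> F \<subseteq> maximal_abelian_subextension K E"
    using ab le gr eq by auto
qed


section \<open>Totally real and totally positive numbers\<close>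

text \<open>
  \<open>conjugates x\<close> is the set of complex roots of the minimal polynomial of \<open>x\<close> over the rationals;
  it is empty if \<open>x\<close> is transcendental.
\<close>

definition is_min_poly :: "rat poly \<Rightarrow> complex \<Rightarrow> bool" where
  "is_min_poly p x \<longleftrightarrow> Polynomial.lead_coeff p = 1
     \<and> Factorial_Ring.irreducible p \<and> poly (map_poly of_rat p) x = 0"

definition conjugates :: "complex \<Rightarrow> complex set" where
  "conjugates x = {y. \<exists>p. is_min_poly p x \<and> poly (map_poly of_rat p) y = 0}"

definition totally_real :: "complex \<Rightarrow> bool" where
  "totally_real x \<longleftrightarrow> Polynomial.algebraic x \<and> (\<forall>y\<in>conjugates x. y \<in> \<real>)"

definition totally_positive :: "complex \<Rightarrow> bool" where
  "totally_positive x \<longleftrightarrow> Polynomial.algebraic x \<and> (\<forall>y\<in>conjugates x. y \<in> \<real> \<and> 0 < Re y)"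

definition totally_real_field :: "complex set \<Rightarrow> bool" where
  "totally_real_field L \<longleftrightarrow> algebraic_extension \<rat> L \<and> (\<forall>x\<in>L. totally_real x)"

definition ring_of_integers :: "complex set \<Rightarrow> complex set" where
  "ring_of_integers L = {x \<in> L. algebraic_int x}"


section \<open>Quadratic lattices\<close>

definition fin_dim_vectorspace :: "complex set \<Rightarrow> (complex, 'v) module \<Rightarrow> bool" where
  "fin_dim_vectorspace L V \<longleftrightarrow>
     vectorspace (ring_on L) V \<and> vectorspace.fin_dim (ring_on L) V"

definition polar_form ::
    "(complex, 'v) module \<Rightarrow> ('v \<Rightarrow> complex) \<Rightarrow> 'v \<Rightarrow> 'v \<Rightarrow> complex" where
  "polar_form V Q v w = (Q (v \<oplus>\<^bsub>V\<^esub> w) - Q v - Q w) / 2"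

definition bilinear_on ::
    "complex set \<Rightarrow> (complex, 'v) module \<Rightarrow> ('v \<Rightarrow> 'v \<Rightarrow> complex) \<Rightarrow> bool" where
  "bilinear_on L V B \<longleftrightarrow>
     (\<forall>u\<in>carrier V. \<forall>v\<in>carrier V. \<forall>w\<in>carrier V.
        B (u \<oplus>\<^bsub>V\<^esub> v) w = B u w + B v w \<and> B w (u \<oplus>\<^bsub>V\<^esub> v) = B w u + B w v)
     \<and> (\<forall>a\<in>L. \<forall>v\<in>carrier V. \<forall>w\<in>carrier V.
        B (a \<odot>\<^bsub>V\<^esub> v) w = a * B v w \<and> B v (a \<odot>\<^bsub>V\<^esub> w) = a * B v w)"

definition quadratic_map ::
    "complex set \<Rightarrow> (complex, 'v) module \<Rightarrow> ('v \<Rightarrow> complex) \<Rightarrow> bool" where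
  "quadratic_map L V Q \<longleftrightarrow>
     Q \<in> carrier V \<rightarrow> L
     \<and> (\<forall>a\<in>L. \<forall>v\<in>carrier V. Q (a \<odot>\<^bsub>V\<^esub> v) = a\<^sup>2 * Q v)
     \<and> bilinear_on L V (polar_form V Q)"

definition O_lattice :: "complex set \<Rightarrow> (complex, 'v) module \<Rightarrow> 'v set \<Rightarrow> bool" where
  "O_lattice L V \<Lambda> \<longleftrightarrow>
     LinearCombinations.submodule (ring_on (ring_of_integers L)) \<Lambda> V
     \<and> (\<exists>S. finite S \<and> S \<subseteq> \<Lambda>
          \<and> LinearCombinations.module.span (ring_on (ring_of_integers L)) V S = \<Lambda>)"

text \<open>
  A quadratic lattice is given by an ambient space \<open>V\<close>, a lattice \<open>\<Lambda>\<close> in \<open>V\<close> (not required to span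
  \<open>V\<close>) and a quadratic map \<open>Q\<close> on \<open>V\<close>. The properties defined after it use only the values of
  \<open>Q\<close> on \<open>\<Lambda>\<close>.
\<close>

definition quadratic_lattice ::
    "complex set \<Rightarrow> (complex, 'v) module \<Rightarrow> 'v set \<Rightarrow> ('v \<Rightarrow> complex) \<Rightarrow> bool" where
  "quadratic_lattice L V \<Lambda> Q \<longleftrightarrow>
     fin_dim_vectorspace L V \<and> O_lattice L V \<Lambda> \<and> quadratic_map L V Q"

definition integral_quadratic_lattice ::
    "complex set \<Rightarrow> (complex, 'v) module \<Rightarrow> 'v set \<Rightarrow> ('v \<Rightarrow> complex) \<Rightarrow> bool" where
  "integral_quadratic_lattice L V \<Lambda> Q \<longleftrightarrow>
     quadratic_lattice L V \<Lambda> Q \<and> Q ` \<Lambda> \<subseteq> ring_of_integers L"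

definition positive_definite_lattice ::
    "complex set \<Rightarrow> (complex, 'v) module \<Rightarrow> 'v set \<Rightarrow> ('v \<Rightarrow> complex) \<Rightarrow> bool" where
  "positive_definite_lattice L V \<Lambda> Q \<longleftrightarrow>
     integral_quadratic_lattice L V \<Lambda> Q \<and> (\<forall>v\<in>\<Lambda>. v \<noteq> \<zero>\<^bsub>V\<^esub> \<longrightarrow> totally_positive (Q v))"

definition universal_lattice ::
    "complex set \<Rightarrow> (complex, 'v) module \<Rightarrow> 'v set \<Rightarrow> ('v \<Rightarrow> complex) \<Rightarrow> bool" where
  "universal_lattice L V \<Lambda> Q \<longleftrightarrow>
     positive_definite_lattice L V \<Lambda> Q
     \<and> (\<forall>a\<in>ring_of_integers L. totally_positive a \<longrightarrow> (\<exists>v\<in>\<Lambda>. Q v = a))"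

end

theory Submission
  imports Defs "HOL-Computational_Algebra.Fundamental_Theorem_Algebra"
    "HOL-Computational_Algebra.Field_as_Ring" "Jordan_Normal_Form.Char_Poly"
begin

text \<open>
  Let \<open>Q\<close> be universal over \<open>L\<close>, and let the house of a number be the largest absolute value of its
  conjugates. Expanding \<open>Q\<close> along an orthogonal family \<open>e\<close> and representing a totally positive
  translate of \<open>x \<in> \<O>\<^sub>L\<close>, whose house is that of \<open>x\<close> up to a constant factor, bounds the conjugates of the
  integers \<open>B(v, e)\<close> by a multiple of the square root of that house. By descent, \<open>L\<close> is generated by
  finitely many numbers together with its integers of house at most some \<open>T\<close>.

  It remains to see that these integers lie in a finite extension. Enlarge \<open>K\<close> to a normal field
  containing the roots of unity of order \<open>m = d!\<close>; the relevant abelian extension then has exponent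
  \<open>m\<close>, so up to a power of \<open>m\<close> each such integer \<open>x\<close> is a sum of integral radicals, one for each
  character occurring in it. If one of these radicals were ramified over a large prime \<open>p\<close>, some
  \<open>\<sigma>\<close> in the inertia group would move \<open>x\<close>, and \<open>\<sigma> x - x\<close> would be a nonzero integer of bounded house
  highly divisible by \<open>p\<close>, which is impossible. The radicals are therefore unramified outside a
  fixed finite set of primes, and by the arguments of Hurwitz and Minkowski they fall into finitely
  many classes modulo multiplication by elements of \<open>K\<close>.
\<close>

section \<open>Algebraic integers\<close>

text \<open>Since \<open>L\<close> is infinite over \<rat>, ramification is studied for single
  elements inside the field of all algebraic numbers: automorphisms are ring endomorphisms of that
  field, a place above \<open>p\<close> is an absolute value on it, and composing with automorphisms
  gives further places.

  The exponent \<open>d!\<close> comes from letting an automorphism run through the at most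
  \<open>d\<close> roots of a polynomial. Commutativity is what provides simultaneous eigenvectors,
  that is, radicals.

  Bounded house limits a prime as follows. If \<sigma> fixes the unramified radicals and moves
  \<open>x\<close>, a proportion of at least 1/[K:\<rat>] of the conjugates of \<sigma> x - x have
  \<open>p\<close>-adic value at most p^(-1/(m [K:\<rat>])), while all of them are bounded by 2 T in
  absolute value. Comparing both in their product gives the threshold (2 T)^(m [K:\<rat>]^2).

  Class group and unit theorem are bypassed: a radical is controlled by the fractional ideal of
  multipliers making it integral and, once this ideal is fixed, by a norm bound and Minkowski's
  theorem, which leave finitely many integers of bounded house in \<open>K\<close>.\<close>

definition int_span :: "'i set \<Rightarrow> ('i \<Rightarrow> complex) \<Rightarrow> complex set" where
  "int_span I s = {z. \<exists>c::'i \<Rightarrow> int. z = (\<Sum>i\<in>I. of_int (c i) * s i)}"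

lemma int_span_add: "x \<in> int_span I s \<Longrightarrow> y \<in> int_span I s \<Longrightarrow> x + y \<in> int_span I s"
  unfolding int_span_def
proof clarsimp
  fix c d :: "'a \<Rightarrow> int"
  show "\<exists>e::'a \<Rightarrow> int. (\<Sum>i\<in>I. of_int (c i) * s i) + (\<Sum>i\<in>I. of_int (d i) * s i) = (\<Sum>i\<in>I. of_int (e i) * s i)"
    by (rule exI[of _ "\<lambda>i. c i + d i"]) (simp add: sum.distrib algebra_simps)
qed

lemma int_span_int_mult: "x \<in> int_span I s \<Longrightarrow> of_int k * x \<in> int_span I s"
  unfolding int_span_def
proof clarsimp
  fix c :: "'a \<Rightarrow> int"
  show "\<exists>e::'a \<Rightarrow> int. of_int k * (\<Sum>i\<in>I. of_int (c i) * s i) = (\<Sum>i\<in>I. of_int (e i) * s i)"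
    by (rule exI[of _ "\<lambda>i. k * c i"]) (simp add: sum_distrib_left algebra_simps)
qed

lemma int_span_0: "0 \<in> int_span I s"
  unfolding int_span_def by (auto intro: exI[of _ "\<lambda>_. 0"])

lemma int_span_sum: "(\<And>j. j \<in> J \<Longrightarrow> f j \<in> int_span I s) \<Longrightarrow> (\<Sum>j\<in>J. f j) \<in> int_span I s"
  by (induction J rule: infinite_finite_induct) (auto intro: int_span_0 int_span_add)

lemma int_span_base: "finite I \<Longrightarrow> i \<in> I \<Longrightarrow> s i \<in> int_span I s"
  unfolding int_span_def
proof clarsimp
  assume "finite I" "i \<in> I"
  then have "s i = (\<Sum>j\<in>I. of_int (if j = i then 1 else 0) * s j)"
    by (simp add: if_distrib if_distribR sum.delta cong: if_cong)
  then show "\<exists>c::'a \<Rightarrow> int. s i = (\<Sum>i\<in>I. of_int (c i) * s i)"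
    by (rule exI[of _ "\<lambda>j. if j = i then 1 else 0"])
qed

definition stabilizes :: "complex \<Rightarrow> 'i set \<Rightarrow> ('i \<Rightarrow> complex) \<Rightarrow> bool" where
  "stabilizes z I s \<longleftrightarrow> (\<forall>i\<in>I. z * s i \<in> int_span I s)"

lemma stabilizes_span: "stabilizes z I s \<Longrightarrow> x \<in> int_span I s \<Longrightarrow> z * x \<in> int_span I s"
proof -
  assume z: "stabilizes z I s" and "x \<in> int_span I s"
  then obtain c :: "'a \<Rightarrow> int" where x: "x = (\<Sum>i\<in>I. of_int (c i) * s i)"
    by (auto simp: int_span_def)
  have "z * x = (\<Sum>i\<in>I. of_int (c i) * (z * s i))"
    by (simp add: x sum_distrib_left algebra_simps)
  also have "\<dots> \<in> int_span I s"
    using z by (intro int_span_sum int_span_int_mult) (auto simp: stabilizes_def)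
  finally show ?thesis .
qed

lemma stabilizes_add: "stabilizes z I s \<Longrightarrow> stabilizes w I s \<Longrightarrow> stabilizes (z + w) I s"
  by (auto simp: stabilizes_def distrib_right intro: int_span_add)

lemma stabilizes_mult: "stabilizes z I s \<Longrightarrow> stabilizes w I s \<Longrightarrow> stabilizes (z * w) I s"
  using stabilizes_span[of z I s] by (auto simp: stabilizes_def mult.assoc)

text \<open>Determinant trick: multiplication by \<open>z\<close> on the spanning family is an
  integer matrix \<open>A\<close>, the family itself is an eigenvector for \<open>z\<close>, and the
  characteristic polynomial of \<open>A\<close> is monic over the integers. The entry
  \<open>s i0\<close> makes the eigenvector nonzero; the family may be linearly dependent.\<close>

lemma algebraic_int_if_stabilizes:
  assumes "finite I" "stabilizes z I s" "i0 \<in> I" "s i0 \<noteq> 0"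
  shows "algebraic_int z"
proof -
  define n where "n = card I"
  obtain e where e: "bij_betw e {0..<n} I"
    using ex_bij_betw_nat_finite[OF assms(1)] n_def by blast
  have "\<forall>i\<in>I. \<exists>c::'a \<Rightarrow> int. z * s i = (\<Sum>j\<in>I. of_int (c j) * s j)"
    using assms(2) by (auto simp: stabilizes_def int_span_def)
  then obtain C :: "'a \<Rightarrow> 'a \<Rightarrow> int" where C: "\<And>i. i \<in> I \<Longrightarrow> z * s i = (\<Sum>j\<in>I. of_int (C i j) * s j)"
    by metis
  define A where "A = mat n n (\<lambda>(i, j). C (e i) (e j))"
  define v where "v = vec n (\<lambda>i. s (e i))"
  have Ac: "A \<in> carrier_mat n n" by (simp add: A_def)
  have hom: "char_poly (map_mat complex_of_int A) = map_poly of_int (char_poly A)"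
    using of_int_hom.char_poly_hom[OF Ac] by simp
  have "map_mat complex_of_int A *\<^sub>v v = z \<cdot>\<^sub>v v"
  proof (rule eq_vecI)
    fix i assume i: "i < dim_vec (z \<cdot>\<^sub>v v)"
    then have i: "i < n" by (simp add: v_def)
    have "z * s (e i) = (\<Sum>j\<in>I. of_int (C (e i) j) * s j)"
      using C e i by (simp add: bij_betw_apply)
    also have "\<dots> = (\<Sum>j = 0..<n. of_int (C (e i) (e j)) * s (e j))"
      by (rule sum.reindex_bij_betw[OF e, symmetric])
    finally show "(map_mat complex_of_int A *\<^sub>v v) $ i = (z \<cdot>\<^sub>v v) $ i"
      using i by (simp add: A_def v_def scalar_prod_def)
  qed (simp add: A_def v_def)
  moreover have "v \<noteq> 0\<^sub>v n"
  proof -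
    obtain i where "i < n" "e i = i0"
      using e assms(3) by (auto simp: bij_betw_def)
    then have "v $ i \<noteq> 0\<^sub>v n $ i" using assms(4) by (simp add: v_def)
    then show ?thesis by metis
  qed
  ultimately have "eigenvalue (map_mat complex_of_int A) z"
    unfolding eigenvalue_def eigenvector_def by (intro exI[of _ v]) (auto simp: A_def v_def)
  then have "poly (map_poly of_int (char_poly A)) z = 0"
    using eigenvalue_root_char_poly[of "map_mat complex_of_int A" n z] Ac hom by simp
  moreover have "lead_coeff (char_poly A) = 1"
    using degree_monic_char_poly[OF Ac] by simp
  ultimately show ?thesis
    by (auto simp: algebraic_int_altdef_ipoly)
qed

text \<open>The monomials \<open>x ^ i * y ^ j\<close> below the degrees \<open>a\<close>,
  \<open>b\<close> of monic equations span \<int>[x, y], which both numbers stabilise; closure under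
  sums and products then follows from the matrix criterion. The pair \<open>(0, 0)\<close> carries
  the nonzero entry 1.\<close>

lemma algebraic_int_common_span:
  assumes "algebraic_int x" "algebraic_int y"
  shows "\<exists>(I :: (nat \<times> nat) set) s. finite I \<and> (0,0) \<in> I \<and> s (0,0) \<noteq> 0 \<and> stabilizes x I s \<and> stabilizes y I s"
proof -
  have red: "\<exists>a>0. x ^ a \<in> int_span {..<a} (\<lambda>i. x ^ i)" if x: "algebraic_int x" for x :: complex
  proof -
    obtain p where p: "poly (map_poly of_int p) x = 0" "lead_coeff p = (1 :: int)"
      using x by (auto simp: algebraic_int_altdef_ipoly)
    have "degree p \<noteq> 0"
    proof
      assume "degree p = 0"
      with p(2) have "p = 1" by (metis lead_coeff_pCons(1) degree_eq_zeroE lead_coeff_pCons(2) one_pCons)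
      with p(1) show False by simp
    qed
    moreover have "0 = (\<Sum>i\<le>degree p. of_int (coeff p i) * x ^ i)"
      using p(1) by (simp add: poly_altdef degree_map_poly coeff_map_poly)
    then have "x ^ degree p = (\<Sum>i<degree p. of_int (- coeff p i) * x ^ i)"
      using p(2) by (simp add: lessThan_Suc_atMost[symmetric] sum_negf eq_neg_iff_add_eq_0 add.commute)
    ultimately show ?thesis
      by (intro exI[of _ "degree p"]) (auto simp: int_span_def intro!: exI[of _ "\<lambda>i. - coeff p i"])
  qed
  obtain a b where a: "a > 0" "x ^ a \<in> int_span {..<a} (\<lambda>i. x ^ i)"
    and b: "b > 0" "y ^ b \<in> int_span {..<b} (\<lambda>i. y ^ i)"
    using red[OF assms(1)] red[OF assms(2)] by blast
  define I where "I = {..<a} \<times> {..<b}"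
  define s where "s = (\<lambda>(i::nat, j::nat). x ^ i * y ^ j)"
  have fin: "finite I" by (simp add: I_def)
  have base: "x ^ i * y ^ j \<in> int_span I s" if "i < a" "j < b" for i j
    using int_span_base[OF fin, of "(i, j)" s] that by (simp add: s_def I_def)
  have "x * s (i, j) \<in> int_span I s" if "i < a" "j < b" for i j
  proof (cases "Suc i < a")
    case True
    then show ?thesis using base[of "Suc i" j] that by (simp add: s_def mult.assoc)
  next
    case False
    then have i: "Suc i = a" using that by simp
    obtain c where c: "x ^ a = (\<Sum>i<a. of_int (c i) * x ^ i)" using a(2) by (auto simp: int_span_def)
    have "x * s (i, j) = x ^ a * y ^ j" by (simp add: s_def mult.assoc flip: i)
    also have "\<dots> = (\<Sum>i<a. of_int (c i) * (x ^ i * y ^ j))"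
      by (simp add: c sum_distrib_right mult.assoc)
    also have "\<dots> \<in> int_span I s"
      using that by (intro int_span_sum int_span_int_mult base) auto
    finally show ?thesis .
  qed
  moreover have "y * s (i, j) \<in> int_span I s" if "i < a" "j < b" for i j
  proof (cases "Suc j < b")
    case True
    then show ?thesis using base[of i "Suc j"] that by (simp add: s_def mult_ac)
  next
    case False
    then have j: "Suc j = b" using that by simp
    obtain c where c: "y ^ b = (\<Sum>i<b. of_int (c i) * y ^ i)" using b(2) by (auto simp: int_span_def)
    have "y * s (i, j) = x ^ i * y ^ b" by (simp add: s_def mult_ac flip: j)
    also have "\<dots> = (\<Sum>j<b. of_int (c j) * (x ^ i * y ^ j))"
      by (simp add: c sum_distrib_left mult_ac)
    also have "\<dots> \<in> int_span I s"
      using that by (intro int_span_sum int_span_int_mult base) auto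
    finally show ?thesis .
  qed
  ultimately have "stabilizes x I s" "stabilizes y I s"
    by (auto simp: stabilizes_def I_def)
  then show ?thesis
    using a(1) b(1) fin by (intro exI[of _ I] exI[of _ s]) (auto simp: I_def s_def)
qed

lemma algebraic_int_add [intro]: "algebraic_int x \<Longrightarrow> algebraic_int y \<Longrightarrow> algebraic_int (x + y :: complex)"
  and algebraic_int_mult [intro]: "algebraic_int x \<Longrightarrow> algebraic_int y \<Longrightarrow> algebraic_int (x * y :: complex)"
  using algebraic_int_common_span[of x y]
  by (meson algebraic_int_if_stabilizes stabilizes_add stabilizes_mult)+

lemma algebraic_int_diff [intro]:
  "algebraic_int x \<Longrightarrow> algebraic_int y \<Longrightarrow> algebraic_int (x - y :: complex)"
  using algebraic_int_add[of x "- y"] by simp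

lemma algebraic_int_of_int [simp]: "algebraic_int (of_int n :: complex)"
  by (rule int_imp_algebraic_int) simp

lemma algebraic_int_of_nat [simp]: "algebraic_int (of_nat n :: complex)"
  by (rule int_imp_algebraic_int) simp

lemma algebraic_int_1 [simp]: "algebraic_int (1 :: complex)"
  by (rule int_imp_algebraic_int) simp

lemma algebraic_int_power [intro]: "algebraic_int x \<Longrightarrow> algebraic_int (x ^ n :: complex)"
  by (induction n) auto

lemma algebraic_int_sum [intro]:
  "(\<And>i. i \<in> I \<Longrightarrow> algebraic_int (f i :: complex)) \<Longrightarrow> algebraic_int (\<Sum>i\<in>I. f i)"
  by (induction I rule: infinite_finite_induct) auto

lemma algebraic_int_prod [intro]:
  "(\<And>i. i \<in> I \<Longrightarrow> algebraic_int (f i :: complex)) \<Longrightarrow> algebraic_int (\<Prod>i\<in>I. f i)"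
  by (induction I rule: infinite_finite_induct) auto

text \<open>
  The Horner partial sums of an integer polynomial at one of its roots; they are algebraic integers
  even when the root is not.
\<close>

definition horner_part :: "int poly \<Rightarrow> complex \<Rightarrow> nat \<Rightarrow> complex" where
  "horner_part p b k = (\<Sum>i\<le>k. of_int (coeff p (degree p - i)) * b ^ (k - i))"

lemma horner_part_0: "horner_part p b 0 = of_int (lead_coeff p)"
  by (simp add: horner_part_def)

lemma horner_part_Suc:
  "horner_part p b (Suc k) = b * horner_part p b k + of_int (coeff p (degree p - Suc k))"
proof -
  have "(\<Sum>i\<le>k. of_int (coeff p (degree p - i)) * b ^ (Suc k - i))
      = b * (\<Sum>i\<le>k. of_int (coeff p (degree p - i)) * b ^ (k - i))"
    unfolding sum_distrib_left by (rule sum.cong) (auto simp: Suc_diff_le)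
  then show ?thesis by (simp add: horner_part_def)
qed

lemma horner_part_degree: "horner_part p b (degree p) = poly (map_poly of_int p) b"
proof -
  have "horner_part p b (degree p) = (\<Sum>i\<le>degree p. of_int (coeff p i) * b ^ i)"
    unfolding horner_part_def
    by (rule sum.reindex_bij_witness[of _ "\<lambda>i. degree p - i" "\<lambda>i. degree p - i"]) auto
  then show ?thesis by (simp add: poly_altdef degree_map_poly coeff_map_poly)
qed

text \<open>The span of the powers of \<open>b\<close> below the degree \<open>n\<close> is stable
  under multiplication. If \<open>k + j < n\<close> no power overflows; otherwise the equation of
  \<open>b\<close> replaces the leading terms by minus the remaining ones, which have lower degree.
  Nothing is ever divided by the leading coefficient.\<close>

lemma algebraic_int_horner_part:
  assumes "p \<noteq> 0" "poly (map_poly of_int p) b = 0" "k \<le> degree p"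
  shows "algebraic_int (horner_part p b k)"
proof (cases "k = degree p")
  case True
  then show ?thesis using horner_part_degree assms(2) by simp
next
  case False
  define n where "n = degree p"
  have kn: "k < n" using False assms(3) n_def by simp
  define s where "s = (\<lambda>i::nat. b ^ i)"
  have base: "b ^ i \<in> int_span {..<n} s" if "i < n" for i
    using int_span_base[of "{..<n}" i s] that by (simp add: s_def)
  have "horner_part p b k * b ^ j \<in> int_span {..<n} s" if j: "j < n" for j
  proof (cases "k + j < n")
    case True
    have "horner_part p b k * b ^ j = (\<Sum>i\<le>k. of_int (coeff p (n - i)) * b ^ (k - i + j))"
      by (simp add: horner_part_def n_def sum_distrib_right power_add mult.assoc del: Nat.add_diff_assoc2)
    also have "\<dots> \<in> int_span {..<n} s"
      using True by (intro int_span_sum int_span_int_mult base) auto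
    finally show ?thesis .
  next
    case False
    define l where "l = j - (n - k)"
    have jl: "j = n - k + l" using False kn by (simp add: l_def)
    have "(\<Sum>i\<le>n. of_int (coeff p (n - i)) * b ^ (n - i)) = 0"
      using horner_part_degree[of p b] assms(2) by (simp add: horner_part_def n_def)
    moreover have "(\<Sum>i\<le>n. of_int (coeff p (n - i)) * b ^ (n - i))
        = (\<Sum>i\<le>k. of_int (coeff p (n - i)) * b ^ (n - i)) + (\<Sum>i\<in>{k<..n}. of_int (coeff p (n - i)) * b ^ (n - i))"
      using kn by (subst sum.union_disjoint[symmetric]) (auto simp: ivl_disj_un)
    ultimately have "(\<Sum>i\<le>k. of_int (coeff p (n - i)) * b ^ (n - i)) = - (\<Sum>i\<in>{k<..n}. of_int (coeff p (n - i)) * b ^ (n - i))"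
      by (simp add: eq_neg_iff_add_eq_0)
    moreover have "horner_part p b k * b ^ (n - k) = (\<Sum>i\<le>k. of_int (coeff p (n - i)) * b ^ (n - i))"
      unfolding horner_part_def sum_distrib_right n_def[symmetric]
      by (rule sum.cong) (use kn in \<open>auto simp: mult.assoc simp flip: power_add\<close>)
    ultimately have "horner_part p b k * b ^ j = - (\<Sum>i\<in>{k<..n}. of_int (coeff p (n - i)) * b ^ (n - i)) * b ^ l"
      by (metis jl mult.assoc power_add)
    also have "\<dots> = (\<Sum>i\<in>{k<..n}. of_int (- coeff p (n - i)) * b ^ (n - i + l))"
      by (simp add: sum_distrib_right power_add mult.assoc sum_negf del: Nat.add_diff_assoc2)
    also have "\<dots> \<in> int_span {..<n} s"
      using j jl kn by (intro int_span_sum int_span_int_mult base) auto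
    finally show ?thesis .
  qed
  then have "stabilizes (horner_part p b k) {..<n} s" by (simp add: stabilizes_def s_def)
  then show ?thesis
    by (intro algebraic_int_if_stabilizes[of "{..<n}" _ s 0]) (use kn in \<open>auto simp: s_def\<close>)
qed

text \<open>The Horner part of index 1 is the leading coefficient times \<open>x\<close> plus an
  integer. Its absolute value serves as a natural multiplier, which every automorphism
  fixes.\<close>

lemma algebraic_int_multiple:
  assumes "algebraic (x :: complex)"
  obtains n :: nat where "n > 0" "algebraic_int (of_nat n * x)"
proof -
  obtain p where p: "p \<noteq> 0" "poly (map_poly of_int p) x = 0"
    using assms by (rule algebraicE')
  define c where "c = lead_coeff p"
  have "degree p \<noteq> 0"
  proof
    assume "degree p = 0"
    then obtain a where "p = [:a:]" by (metis degree_eq_zeroE)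
    with p show False by (auto simp: map_poly_pCons)
  qed
  then have "algebraic_int (x * of_int c + of_int (coeff p (degree p - 1)))"
    using algebraic_int_horner_part[OF p, of "Suc 0"] by (simp add: horner_part_Suc horner_part_0 c_def)
  from algebraic_int_diff[OF this algebraic_int_of_int[of "coeff p (degree p - 1)"]]
  have 1: "algebraic_int (x * of_int c)" by simp
  have "of_nat (nat \<bar>c\<bar>) * x = x * of_int c \<or> of_nat (nat \<bar>c\<bar>) * x = - (x * of_int c)"
    by (cases "c \<ge> 0") auto
  then have "algebraic_int (of_nat (nat \<bar>c\<bar>) * x)" using 1 by (metis algebraic_int_minus_iff)
  moreover have "c \<noteq> 0" using p(1) by (simp add: c_def)
  ultimately show ?thesis using that[of "nat \<bar>c\<bar>"] by simp
qed

lemma algebraic_divide_nat: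
  assumes "algebraic_int (of_nat n * x)" "n > 0"
  shows "algebraic (x :: complex)"
proof -
  obtain p where p: "poly (map_poly of_int p) (of_nat n * x) = 0" "lead_coeff p = (1 :: int)"
    using assms(1) by (auto simp: algebraic_int_altdef_ipoly)
  define q :: "int poly" where "q = pcompose p [:0, int n:]"
  have "p \<noteq> 0" using p(2) by auto
  moreover have "degree q = degree p" using assms(2) by (simp add: q_def)
  moreover have "p = [:1:]" if "degree p = 0" using p(2) that by (auto elim: degree_eq_zeroE)
  ultimately have "q \<noteq> 0" by (auto simp: q_def pcompose_eq_0_iff assms(2))
  moreover have "poly (map_poly of_int q) x = 0"
    using p(1) by (simp add: q_def of_int_hom.map_poly_pcompose poly_pcompose of_int_hom.map_poly_pCons_hom mult.commute)
  ultimately show ?thesis by (intro algebraicI[of "map_poly of_int q"]) auto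
qed

lemma algebraic_add [intro]: "algebraic x \<Longrightarrow> algebraic y \<Longrightarrow> algebraic (x + y :: complex)"
  and algebraic_mult [intro]: "algebraic x \<Longrightarrow> algebraic y \<Longrightarrow> algebraic (x * y :: complex)"
proof -
  assume x: "algebraic x" and y: "algebraic y"
  obtain a :: nat where a: "a > 0" "algebraic_int (of_nat a * x)"
    using x by (rule algebraic_int_multiple)
  obtain b :: nat where b: "b > 0" "algebraic_int (of_nat b * y)"
    using y by (rule algebraic_int_multiple)
  have "algebraic_int (of_nat b * (of_nat a * x) + of_nat a * (of_nat b * y))"
    by (rule algebraic_int_add[OF algebraic_int_mult[OF algebraic_int_of_nat a(2)] algebraic_int_mult[OF algebraic_int_of_nat b(2)]])
  then have "algebraic_int (of_nat (a * b) * (x + y))" by (simp add: algebra_simps)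
  then show "algebraic (x + y)" by (rule algebraic_divide_nat) (use a b in simp)
  have "algebraic_int ((of_nat a * x) * (of_nat b * y))"
    by (rule algebraic_int_mult[OF a(2) b(2)])
  then have "algebraic_int (of_nat (a * b) * (x * y))" by (simp add: algebra_simps)
  then show "algebraic (x * y)" by (rule algebraic_divide_nat) (use a b in simp)
qed

lemma algebraic_diff [intro]: "algebraic x \<Longrightarrow> algebraic y \<Longrightarrow> algebraic (x - y :: complex)"
  using algebraic_add[of x "- y"] by simp

lemma algebraic_power [intro]: "algebraic x \<Longrightarrow> algebraic (x ^ n :: complex)"
  by (induction n) (auto intro: algebraic_int_imp_algebraic)

lemma algebraic_sum [intro]:
  "(\<And>i. i \<in> I \<Longrightarrow> algebraic (f i :: complex)) \<Longrightarrow> algebraic (\<Sum>i\<in>I. f i)"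
  by (induction I rule: infinite_finite_induct) auto

section \<open>Automorphisms of the field of algebraic numbers\<close>

text \<open>
  Graphs of ring homomorphisms into \<open>\<complex>\<close> whose domain consists of algebraic numbers. Single-valuedness
  is the condition on \<open>(0, y)\<close>.
\<close>

definition hom_graph :: "(complex \<times> complex) set \<Rightarrow> bool" where
  "hom_graph r \<longleftrightarrow> (\<forall>q\<in>\<rat>. (q, q) \<in> r) \<and> (\<forall>x y. (x, y) \<in> r \<longrightarrow> algebraic x)
     \<and> (\<forall>x y x' y'. (x, y) \<in> r \<longrightarrow> (x', y') \<in> r \<longrightarrow> (x + x', y + y') \<in> r \<and> (x * x', y * y') \<in> r)
     \<and> (\<forall>y. (0, y) \<in> r \<longrightarrow> y = 0)"

text \<open>The polynomial \<open>g\<close> is the image of \<open>f\<close> under the partial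
  homomorphism \<open>r\<close>, applied to coefficients.\<close>

definition poly_rel :: "(complex \<times> complex) set \<Rightarrow> complex poly \<Rightarrow> complex poly \<Rightarrow> bool" where
  "poly_rel r f g \<longleftrightarrow> (\<forall>i. (coeff f i, coeff g i) \<in> r)"

lemma poly_eq_sum_atMost: "degree p \<le> n \<Longrightarrow> poly p (x :: complex) = (\<Sum>i\<le>n. coeff p i * x ^ i)"
  unfolding poly_altdef by (rule sum.mono_neutral_left) (auto intro: coeff_eq_0)

context
  fixes r :: "(complex \<times> complex) set"
  assumes r: "hom_graph r"
begin

lemma graph_rat: "q \<in> \<rat> \<Longrightarrow> (q, q) \<in> r"
  and graph_algebraic: "(x, y) \<in> r \<Longrightarrow> algebraic x"
  and graph_add: "(x, y) \<in> r \<Longrightarrow> (x', y') \<in> r \<Longrightarrow> (x + x', y + y') \<in> r"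
  and graph_mult: "(x, y) \<in> r \<Longrightarrow> (x', y') \<in> r \<Longrightarrow> (x * x', y * y') \<in> r"
  and graph_0: "(0, y) \<in> r \<Longrightarrow> y = 0"
  using r by (auto simp: hom_graph_def)

lemma graph_uminus: "(x, y) \<in> r \<Longrightarrow> (- x, - y) \<in> r"
  using graph_mult[OF graph_rat[of "-1"], of x y] by simp

lemma graph_diff: "(x, y) \<in> r \<Longrightarrow> (x', y') \<in> r \<Longrightarrow> (x - x', y - y') \<in> r"
  using graph_add[OF _ graph_uminus, of x y x' y'] by simp

lemma graph_unique: "(x, y) \<in> r \<Longrightarrow> (x, y') \<in> r \<Longrightarrow> y = y'"
  using graph_0[of "y - y'"] graph_diff[of x y x y'] by simp

lemma graph_sum: "(\<And>i. i \<in> I \<Longrightarrow> (f i, g i) \<in> r) \<Longrightarrow> (sum f I, sum g I) \<in> r"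
  by (induction I rule: infinite_finite_induct) (auto intro: graph_add graph_rat)

lemma graph_power: "(x, y) \<in> r \<Longrightarrow> (x ^ n, y ^ n) \<in> r"
  by (induction n) (auto intro: graph_mult graph_rat)

lemma poly_rel_add: "poly_rel r f g \<Longrightarrow> poly_rel r f' g' \<Longrightarrow> poly_rel r (f + f') (g + g')"
  by (auto simp: poly_rel_def intro: graph_add)

lemma poly_rel_diff: "poly_rel r f g \<Longrightarrow> poly_rel r f' g' \<Longrightarrow> poly_rel r (f - f') (g - g')"
  by (auto simp: poly_rel_def intro: graph_diff)

lemma poly_rel_mult: "poly_rel r f g \<Longrightarrow> poly_rel r f' g' \<Longrightarrow> poly_rel r (f * f') (g * g')"
  by (auto simp: poly_rel_def coeff_mult intro!: graph_sum graph_mult)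

lemma poly_rel_monom: "(a, b) \<in> r \<Longrightarrow> poly_rel r (Polynomial.monom a k) (Polynomial.monom b k)"
  by (auto simp: poly_rel_def intro: graph_rat)

lemma poly_rel_const: "(a, b) \<in> r \<Longrightarrow> poly_rel r [:a:] [:b:]"
  by (auto simp: poly_rel_def coeff_pCons intro: graph_rat split: nat.splits)

lemma poly_rel_X: "poly_rel r [:0, 1:] [:0, 1:]"
  by (auto simp: poly_rel_def coeff_pCons intro: graph_rat split: nat.splits)

lemma poly_rel_0: "poly_rel r 0 g \<Longrightarrow> g = 0"
  by (auto simp: poly_rel_def poly_eq_iff dest: graph_0)

lemma poly_rel_of_int: "poly_rel r (map_poly of_int p) (map_poly of_int p)"
  by (auto simp: poly_rel_def coeff_map_poly intro: graph_rat)

lemma graph_poly: "poly_rel r f g \<Longrightarrow> (x, y) \<in> r \<Longrightarrow> (poly f x, poly g y) \<in> r"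
  using poly_eq_sum_atMost[of f "max (degree f) (degree g)" x]
    poly_eq_sum_atMost[of g "max (degree f) (degree g)" y]
  by (auto simp: poly_rel_def intro!: graph_sum graph_mult graph_power)

text \<open>A ring of algebraic numbers is a field: an integer polynomial with root \<open>x\<close>
  and nonzero constant term writes \<open>inverse x\<close> as a polynomial in \<open>x\<close>.
  Hence \<open>hom_graph\<close> can do without closure under inverses.\<close>

lemma graph_inverse:
  assumes "(x, y) \<in> r" "x \<noteq> 0"
  obtains z where "(inverse x, z) \<in> r"
proof -
  obtain p where p: "p \<noteq> 0" "coeff p 0 \<noteq> 0" "poly (map_poly of_int p) x = 0"
    using algebraicE'_nonzero[OF graph_algebraic[OF assms(1)] assms(2)] by blast
  obtain c q where q: "p = pCons c q" by (rule pCons_cases)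
  have "of_int c + x * poly (map_poly of_int q) x = 0" "c \<noteq> 0"
    using p(2,3) by (simp_all add: q of_int_hom.map_poly_pCons_hom)
  then have "inverse x = (- inverse (of_int c)) * poly (map_poly of_int q) x"
    using assms(2) by (simp add: field_simps eq_neg_iff_add_eq_0 add.commute)
  moreover have "((- inverse (of_int c)) * poly (map_poly of_int q) x, (- inverse (of_int c)) * poly (map_poly of_int q) y) \<in> r"
    by (intro graph_mult graph_poly poly_rel_of_int assms graph_rat) auto
  ultimately show ?thesis using that by metis
qed

lemma graph_inj: "(x, 0) \<in> r \<Longrightarrow> x = 0"
proof (rule ccontr)
  assume x: "(x, 0) \<in> r" "x \<noteq> 0"
  then obtain z where "(inverse x, z) \<in> r" by (rule graph_inverse)
  from graph_mult[OF x(1) this] have "(1, 0) \<in> r" using x(2) by simp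
  from graph_unique[OF this graph_rat[of 1]] show False by simp
qed

text \<open>The polynomial \<open>f0\<close> has least degree among those over the domain of
  \<open>r\<close> that vanish at \<open>x\<close>, so it divides each of them. Pseudo-division by
  \<open>f0\<close> is carried out in parallel on \<open>f\<close> and on its image
  \<open>g\<close>.\<close>

lemma minimal_poly_root:
  assumes f0: "poly_rel r f0 g0" "f0 \<noteq> 0" "poly f0 x = 0" "poly g0 y = 0"
    and min: "\<And>f g. poly_rel r f g \<Longrightarrow> f \<noteq> 0 \<Longrightarrow> poly f x = 0 \<Longrightarrow> degree f0 \<le> degree f"
    and "poly_rel r f g" "poly f x = 0"
  shows "poly g y = 0"
  using assms(6,7)
\<comment> \<open>The measure puts the zero polynomial strictly below the nonzero constants, whose
  degree is 0 as well.\<close>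
proof (induction "if f = 0 then 0 else Suc (degree f)" arbitrary: f g rule: less_induct)
  case less
  show ?case
  proof (cases "f = 0")
    case True
    then have "g = 0" using poly_rel_0[of g] less.prems(1) by blast
    then show ?thesis by simp
  next
    case False
    define k where "k = degree f - degree f0"
    \<comment> \<open>The image of the leading coefficient of \<open>f0\<close>. It is nonzero by
      injectivity, so the vanishing of \<open>g'\<close> at \<open>y\<close> can be carried back to
      \<open>g\<close>.\<close>
    define b where "b = coeff g0 (degree f0)"
    have ab: "(lead_coeff f0, b) \<in> r" using f0(1) by (simp add: poly_rel_def b_def)
    then have b: "b \<noteq> 0" using graph_inj f0(2) by force
    define f' where "f' = [:lead_coeff f0:] * f - Polynomial.monom (lead_coeff f) k * f0"
    define g' where "g' = [:b:] * g - Polynomial.monom (coeff g (degree f)) k * g0"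
    have le: "degree f0 \<le> degree f" using min less.prems False by blast
    have rel: "poly_rel r f' g'"
      unfolding f'_def g'_def using less.prems(1) f0(1) ab
      by (intro poly_rel_diff poly_rel_mult poly_rel_const poly_rel_monom) (auto simp: poly_rel_def)
    have "poly f' x = 0" using less.prems f0 by (simp add: f'_def)
    moreover have "f' = 0 \<or> degree f' < degree f"
    proof (cases "f' = 0")
      case False
      have "degree (Polynomial.monom (lead_coeff f) k * f0) = degree f"
        using \<open>f \<noteq> 0\<close> f0(2) le by (simp add: degree_mult_eq degree_monom_eq k_def)
      moreover have "degree ([:lead_coeff f0:] * f) = degree f" using f0(2) by simp
      ultimately have "degree f' \<le> degree f" unfolding f'_def by (metis degree_diff_le order_refl)
      moreover have "coeff f' (degree f) = 0"
        using le by (simp add: f'_def coeff_monom_mult k_def)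
      ultimately show ?thesis using False by (metis eq_zero_or_degree_less)
    qed auto
    ultimately have "poly g' y = 0" using less.hyps[OF _ rel] False by auto
    then show ?thesis using b f0(4) by (simp add: g'_def)
  qed
qed

text \<open>The graph grows by all pairs of values of \<open>f\<close> at \<open>x\<close> and
  \<open>g\<close> at \<open>y\<close>; the assumption on \<open>y\<close> says that it stays
  single-valued at 0.\<close>

lemma hom_graph_adjoin:
  assumes x: "algebraic x" and y: "\<And>f g. poly_rel r f g \<Longrightarrow> poly f x = 0 \<Longrightarrow> poly g y = 0"
  obtains r' where "hom_graph r'" "r \<subseteq> r'" "(x, y) \<in> r'"
proof
  define r' where "r' = {(poly f x, poly g y) | f g. poly_rel r f g}"
  have memI: "(poly f x, poly g y) \<in> r'" if "poly_rel r f g" for f g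
    using that by (auto simp: r'_def)
  show sub: "r \<subseteq> r'"
  proof
    fix z assume "z \<in> r"
    then obtain a b where ab: "z = (a, b)" "(a, b) \<in> r" by (cases z) auto
    then show "z \<in> r'" using memI[OF poly_rel_const[OF ab(2)]] by simp
  qed
  show "(x, y) \<in> r'" using memI[OF poly_rel_X] by simp
  show "hom_graph r'"
    unfolding hom_graph_def
  proof (intro conjI ballI allI impI)
    fix a b assume "(a, b) \<in> r'"
    then obtain f g where f: "a = poly f x" "poly_rel r f g" by (auto simp: r'_def)
    then show "algebraic a"
      using x by (auto simp: poly_altdef poly_rel_def intro!: algebraic_sum algebraic_mult algebraic_power dest: graph_algebraic)
  next
    fix a b a' b' assume "(a, b) \<in> r'" "(a', b') \<in> r'"
    then obtain f g f' g' where *: "a = poly f x" "b = poly g y" "poly_rel r f g"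
      "a' = poly f' x" "b' = poly g' y" "poly_rel r f' g'" by (auto simp: r'_def)
    show "(a + a', b + b') \<in> r'" using memI[OF poly_rel_add[OF *(3,6)]] * by simp
    show "(a * a', b * b') \<in> r'" using memI[OF poly_rel_mult[OF *(3,6)]] * by simp
  next
    fix q :: complex assume "q \<in> \<rat>"
    then show "(q, q) \<in> r'" using sub graph_rat by blast
  next
    fix z assume "(0, z) \<in> r'"
    then show "z = 0" using y by (auto simp: r'_def)
  qed
qed

lemma minimal_rel_poly:
  assumes "algebraic x"
  obtains f0 g0 where "poly_rel r f0 g0" "f0 \<noteq> 0" "poly f0 x = 0"
    "\<And>f g. poly_rel r f g \<Longrightarrow> f \<noteq> 0 \<Longrightarrow> poly f x = 0 \<Longrightarrow> degree f0 \<le> degree f"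
proof -
  define P where "P = (\<lambda>n. \<exists>f g. poly_rel r f g \<and> f \<noteq> 0 \<and> poly f x = 0 \<and> degree f = n)"
  obtain p where "p \<noteq> 0" "poly (map_poly of_int p) x = 0"
    using assms by (rule algebraicE')
  then have "P (degree p)"
    unfolding P_def using poly_rel_of_int[of p] by (intro exI[of _ "map_poly of_int p"]) auto
  then have "P (LEAST n. P n)" by (rule LeastI)
  moreover have "(LEAST n. P n) \<le> n" if "P n" for n using that by (rule Least_le)
  ultimately show ?thesis using that unfolding P_def by metis
qed

end

text \<open>Elements act on all complex numbers but are constrained only at algebraic ones, so two
  of them with the same restriction may differ. Bijectivity on the algebraic numbers is a
  consequence, see \<open>Gal_inverse_exists\<close>.\<close>

definition Gal :: "complex set \<Rightarrow> (complex \<Rightarrow> complex) set" where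
  "Gal F = {\<sigma>. (\<forall>x y. algebraic x \<longrightarrow> algebraic y \<longrightarrow> \<sigma> (x + y) = \<sigma> x + \<sigma> y \<and> \<sigma> (x * y) = \<sigma> x * \<sigma> y)
     \<and> \<sigma> 1 = 1 \<and> (\<forall>x\<in>F. \<sigma> x = x)}"

text \<open>Zorn's lemma: a maximal graph has every algebraic number in its domain, since the image
  of the minimal polynomial of a missing \<open>x\<close> has a complex root \<open>y\<close>, and
  then \<open>(x, y)\<close> can be adjoined.\<close>

lemma hom_graph_extend:
  assumes "hom_graph r"
  obtains \<sigma> where "\<sigma> \<in> Gal {}" "\<And>x y. (x, y) \<in> r \<Longrightarrow> \<sigma> x = y"
proof -
  define \<A> where "\<A> = {r'. hom_graph r' \<and> r \<subseteq> r'}"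
  have "\<exists>M\<in>\<A>. \<forall>Y\<in>\<A>. M \<subseteq> Y \<longrightarrow> Y = M"
  proof (rule subset_Zorn_nonempty)
    show "\<A> \<noteq> {}" using assms by (auto simp: \<A>_def)
    fix C assume C: "C \<noteq> {}" "subset.chain \<A> C"
    then have CA: "\<And>c. c \<in> C \<Longrightarrow> hom_graph c \<and> r \<subseteq> c" by (auto simp: subset_chain_def \<A>_def)
    have two: "\<exists>c\<in>C. z \<in> c \<and> w \<in> c" if "z \<in> \<Union>C" "w \<in> \<Union>C" for z w
      using that C(2) unfolding subset_chain_def by blast
    have "hom_graph (\<Union>C)"
      unfolding hom_graph_def
    proof (intro conjI ballI allI impI)
      fix q :: complex assume "q \<in> \<rat>"
      then show "(q, q) \<in> \<Union>C" using C(1) CA graph_rat by blast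
    next
      fix x y assume "(x, y) \<in> \<Union>C"
      then show "algebraic x" using CA graph_algebraic by blast
    next
      fix x y x' y' assume "(x, y) \<in> \<Union>C" "(x', y') \<in> \<Union>C"
      then obtain c where c: "c \<in> C" "(x, y) \<in> c" "(x', y') \<in> c" using two by blast
      then show "(x + x', y + y') \<in> \<Union>C" "(x * x', y * y') \<in> \<Union>C"
        using CA[OF c(1)] graph_add graph_mult by blast+
    next
      fix y assume "(0, y) \<in> \<Union>C"
      then show "y = 0" using CA graph_0 by blast
    qed
    then show "\<Union>C \<in> \<A>" using C(1) CA by (auto simp: \<A>_def)
  qed
  then obtain M where M: "hom_graph M" "r \<subseteq> M" and max: "\<And>Y. hom_graph Y \<Longrightarrow> M \<subseteq> Y \<Longrightarrow> Y = M"
    by (auto simp: \<A>_def)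
  have dom: "\<exists>y. (x, y) \<in> M" if x: "algebraic x" for x
  proof -
    obtain f0 g0 where f0: "poly_rel M f0 g0" "f0 \<noteq> 0" "poly f0 x = 0"
      "\<And>f g. poly_rel M f g \<Longrightarrow> f \<noteq> 0 \<Longrightarrow> poly f x = 0 \<Longrightarrow> degree f0 \<le> degree f"
      using minimal_rel_poly[OF M(1) x] by metis
    have "coeff g0 (degree f0) \<noteq> 0"
      using f0(1,2) graph_inj[OF M(1), of "lead_coeff f0"] unfolding poly_rel_def by (metis leading_coeff_0_iff)
    moreover have "degree f0 > 0" using f0(2,3) by (auto intro!: Nat.gr0I elim!: degree_eq_zeroE)
    ultimately have "degree g0 > 0" by (metis coeff_eq_0 gr0I)
    then have "\<not> constant (poly g0)" by (simp add: constant_degree)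
    then obtain y where y: "poly g0 y = 0" using fundamental_theorem_of_algebra by blast
    have root: "poly g y = 0" if "poly_rel M f g" "poly f x = 0" for f g
      using minimal_poly_root[OF M(1) f0(1-3) y _ that] f0(4) by blast
    obtain M' where "hom_graph M'" "M \<subseteq> M'" "(x, y) \<in> M'"
      by (rule hom_graph_adjoin[OF M(1) x root])
    then show ?thesis using max by blast
  qed
  define \<sigma> where "\<sigma> = (\<lambda>x. SOME y. (x, y) \<in> M)"
  have \<sigma>: "\<sigma> x = y" if "(x, y) \<in> M" for x y
    unfolding \<sigma>_def using that graph_unique[OF M(1)] by blast
  have \<sigma>M: "(x, \<sigma> x) \<in> M" if "algebraic x" for x
    using dom[OF that] \<sigma> by blast
  have "\<sigma> \<in> Gal {}"
    unfolding Gal_def using graph_add[OF M(1) \<sigma>M \<sigma>M] graph_mult[OF M(1) \<sigma>M \<sigma>M] graph_rat[OF M(1), of 1]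
    by (auto intro!: \<sigma>)
  then show ?thesis using that \<sigma> M(2) by blast
qed

context
  fixes F :: "complex set" and \<sigma> :: "complex \<Rightarrow> complex"
  assumes \<sigma>: "\<sigma> \<in> Gal F"
begin

lemma Gal_add: "algebraic x \<Longrightarrow> algebraic y \<Longrightarrow> \<sigma> (x + y) = \<sigma> x + \<sigma> y"
  and Gal_mult: "algebraic x \<Longrightarrow> algebraic y \<Longrightarrow> \<sigma> (x * y) = \<sigma> x * \<sigma> y"
  and Gal_1: "\<sigma> 1 = 1" and Gal_fix: "x \<in> F \<Longrightarrow> \<sigma> x = x"
  using \<sigma> by (auto simp: Gal_def)

lemma Gal_0: "\<sigma> 0 = 0"
  using Gal_add[of 0 0] by simp

lemma Gal_uminus: "algebraic x \<Longrightarrow> \<sigma> (- x) = - \<sigma> x"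
  using Gal_add[of x "- x"] by (simp add: Gal_0 eq_neg_iff_add_eq_0 add.commute)

lemma Gal_diff: "algebraic x \<Longrightarrow> algebraic y \<Longrightarrow> \<sigma> (x - y) = \<sigma> x - \<sigma> y"
  using Gal_add[of x "- y"] Gal_uminus[of y] by simp

lemma Gal_eq_0_iff: "algebraic x \<Longrightarrow> \<sigma> x = 0 \<longleftrightarrow> x = 0"
proof
  assume x: "algebraic x" "\<sigma> x = 0"
  show "x = 0"
  proof (rule ccontr)
    assume "x \<noteq> 0"
    then show False using Gal_mult[of x "inverse x"] x Gal_1 by (auto intro: algebraic_inverse)
  qed
qed (simp add: Gal_0)

lemma Gal_inverse: "algebraic x \<Longrightarrow> \<sigma> (inverse x) = inverse (\<sigma> x)"
proof (cases "x = 0")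
  case False
  assume x: "algebraic x"
  then have "\<sigma> x * \<sigma> (inverse x) = 1"
    using Gal_mult[of x "inverse x"] False Gal_1 by (auto intro: algebraic_inverse)
  then show ?thesis by (metis inverse_unique)
qed (simp add: Gal_0)

lemma Gal_divide: "algebraic x \<Longrightarrow> algebraic y \<Longrightarrow> \<sigma> (x / y) = \<sigma> x / \<sigma> y"
  using Gal_mult[of x "inverse y"] Gal_inverse[of y] by (simp add: divide_inverse algebraic_inverse)

lemma Gal_power: "algebraic x \<Longrightarrow> \<sigma> (x ^ n) = \<sigma> x ^ n"
  by (induction n) (auto simp: Gal_1 Gal_mult algebraic_power)

lemma Gal_sum: "(\<And>i. i \<in> I \<Longrightarrow> algebraic (f i)) \<Longrightarrow> \<sigma> (\<Sum>i\<in>I. f i) = (\<Sum>i\<in>I. \<sigma> (f i))"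
  by (induction I rule: infinite_finite_induct) (auto simp: Gal_0 Gal_add algebraic_sum)

lemma Gal_prod: "(\<And>i. i \<in> I \<Longrightarrow> algebraic (f i)) \<Longrightarrow> \<sigma> (\<Prod>i\<in>I. f i) = (\<Prod>i\<in>I. \<sigma> (f i))"
proof (induction I rule: infinite_finite_induct)
  case (insert i I)
  have "algebraic (\<Prod>i\<in>I. f i)"
    using insert.prems by (induction I rule: infinite_finite_induct) (auto intro: rat_imp_algebraic)
  then show ?case using insert by (auto simp: Gal_mult)
qed (auto simp: Gal_1)

lemma Gal_of_nat: "\<sigma> (of_nat n) = of_nat n"
  by (induction n) (auto simp: Gal_0 Gal_1 Gal_add intro: rat_imp_algebraic)

lemma Gal_of_int: "\<sigma> (of_int n) = of_int n"
  by (cases n) (auto simp: Gal_of_nat Gal_uminus rat_imp_algebraic simp del: of_nat_Suc)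

lemma Gal_rat: "q \<in> \<rat> \<Longrightarrow> \<sigma> q = q"
  by (auto elim!: Rats_cases' simp: Gal_of_int Gal_divide rat_imp_algebraic)

lemma Gal_poly:
  assumes "algebraic x" "\<And>i. coeff f i \<in> \<rat>"
  shows "\<sigma> (poly f x) = poly f (\<sigma> x)"
  using assms by (simp add: poly_altdef Gal_sum Gal_mult Gal_power Gal_rat algebraic_power algebraic_mult rat_imp_algebraic)

lemma Gal_algebraic: "algebraic x \<Longrightarrow> algebraic (\<sigma> x)"
proof -
  assume x: "algebraic x"
  then obtain f where f: "\<And>i. coeff f i \<in> \<int>" "f \<noteq> 0" "poly f x = 0"
    by (auto elim!: algebraicE)
  then have "poly f (\<sigma> x) = 0"
    using Gal_poly[OF x, of f] Ints_subset_Rats Gal_0 by auto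
  with f show ?thesis by (auto intro: algebraicI)
qed

lemma Gal_algebraic_int: "algebraic_int x \<Longrightarrow> algebraic_int (\<sigma> x)"
proof -
  assume x: "algebraic_int x"
  then obtain f where f: "lead_coeff f = 1" "\<forall>i. coeff f i \<in> \<int>" "poly f x = 0"
    by (auto simp: algebraic_int.simps)
  then have "poly f (\<sigma> x) = 0"
    using Gal_poly[of x f] x Ints_subset_Rats Gal_0 by auto
  with f show ?thesis by (auto intro: algebraic_int.intros)
qed

lemma Gal_inj: "algebraic x \<Longrightarrow> algebraic y \<Longrightarrow> \<sigma> x = \<sigma> y \<longleftrightarrow> x = y"
  using Gal_diff[of x y] Gal_eq_0_iff[of "x - y"] algebraic_diff[of x y] by auto

end

lemma Gal_mono: "\<sigma> \<in> Gal F \<Longrightarrow> F' \<subseteq> F \<Longrightarrow> \<sigma> \<in> Gal F'"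
  by (auto simp: Gal_def)

lemma Gal_Rats:
  assumes "\<sigma> \<in> Gal F"
  shows "\<sigma> \<in> Gal \<rat>"
  unfolding Gal_def mem_Collect_eq
  using Gal_add[OF assms] Gal_mult[OF assms] Gal_1[OF assms] Gal_rat[OF assms] by blast

lemma cnj_Gal: "cnj \<in> Gal \<rat>"
proof -
  have "cnj q = q" if "q \<in> \<rat>" for q
    using that by (cases q rule: Rats_cases') simp_all
  then show ?thesis by (simp add: Gal_def)
qed

lemma Gal_comp:
  assumes \<sigma>: "\<sigma> \<in> Gal F" and \<tau>: "\<tau> \<in> Gal F"
  shows "\<sigma> \<circ> \<tau> \<in> Gal F"
  unfolding Gal_def mem_Collect_eq
proof (intro conjI allI impI ballI)
  fix x y :: complex assume "algebraic x" "algebraic y"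
  then show "(\<sigma> \<circ> \<tau>) (x + y) = (\<sigma> \<circ> \<tau>) x + (\<sigma> \<circ> \<tau>) y" "(\<sigma> \<circ> \<tau>) (x * y) = (\<sigma> \<circ> \<tau>) x * (\<sigma> \<circ> \<tau>) y"
    using Gal_algebraic[OF \<tau>] by (simp_all add: Gal_add[OF \<tau>] Gal_mult[OF \<tau>] Gal_add[OF \<sigma>] Gal_mult[OF \<sigma>])
qed (simp_all add: Gal_1[OF \<sigma>] Gal_1[OF \<tau>] Gal_fix[OF \<sigma>] Gal_fix[OF \<tau>])

lemma id_Gal: "id \<in> Gal F"
  by (simp add: Gal_def)

lemma finite_rat_poly_orbit:
  assumes "algebraic x"
  shows "finite ((\<lambda>\<sigma>. \<sigma> x) ` Gal F)"
proof -
  obtain f where f: "\<And>i. coeff f i \<in> \<int>" "f \<noteq> 0" "poly f x = 0"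
    using algebraicE[OF assms] by blast
  have "poly f (\<sigma> x) = 0" if "\<sigma> \<in> Gal F" for \<sigma>
    using Gal_poly[OF that assms, of f] f Gal_0[OF that] Ints_subset_Rats by auto
  then have "(\<lambda>\<sigma>. \<sigma> x) ` Gal F \<subseteq> {y. poly f y = 0}" by auto
  then show ?thesis using poly_roots_finite[OF f(2)] finite_subset by blast
qed

text \<open>Each \<sigma> maps the finite orbit of \<open>x\<close> injectively into itself, hence
  onto it. At transcendental numbers, where nothing is required, the inverse is set to be the
  identity.\<close>

lemma Gal_inverse_exists:
  assumes \<sigma>: "\<sigma> \<in> Gal F" and F: "\<forall>x\<in>F. algebraic x"
  obtains \<tau> where "\<tau> \<in> Gal F" "\<And>x. algebraic x \<Longrightarrow> \<sigma> (\<tau> x) = x" "\<And>x. algebraic x \<Longrightarrow> \<tau> (\<sigma> x) = x"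
proof -
  have surj: "\<exists>y. algebraic y \<and> \<sigma> y = x" if x: "algebraic x" for x
  proof -
    define O' where "O' = (\<lambda>\<tau>. \<tau> x) ` Gal F"
    have alg: "algebraic y" if "y \<in> O'" for y using that x Gal_algebraic by (auto simp: O'_def)
    have "\<sigma> ` O' \<subseteq> O'"
      using Gal_comp[OF \<sigma>] by (auto simp: O'_def image_iff intro!: bexI[of _ "\<sigma> \<circ> _"])
    moreover have "inj_on \<sigma> O'" using Gal_inj[OF \<sigma>] alg by (auto simp: inj_on_def)
    ultimately have "\<sigma> ` O' = O'"
      using finite_rat_poly_orbit[OF x] endo_inj_surj unfolding O'_def by metis
    moreover have "x \<in> O'" unfolding O'_def using imageI[OF id_Gal, of "\<lambda>\<tau>. \<tau> x"] by simp
    ultimately show ?thesis using alg by (metis imageE)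
  qed
  define \<tau> where "\<tau> = (\<lambda>x. if algebraic x then SOME y. algebraic y \<and> \<sigma> y = x else x)"
  have \<tau>: "algebraic (\<tau> x)" "\<sigma> (\<tau> x) = x" if "algebraic x" for x
    using someI_ex[OF surj[OF that]] that by (auto simp: \<tau>_def)
  have eq: "\<tau> x = y" if "algebraic x" "algebraic y" "\<sigma> y = x" for x y
    using \<tau>[OF that(1)] Gal_inj[OF \<sigma>, of "\<tau> x" y] that by simp
  have "\<tau> \<in> Gal F"
    unfolding Gal_def
  proof (intro CollectI conjI allI impI ballI)
    fix x y :: complex assume xy: "algebraic x" "algebraic y"
    show "\<tau> (x + y) = \<tau> x + \<tau> y" "\<tau> (x * y) = \<tau> x * \<tau> y"
      using xy \<tau> by (auto intro!: eq simp: Gal_add[OF \<sigma>] Gal_mult[OF \<sigma>])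
  next
    show "\<tau> 1 = 1" using Gal_1[OF \<sigma>] by (intro eq) (auto intro: rat_imp_algebraic)
  next
    fix x assume "x \<in> F"
    then show "\<tau> x = x" using F Gal_fix[OF \<sigma>] by (intro eq) auto
  qed
  then show ?thesis using that \<tau> eq Gal_algebraic[OF \<sigma>] by metis
qed

text \<open>Inverses are omitted because rings of algebraic numbers have them automatically
  (\<open>alg_field_inverse\<close>); this makes sets of sums or of polynomial values easy to
  recognise as fields.\<close>

definition alg_field :: "complex set \<Rightarrow> bool" where
  "alg_field F \<longleftrightarrow> \<rat> \<subseteq> F \<and> (\<forall>x\<in>F. algebraic x) \<and> (\<forall>x\<in>F. \<forall>y\<in>F. x + y \<in> F \<and> x * y \<in> F)"

lemma hom_graph_Id_on: "alg_field F \<Longrightarrow> hom_graph (Id_on F)"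
  by (auto simp: alg_field_def hom_graph_def)

lemma poly_rel_Id_on: "poly_rel (Id_on F) f g \<longleftrightarrow> f = g \<and> (\<forall>i. coeff f i \<in> F)"
  by (auto simp: poly_rel_def poly_eq_iff Id_on_iff)

context
  fixes F :: "complex set"
  assumes F: "alg_field F"
begin

lemma alg_field_algebraic: "x \<in> F \<Longrightarrow> algebraic x"
  and alg_field_rat: "x \<in> \<rat> \<Longrightarrow> x \<in> F"
  and alg_field_add: "x \<in> F \<Longrightarrow> y \<in> F \<Longrightarrow> x + y \<in> F"
  and alg_field_mult: "x \<in> F \<Longrightarrow> y \<in> F \<Longrightarrow> x * y \<in> F"
  using F by (auto simp: alg_field_def)

lemma alg_field_uminus: "x \<in> F \<Longrightarrow> - x \<in> F"
  using alg_field_mult[OF alg_field_rat[of "-1"], of x] by simp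

lemma alg_field_diff: "x \<in> F \<Longrightarrow> y \<in> F \<Longrightarrow> x - y \<in> F"
  using alg_field_add[OF _ alg_field_uminus, of x y] by simp

lemma alg_field_inverse: "x \<in> F \<Longrightarrow> inverse x \<in> F"
proof (cases "x = 0")
  case False
  assume "x \<in> F"
  then have "(x, x) \<in> Id_on F" by (rule Id_onI)
  with graph_inverse[OF hom_graph_Id_on[OF F] this False] show ?thesis by blast
qed (use alg_field_rat in auto)

lemma alg_field_divide: "x \<in> F \<Longrightarrow> y \<in> F \<Longrightarrow> x / y \<in> F"
  using alg_field_mult[OF _ alg_field_inverse] by (simp add: divide_inverse)

lemma alg_field_power: "x \<in> F \<Longrightarrow> x ^ n \<in> F"
  by (induction n) (auto intro: alg_field_mult alg_field_rat)

lemma alg_field_sum: "(\<And>i. i \<in> I \<Longrightarrow> f i \<in> F) \<Longrightarrow> (\<Sum>i\<in>I. f i) \<in> F"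
  by (induction I rule: infinite_finite_induct) (auto intro: alg_field_add alg_field_rat)

lemma alg_field_prod: "(\<And>i. i \<in> I \<Longrightarrow> f i \<in> F) \<Longrightarrow> (\<Prod>i\<in>I. f i) \<in> F"
  by (induction I rule: infinite_finite_induct) (auto intro: alg_field_mult alg_field_rat)

text \<open>The minimal polynomial of \<open>x\<close> over \<open>F\<close> has degree at least 2
  and a simple root at \<open>x\<close>, hence a second root \<open>y\<close>; sending
  \<open>x\<close> to \<open>y\<close> extends to an element of \<open>Gal F\<close>.\<close>

lemma Gal_moves:
  assumes x: "algebraic x" "x \<notin> F"
  obtains \<sigma> where "\<sigma> \<in> Gal F" "\<sigma> x \<noteq> x"
proof -
  let ?r = "Id_on F"
  note r = hom_graph_Id_on[OF F]
  obtain f where f: "poly_rel ?r f f" "f \<noteq> 0" "poly f x = 0"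
    and min: "\<And>g h. poly_rel ?r g h \<Longrightarrow> g \<noteq> 0 \<Longrightarrow> poly g x = 0 \<Longrightarrow> degree f \<le> degree g"
    using minimal_rel_poly[OF r x(1)] poly_rel_Id_on by metis
  have fF: "coeff f i \<in> F" for i using f(1) by (simp add: poly_rel_Id_on)
  have d0: "degree f \<noteq> 0" using f(2,3) by (auto elim!: degree_eq_zeroE)
  have d1: "degree f \<noteq> 1"
  proof
    assume d: "degree f = 1"
    then have "coeff f 0 + coeff f 1 * x = 0" using f(3) by (simp add: poly_altdef)
    moreover have "coeff f 1 \<noteq> 0" using f(2) d by (metis leading_coeff_0_iff)
    ultimately have "x = - coeff f 0 / coeff f 1" by (simp add: field_simps eq_neg_iff_add_eq_0 add.commute)
    then show False using x(2) fF alg_field_divide alg_field_uminus by metis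
  qed
  \<comment> \<open>Separability in characteristic 0: the derivative is nonzero, of smaller degree
    and over the same field, so minimality forbids it to vanish at \<open>x\<close>.\<close>
  have "poly_rel ?r (pderiv f) (pderiv f)"
    using fF alg_field_rat by (auto simp: poly_rel_Id_on coeff_pderiv simp del: of_nat_Suc intro!: alg_field_mult)
  then have "poly (pderiv f) x \<noteq> 0"
    using min[of "pderiv f" "pderiv f"] d0 by (auto simp: degree_pderiv pderiv_eq_0_iff)
  obtain h where h: "f = [:- x, 1:] * h"
    using f(3) by (auto simp: poly_eq_0_iff_dvd dvd_def)
  have "pderiv f = h + [:- x, 1:] * pderiv h"
    unfolding h by (simp only: pderiv_mult) (simp add: pderiv_pCons)
  then have "poly h x \<noteq> 0" using \<open>poly (pderiv f) x \<noteq> 0\<close> by simp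
  have "h \<noteq> 0" using f(2) h by auto
  then have "degree f = degree [:- x, 1:] + degree h" unfolding h by (intro degree_mult_eq) auto
  then have "degree f = Suc (degree h)" by simp
  then have "degree h \<noteq> 0" using d1 by simp
  then obtain y where y: "poly h y = 0"
    using fundamental_theorem_of_algebra[of h] by (auto simp: constant_degree)
  then have xy: "y \<noteq> x" using \<open>poly h x \<noteq> 0\<close> by auto
  have "poly f y = 0" using y h by simp
  then have root: "poly h y = 0" if "poly_rel ?r g h" "poly g x = 0" for g h
    using minimal_poly_root[OF r f(1-3) _ _ that] min by blast
  obtain r' where r': "hom_graph r'" "?r \<subseteq> r'" "(x, y) \<in> r'"
    by (rule hom_graph_adjoin[OF r x(1) root])
  obtain \<sigma> where "\<sigma> \<in> Gal {}" "\<And>x y. (x, y) \<in> r' \<Longrightarrow> \<sigma> x = y"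
    using hom_graph_extend[OF r'(1)] by blast
  then have "\<sigma> \<in> Gal F" "\<sigma> x \<noteq> x" using r'(2,3) xy by (auto simp: Gal_def)
  then show ?thesis using that by blast
qed

lemma fixed_by_Gal: "algebraic x \<Longrightarrow> (\<And>\<sigma>. \<sigma> \<in> Gal F \<Longrightarrow> \<sigma> x = x) \<Longrightarrow> x \<in> F"
  using Gal_moves by metis

end

lemma alg_field_Rats: "alg_field \<rat>"
  by (auto simp: alg_field_def rat_imp_algebraic)

lemma alg_field_algebraics: "alg_field {x. algebraic x}"
  by (auto simp: alg_field_def rat_imp_algebraic)

section \<open>Minimal polynomials over \<rat>, and conjugates as Galois orbits\<close>

lemma map_poly_of_rat_mult:
  "map_poly of_rat (a * b) = (map_poly of_rat a * map_poly of_rat b :: 'a :: field_char_0 poly)"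
  by (rule poly_eqI) (simp add: coeff_map_poly coeff_mult of_rat_sum of_rat_mult)

lemma map_poly_of_rat_add:
  "map_poly of_rat (a + b) = (map_poly of_rat a + map_poly of_rat b :: 'a :: field_char_0 poly)"
  by (rule poly_eqI) (simp add: coeff_map_poly of_rat_add)

lemma map_poly_of_rat_smult:
  "map_poly of_rat (Polynomial.smult c b) = (Polynomial.smult (of_rat c) (map_poly of_rat b) :: 'a :: field_char_0 poly)"
  by (rule poly_eqI) (simp add: coeff_map_poly of_rat_mult)

lemma min_poly_exists:
  assumes "algebraic x"
  obtains p where "is_min_poly p x"
proof -
  have ex: "\<exists>q. Factorial_Ring.irreducible q \<and> poly (map_poly of_rat q) x = 0"
    if "p \<noteq> 0" "poly (map_poly of_rat p) x = 0" for p
    using that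
  proof (induction "degree p" arbitrary: p rule: less_induct)
    case less
    show ?case
    proof (cases "Factorial_Ring.irreducible p")
      case False
      have "degree p \<noteq> 0"
        using less.prems by (auto elim!: degree_eq_zeroE simp: of_rat_hom.map_poly_pCons_hom)
      then have "\<not> p dvd 1" by (auto simp: is_unit_iff_degree[OF less.prems(1)])
      then obtain a b where ab: "p = a * b" "\<not> a dvd 1" "\<not> b dvd 1"
        using False less.prems(1) by (auto simp: Factorial_Ring.irreducible_def)
      have nz: "a \<noteq> 0" "b \<noteq> 0" using ab less.prems by auto
      then have deg: "degree a < degree p" "degree b < degree p"
        using ab(2,3) by (auto simp: ab(1) degree_mult_eq is_unit_iff_degree)
      have "poly (map_poly of_rat a) x = 0 \<or> poly (map_poly of_rat b) x = 0"
        using less.prems(2) by (simp add: ab(1) map_poly_of_rat_mult map_poly_of_rat_add map_poly_of_rat_smult)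
      then show ?thesis using less.hyps[OF deg(1) nz(1)] less.hyps[OF deg(2) nz(2)] by blast
    qed (use less.prems in blast)
  qed
  obtain p where p: "p \<noteq> 0" "poly (map_poly of_int p) x = 0" using assms by (rule algebraicE')
  have "map_poly of_rat (map_poly of_int p) = (map_poly of_int p :: complex poly)"
    by (simp add: map_poly_map_poly o_def)
  then obtain q where q: "Factorial_Ring.irreducible q" "poly (map_poly of_rat q) x = 0"
    using ex[of "map_poly of_int p"] p by auto
  define c where "c = inverse (lead_coeff q)"
  have c: "c \<noteq> 0" using q(1) by (auto simp: c_def)
  have "[:c:] dvd 1" using c by (simp add: is_unit_const_poly_iff)
  from irreducible_mult_unit_left[OF this, of q]
  have "Factorial_Ring.irreducible (Polynomial.smult c q)" using q(1) by simp
  moreover have "lead_coeff (Polynomial.smult c q) = 1" using c q(1) by (auto simp: c_def)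
  moreover have "poly (map_poly of_rat (Polynomial.smult c q)) x = 0" using q(2) by (simp add: map_poly_of_rat_mult map_poly_of_rat_add map_poly_of_rat_smult)
  ultimately have "is_min_poly (Polynomial.smult c q) x" unfolding is_min_poly_def by blast
  then show ?thesis by (rule that)
qed

lemma min_poly_dvd:
  assumes "is_min_poly p x" "poly (map_poly of_rat f) x = 0"
  shows "p dvd f"
proof (rule ccontr)
  assume ndvd: "\<not> p dvd f"
  have "Factorial_Ring.irreducible p" using assms(1) by (simp add: is_min_poly_def)
  from prime_elem_imp_coprime[OF field_poly_irreducible_imp_prime[OF this] ndvd]
  have "Rings.coprime p f" .
  then have "gcd p f = 1" by (rule coprime_imp_gcd_eq_1)
  then obtain a b where "a * p + b * f = 1"
    using bezout_coefficients_fst_snd[of p f] by metis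
  then have "poly (map_poly of_rat (a * p + b * f)) x = (1 :: complex)" by simp
  moreover have "poly (map_poly of_rat p) x = 0" using assms(1) by (simp add: is_min_poly_def)
  ultimately show False
    using assms(2) by (simp add: map_poly_of_rat_mult map_poly_of_rat_add map_poly_of_rat_smult)
qed

text \<open>A root \<open>y\<close> of the minimal polynomial of \<open>x\<close> is a root of every
  rational polynomial vanishing at \<open>x\<close>, so \<open>x \<mapsto> y\<close> extends to an
  automorphism. Total reality and positivity are used only in this orbit form.\<close>

lemma conjugates_eq_orbit:
  assumes x: "algebraic x"
  shows "conjugates x = (\<lambda>\<sigma>. \<sigma> x) ` Gal \<rat>"
proof (intro equalityI subsetI)
  fix y assume "y \<in> conjugates x"
  then obtain p where p: "is_min_poly p x" "poly (map_poly of_rat p) y = 0"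
    by (auto simp: conjugates_def)
  have "poly g y = 0" if fg: "poly_rel (Id_on \<rat>) f g" and "poly f x = 0" for f g
  proof -
    obtain f' where f': "f = map_poly of_rat f'"
      using fg ratpolyE[of f] by (auto simp: poly_rel_Id_on)
    then have "p dvd f'" using min_poly_dvd[OF p(1)] that(2) by simp
    then have "poly f y = 0" using p(2) by (auto simp: f' dvd_def map_poly_of_rat_mult map_poly_of_rat_add map_poly_of_rat_smult)
    then show ?thesis using fg by (simp add: poly_rel_Id_on)
  qed
  then obtain r' where r': "hom_graph r'" "Id_on \<rat> \<subseteq> r'" "(x, y) \<in> r'"
    using hom_graph_adjoin[OF hom_graph_Id_on[OF alg_field_Rats] x, of y] by metis
  obtain \<sigma> where "\<sigma> \<in> Gal {}" "\<And>x y. (x, y) \<in> r' \<Longrightarrow> \<sigma> x = y"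
    using hom_graph_extend[OF r'(1)] by blast
  then show "y \<in> (\<lambda>\<sigma>. \<sigma> x) ` Gal \<rat>" using r'(3) Gal_Rats by blast
next
  fix y assume "y \<in> (\<lambda>\<sigma>. \<sigma> x) ` Gal \<rat>"
  then obtain \<sigma> where \<sigma>: "\<sigma> \<in> Gal \<rat>" "y = \<sigma> x" by blast
  obtain p where p: "is_min_poly p x" using x by (rule min_poly_exists)
  have "poly (map_poly of_rat p) y = 0"
    using Gal_poly[OF \<sigma>(1) x, of "map_poly of_rat p"] p \<sigma> Gal_0[OF \<sigma>(1)]
    by (auto simp: coeff_map_poly is_min_poly_def)
  then show "y \<in> conjugates x" using p by (auto simp: conjugates_def)
qed

section \<open>Finite normal extensions of the rationals\<close>

text \<open>A family and not a set of roots, so that conjugates coinciding under several embeddings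
  keep their multiplicity.\<close>

definition lin_prod :: "('i \<Rightarrow> complex) \<Rightarrow> 'i set \<Rightarrow> complex poly" where
  "lin_prod a I = (\<Prod>i\<in>I. [:- a i, 1:])"

lemma lin_prod_insert:
  "finite I \<Longrightarrow> i \<notin> I \<Longrightarrow> lin_prod a (insert i I) = [:- a i, 1:] * lin_prod a I"
  by (simp add: lin_prod_def)

lemma coeff_linear_mult:
  "coeff ([:- c, 1:] * g) k = (case k of 0 \<Rightarrow> 0 | Suc k \<Rightarrow> coeff g k) - c * coeff (g :: complex poly) k"
  by (simp add: coeff_pCons split: nat.splits)

lemma coeff_lin_prod_insert:
  assumes "finite I" "i \<notin> I"
  shows "coeff (lin_prod a (insert i I)) k
    = (case k of 0 \<Rightarrow> 0 | Suc k \<Rightarrow> coeff (lin_prod a I) k) - a i * coeff (lin_prod a I) k"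
  unfolding lin_prod_insert[OF assms] by (rule coeff_linear_mult)

lemma poly_lin_prod: "finite I \<Longrightarrow> poly (lin_prod a I) x = (\<Prod>i\<in>I. x - a i)"
  by (simp add: lin_prod_def poly_prod)

lemma degree_lin_prod: "finite I \<Longrightarrow> degree (lin_prod a I) = card I"
  and lead_coeff_lin_prod: "finite I \<Longrightarrow> lead_coeff (lin_prod a I) = 1"
proof -
  assume I: "finite I"
  show "degree (lin_prod a I) = card I"
    unfolding lin_prod_def by (subst degree_prod_eq_sum_degree) auto
  show "lead_coeff (lin_prod a I) = 1"
    unfolding lin_prod_def lead_coeff_prod by simp
qed

lemma coeff_lin_prod_algebraic_int:
  "finite I \<Longrightarrow> (\<And>i. i \<in> I \<Longrightarrow> algebraic_int (a i)) \<Longrightarrow> algebraic_int (coeff (lin_prod a I) k)"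
proof (induction I arbitrary: k rule: finite_induct)
  case (insert i I)
  then show ?case
    by (auto simp: coeff_lin_prod_insert split: nat.splits)
qed (simp add: lin_prod_def coeff_pCons split: nat.splits)

lemma coeff_lin_prod_algebraic:
  "finite I \<Longrightarrow> (\<And>i. i \<in> I \<Longrightarrow> algebraic (a i)) \<Longrightarrow> algebraic (coeff (lin_prod a I) k)"
proof (induction I arbitrary: k rule: finite_induct)
  case (insert i I)
  then show ?case
    by (auto simp: coeff_lin_prod_insert intro!: algebraic_diff algebraic_mult split: nat.splits)
qed (simp add: lin_prod_def coeff_pCons rat_imp_algebraic split: nat.splits)

lemma Gal_coeff_lin_prod:
  assumes \<sigma>: "\<sigma> \<in> Gal F"
  shows "finite I \<Longrightarrow> (\<And>i. i \<in> I \<Longrightarrow> algebraic (a i)) \<Longrightarrow>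
    \<sigma> (coeff (lin_prod a I) k) = coeff (lin_prod (\<lambda>i. \<sigma> (a i)) I) k"
proof (induction I arbitrary: k rule: finite_induct)
  case empty
  then show ?case by (simp add: lin_prod_def coeff_pCons Gal_0[OF \<sigma>] Gal_1[OF \<sigma>] split: nat.splits)
next
  case (insert i I)
  then have *: "algebraic (coeff (lin_prod a I) k)" "algebraic (a i)" for k
    by (auto intro: coeff_lin_prod_algebraic)
  then show ?case
    using insert by (auto simp: coeff_lin_prod_insert Gal_diff[OF \<sigma>] Gal_mult[OF \<sigma>] algebraic_mult
        Gal_0[OF \<sigma>] Gal_uminus[OF \<sigma>] split: nat.splits)
qed

lemma norm_coeff_lin_prod_le:
  assumes T: "T \<ge> 0"
  shows "finite I \<Longrightarrow> (\<And>i. i \<in> I \<Longrightarrow> cmod (a i) \<le> T) \<Longrightarrow> cmod (coeff (lin_prod a I) k) \<le> (1 + T) ^ card I"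
proof (induction I arbitrary: k rule: finite_induct)
  case (insert i I)
  have "cmod (coeff (lin_prod a (insert i I)) k)
      \<le> cmod (case k of 0 \<Rightarrow> 0 | Suc k \<Rightarrow> coeff (lin_prod a I) k) + cmod (a i * coeff (lin_prod a I) k)"
    unfolding coeff_lin_prod_insert[OF insert.hyps] by (rule norm_triangle_ineq4)
  also have "\<dots> \<le> (1 + T) ^ card I + T * (1 + T) ^ card I"
    using insert.IH insert.prems T
    by (intro add_mono) (auto simp: norm_mult intro!: mult_mono split: nat.splits)
  finally show ?case using insert.hyps by (simp add: algebra_simps)
qed (simp add: lin_prod_def coeff_pCons split: nat.splits)

lemma coeff_lin_prod_in_field:
  assumes F: "alg_field F" and I: "finite I" "\<And>i. i \<in> I \<Longrightarrow> algebraic (a i)"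
    and perm: "\<And>\<sigma>. \<sigma> \<in> Gal F \<Longrightarrow> \<exists>\<pi>. bij_betw \<pi> I I \<and> (\<forall>i\<in>I. \<sigma> (a i) = a (\<pi> i))"
  shows "coeff (lin_prod a I) k \<in> F"
proof (rule fixed_by_Gal[OF F])
  fix \<sigma> assume \<sigma>: "\<sigma> \<in> Gal F"
  then obtain \<pi> where \<pi>: "bij_betw \<pi> I I" "\<forall>i\<in>I. \<sigma> (a i) = a (\<pi> i)" using perm by blast
  have "lin_prod (\<lambda>i. \<sigma> (a i)) I = (\<Prod>i\<in>I. [:- a (\<pi> i), 1:])"
    unfolding lin_prod_def using \<pi>(2) by (intro prod.cong) auto
  also have "\<dots> = lin_prod a I"
    unfolding lin_prod_def by (rule prod.reindex_bij_betw[OF \<pi>(1)])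
  finally show "\<sigma> (coeff (lin_prod a I) k) = coeff (lin_prod a I) k"
    by (simp add: Gal_coeff_lin_prod[OF \<sigma> I])
qed (rule coeff_lin_prod_algebraic[OF I])

lemma finite_bounded_int_polys: "finite {p :: int poly. degree p \<le> n \<and> (\<forall>i. \<bar>coeff p i\<bar> \<le> C)}"
proof (rule finite_subset)
  show "finite (Poly ` {xs. set xs \<subseteq> {-C..C} \<and> length xs = Suc n})"
    by (intro finite_imageI finite_lists_length_eq) simp
  show "{p :: int poly. degree p \<le> n \<and> (\<forall>i. \<bar>coeff p i\<bar> \<le> C)} \<subseteq> Poly ` {xs. set xs \<subseteq> {-C..C} \<and> length xs = Suc n}"
  proof clarify
    fix p :: "int poly" assume p: "degree p \<le> n" "\<forall>i. \<bar>coeff p i\<bar> \<le> C"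
    have "p = Poly (map (coeff p) [0..<Suc n])"
      by (rule poly_eqI) (use p(1) in \<open>auto simp: coeff_Poly_eq nth_default_def coeff_eq_0 simp del: upt_Suc\<close>)
    moreover have "set (map (coeff p) [0..<Suc n]) \<subseteq> {-C..C}"
      using p(2) by (auto simp: abs_le_iff simp del: upt_Suc) (metis minus_le_iff)
    ultimately show "p \<in> Poly ` {xs. set xs \<subseteq> {-C..C} \<and> length xs = Suc n}"
      by (intro image_eqI[of _ _ "map (coeff p) [0..<Suc n]"]) auto
  qed
qed

lemma alg_field_poly_rat:
  assumes F: "alg_field F" and x: "x \<in> F"
  shows "poly (map_poly of_rat f) x \<in> F"
  unfolding poly_altdef
proof (rule alg_field_sum[OF F])
  fix i
  show "coeff (map_poly of_rat f) i * x ^ i \<in> F"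
    by (rule alg_field_mult[OF F alg_field_rat[OF F] alg_field_power[OF F x]]) (simp add: coeff_map_poly)
qed

section \<open>Simple extensions of \<rat> and primitive elements\<close>

definition adjoin :: "complex \<Rightarrow> complex set" where
  "adjoin \<theta> = {poly (map_poly of_rat f) \<theta> | f. True}"

lemma adjoin_poly: "poly (map_poly of_rat f) \<theta> \<in> adjoin \<theta>"
  by (auto simp: adjoin_def)

lemma adjoin_self: "\<theta> \<in> adjoin \<theta>"
  using adjoin_poly[of "[:0, 1:]" \<theta>] by (simp add: of_rat_hom.map_poly_pCons_hom)

lemma alg_field_adjoin:
  assumes "algebraic \<theta>"
  shows "alg_field (adjoin \<theta>)"
  unfolding alg_field_def
proof (intro conjI ballI subsetI)
  fix q :: complex assume "q \<in> \<rat>"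
  then obtain r where "q = of_rat r" by (auto elim: Rats_cases)
  then show "q \<in> adjoin \<theta>" using adjoin_poly[of "[:r:]" \<theta>] by (simp add: of_rat_hom.map_poly_pCons_hom)
next
  fix x assume "x \<in> adjoin \<theta>"
  then show "algebraic x"
    using assms by (auto simp: adjoin_def poly_altdef coeff_map_poly rat_imp_algebraic
        intro!: algebraic_sum algebraic_mult algebraic_power)
next
  fix x y assume "x \<in> adjoin \<theta>" "y \<in> adjoin \<theta>"
  then obtain f g where "x = poly (map_poly of_rat f) \<theta>" "y = poly (map_poly of_rat g) \<theta>"
    by (auto simp: adjoin_def)
  then show "x + y \<in> adjoin \<theta>" "x * y \<in> adjoin \<theta>"
    using adjoin_poly[of "f + g" \<theta>] adjoin_poly[of "f * g" \<theta>]
    by (simp_all add: map_poly_of_rat_add map_poly_of_rat_mult)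
qed

lemma adjoin_least: "alg_field F \<Longrightarrow> \<theta> \<in> F \<Longrightarrow> adjoin \<theta> \<subseteq> F"
  using alg_field_poly_rat by (auto simp: adjoin_def)

lemma Gal_adjoin_poly:
  assumes "\<sigma> \<in> Gal F" "algebraic \<theta>"
  shows "\<sigma> (poly (map_poly of_rat f) \<theta>) = poly (map_poly of_rat f) (\<sigma> \<theta>)"
  using Gal_poly[OF assms, of "map_poly of_rat f"] by (simp add: coeff_map_poly)

text \<open>The candidate is the value at an integer \<open>t\<close> of the polynomial with
  coefficient list \<open>B\<close>. If \<sigma> fixes it, then \<open>t\<close> is a root of the
  polynomial with coefficients \<open>\<sigma> b - b\<close>. Only finitely many such polynomials
  occur and \<open>t\<close> avoids the roots of the nonzero ones, so \<sigma> fixes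
  \<open>B\<close>, and the Galois correspondence puts \<open>B\<close> into the generated
  field.\<close>

lemma primitive_element:
  assumes B: "finite B" "\<And>b. b \<in> B \<Longrightarrow> algebraic b"
  obtains \<theta> where "algebraic_int \<theta>" "B \<subseteq> adjoin \<theta>" "\<And>F. alg_field F \<Longrightarrow> B \<subseteq> F \<Longrightarrow> adjoin \<theta> \<subseteq> F"
proof -
  obtain bs where bs: "set bs = B" using finite_list[OF B(1)] by blast
  define P where "P = (\<lambda>\<sigma>. Poly (map (\<lambda>b. \<sigma> b - b) bs))"
  have "finite ((\<lambda>\<sigma>. map \<sigma> bs) ` Gal \<rat>)"
  proof (rule finite_subset)
    show "(\<lambda>\<sigma>. map \<sigma> bs) ` Gal \<rat> \<subseteq> {xs. set xs \<subseteq> (\<Union>b\<in>B. (\<lambda>\<sigma>. \<sigma> b) ` Gal \<rat>) \<and> length xs = length bs}"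
      using bs by fastforce
    show "finite {xs. set xs \<subseteq> (\<Union>b\<in>B. (\<lambda>\<sigma>. \<sigma> b) ` Gal \<rat>) \<and> length xs = length bs}"
      using B by (intro finite_lists_length_eq finite_UN_I finite_rat_poly_orbit) auto
  qed
  moreover have "P ` Gal \<rat> = (\<lambda>xs. Poly (map2 (-) xs bs)) ` (\<lambda>\<sigma>. map \<sigma> bs) ` Gal \<rat>"
    unfolding image_image P_def by (intro image_cong refl arg_cong[of _ _ Poly] nth_equalityI) auto
  ultimately have fin: "finite (P ` Gal \<rat>)" by simp
  define R where "R = (\<Union>p\<in>P ` Gal \<rat> - {0}. {x. poly p x = 0})"
  have "finite R" unfolding R_def using fin by (intro finite_UN_I) (auto intro: poly_roots_finite)
  moreover have "infinite (range (of_nat :: nat \<Rightarrow> complex))"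
    by (simp add: finite_image_iff[OF inj_of_nat])
  ultimately obtain t :: nat where t: "of_nat t \<notin> R"
    by (metis finite_subset image_subsetI)
  define \<theta>0 where "\<theta>0 = poly (Poly bs) (of_nat t)"
  have sum: "poly (Poly xs) x = (\<Sum>i<length xs. xs ! i * x ^ i)" for xs :: "complex list" and x
    by (induction xs) (simp_all add: sum.lessThan_Suc_shift sum_distrib_left algebra_simps del: sum.lessThan_Suc)
  have alg_nth: "algebraic (bs ! i)" if "i < length bs" for i
    using B(2) bs that by auto
  have alg: "algebraic \<theta>0"
    unfolding \<theta>0_def sum using alg_nth by (auto intro!: algebraic_sum algebraic_mult algebraic_power simp: rat_imp_algebraic)
  have fix_B: "\<sigma> b = b" if \<sigma>: "\<sigma> \<in> Gal \<rat>" "\<sigma> \<theta>0 = \<theta>0" "b \<in> B" for \<sigma> b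
  proof -
    have t_pow: "\<sigma> (of_nat t ^ i) = of_nat t ^ i" "algebraic (of_nat t ^ i :: complex)" for i
      using Gal_of_nat[OF \<sigma>(1), of "t ^ i"] rat_imp_algebraic[of "of_nat (t ^ i)"] by simp_all
    have "\<sigma> \<theta>0 = (\<Sum>i<length bs. \<sigma> (bs ! i * of_nat t ^ i))"
      unfolding \<theta>0_def sum using alg_nth t_pow(2) by (intro Gal_sum[OF \<sigma>(1)] algebraic_mult) auto
    also have "\<dots> = (\<Sum>i<length bs. \<sigma> (bs ! i) * of_nat t ^ i)"
      using alg_nth t_pow by (intro sum.cong refl) (simp add: Gal_mult[OF \<sigma>(1)])
    finally have "\<sigma> \<theta>0 = (\<Sum>i<length bs. \<sigma> (bs ! i) * of_nat t ^ i)" .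
    then have "poly (P \<sigma>) (of_nat t) = \<sigma> \<theta>0 - \<theta>0"
      by (simp add: P_def \<theta>0_def sum sum_subtractf algebra_simps)
    then have "P \<sigma> = 0" using t \<sigma> by (auto simp: R_def)
    then have "nth_default 0 (map (\<lambda>b. \<sigma> b - b) bs) = (\<lambda>_. 0)"
      unfolding P_def by (metis coeff_0 coeff_Poly_eq ext)
    moreover obtain i where "i < length bs" "bs ! i = b" using \<sigma>(3) bs by (metis in_set_conv_nth)
    ultimately have "\<sigma> b - b = 0" by (auto simp: nth_default_def fun_eq_iff split: if_splits)
    then show ?thesis by simp
  qed
  \<comment> \<open>Scaling by a positive integer makes the generator integral and does not affect
    which automorphisms fix it.\<close>
  obtain n :: nat where n: "n > 0" "algebraic_int (of_nat n * \<theta>0)"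
    using alg by (rule algebraic_int_multiple)
  define \<theta> where "\<theta> = of_nat n * \<theta>0"
  have \<theta>: "algebraic_int \<theta>" using n by (simp add: \<theta>_def)
  note K = alg_field_adjoin[OF algebraic_int_imp_algebraic[OF \<theta>]]
  have "B \<subseteq> adjoin \<theta>"
  proof
    fix b assume b: "b \<in> B"
    show "b \<in> adjoin \<theta>"
    proof (rule fixed_by_Gal[OF K])
      fix \<sigma> assume \<sigma>: "\<sigma> \<in> Gal (adjoin \<theta>)"
      have "\<sigma> \<theta> = \<theta>" using Gal_fix[OF \<sigma> adjoin_self] .
      then have "\<sigma> \<theta>0 = \<theta>0"
        using n(1) alg by (simp add: \<theta>_def Gal_mult[OF \<sigma>] Gal_of_nat[OF \<sigma>] rat_imp_algebraic)
      then show "\<sigma> b = b" using fix_B[OF Gal_Rats[OF \<sigma>]] b by blast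
    qed (use B(2) b in blast)
  qed
  moreover have "adjoin \<theta> \<subseteq> F" if F: "alg_field F" "B \<subseteq> F" for F
  proof (rule adjoin_least[OF F(1)])
    have "bs ! i * of_nat t ^ i \<in> F" if "i < length bs" for i
      using alg_field_mult[OF F(1), of "bs ! i" "of_nat t ^ i"] alg_field_rat[OF F(1), of "of_nat t ^ i"] F(2) bs nth_mem[OF that]
      by auto
    then show "\<theta> \<in> F" unfolding \<theta>_def \<theta>0_def sum
      by (intro alg_field_mult[OF F(1) alg_field_rat[OF F(1)] alg_field_sum[OF F(1)]]) auto
  qed
  ultimately show ?thesis using that \<theta> by blast
qed

section \<open>Galois number fields: embeddings, characteristic polynomials, norms\<close>

locale normal_field =
  fixes \<theta> :: complex
  assumes \<theta>_int: "algebraic_int \<theta>"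
    and conj_\<theta>: "\<sigma> \<in> Gal \<rat> \<Longrightarrow> \<sigma> \<theta> \<in> adjoin \<theta>"
begin

definition K :: "complex set" where "K = adjoin \<theta>"

definition conj_set :: "complex set" where "conj_set = (\<lambda>\<sigma>. \<sigma> \<theta>) ` Gal \<rat>"

definition deg :: nat where "deg = card conj_set"

text \<open>Representatives for the embeddings of \<open>K\<close>, one per conjugate of \<theta>.
  As a set of functions \<open>Gal \<rat>\<close> is infinite, whereas norms are finite products
  over embeddings.\<close>

definition emb :: "(complex \<Rightarrow> complex) set" where
  "emb = (\<lambda>t. SOME \<sigma>. \<sigma> \<in> Gal \<rat> \<and> \<sigma> \<theta> = t) ` conj_set"

lemma \<theta>_alg: "algebraic \<theta>"
  using \<theta>_int by blast

lemma alg_field_K: "alg_field K"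
  unfolding K_def by (rule alg_field_adjoin[OF \<theta>_alg])

lemma K_algebraic: "z \<in> K \<Longrightarrow> algebraic z"
  by (rule alg_field_algebraic[OF alg_field_K])

lemma K_rat: "q \<in> \<rat> \<Longrightarrow> q \<in> K"
  by (rule alg_field_rat[OF alg_field_K])

lemma \<theta>_K: "\<theta> \<in> K" by (simp add: K_def adjoin_self)

lemma Gal_K_image: "\<sigma> \<in> Gal \<rat> \<Longrightarrow> z \<in> K \<Longrightarrow> \<sigma> z \<in> K"
proof -
  assume \<sigma>: "\<sigma> \<in> Gal \<rat>" and "z \<in> K"
  then obtain f where "z = poly (map_poly of_rat f) \<theta>" by (auto simp: K_def adjoin_def)
  then have "\<sigma> z = poly (map_poly of_rat f) (\<sigma> \<theta>)" using Gal_adjoin_poly[OF \<sigma> \<theta>_alg] by simp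
  then show ?thesis
    using alg_field_poly_rat[OF alg_field_K] conj_\<theta>[OF \<sigma>] by (simp add: K_def)
qed

lemma eq_on_K:
  assumes "\<sigma> \<in> Gal \<rat>" "\<tau> \<in> Gal \<rat>" "\<sigma> \<theta> = \<tau> \<theta>" "z \<in> K"
  shows "\<sigma> z = \<tau> z"
  using assms(3,4) Gal_adjoin_poly[OF assms(1) \<theta>_alg] Gal_adjoin_poly[OF assms(2) \<theta>_alg]
  by (auto simp: K_def adjoin_def)

lemma finite_conj_set: "finite conj_set"
  unfolding conj_set_def by (rule finite_rat_poly_orbit[OF \<theta>_alg])

lemma emb_rep:
  assumes "t \<in> conj_set"
  shows "(SOME \<sigma>. \<sigma> \<in> Gal \<rat> \<and> \<sigma> \<theta> = t) \<in> Gal \<rat>" "(SOME \<sigma>. \<sigma> \<in> Gal \<rat> \<and> \<sigma> \<theta> = t) \<theta> = t"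
proof -
  have "\<exists>\<sigma>. \<sigma> \<in> Gal \<rat> \<and> \<sigma> \<theta> = t" using assms by (auto simp: conj_set_def)
  from someI_ex[OF this]
  show "(SOME \<sigma>. \<sigma> \<in> Gal \<rat> \<and> \<sigma> \<theta> = t) \<in> Gal \<rat>" "(SOME \<sigma>. \<sigma> \<in> Gal \<rat> \<and> \<sigma> \<theta> = t) \<theta> = t" by auto
qed

lemma emb_Gal: "\<rho> \<in> emb \<Longrightarrow> \<rho> \<in> Gal \<rat>"
  unfolding emb_def using emb_rep by auto

lemma emb_inj: "\<rho> \<in> emb \<Longrightarrow> \<rho>' \<in> emb \<Longrightarrow> \<rho> \<theta> = \<rho>' \<theta> \<Longrightarrow> \<rho> = \<rho>'"
  unfolding emb_def using emb_rep(2) by auto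

lemma finite_emb: "finite emb"
  unfolding emb_def using finite_conj_set by simp

lemma emb_bij: "bij_betw (\<lambda>\<rho>. \<rho> \<theta>) emb conj_set"
  unfolding bij_betw_def inj_on_def using emb_inj emb_rep(2)
  by (auto simp: emb_def image_image)

lemma card_emb: "card emb = deg"
  unfolding deg_def by (rule bij_betw_same_card[OF emb_bij])

lemma Gal_emb:
  assumes "\<sigma> \<in> Gal \<rat>"
  obtains \<rho> where "\<rho> \<in> emb" "\<And>z. z \<in> K \<Longrightarrow> \<sigma> z = \<rho> z"
proof -
  have "\<sigma> \<theta> \<in> conj_set" using assms unfolding conj_set_def by (rule imageI)
  then obtain \<rho> where "\<rho> \<in> emb" "\<sigma> \<theta> = \<rho> \<theta>"
    using emb_bij unfolding bij_betw_def by blast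
  then show ?thesis using eq_on_K[OF assms emb_Gal] that by blast
qed

lemma emb_nonempty: "emb \<noteq> {}"
  using Gal_emb[OF id_Gal] by blast

lemma deg_pos: "deg > 0"
  using emb_nonempty finite_emb card_emb by (metis card_gt_0_iff)

lemma Gal_permutes_emb:
  assumes \<sigma>: "\<sigma> \<in> Gal \<rat>"
  obtains \<pi> where "bij_betw \<pi> emb emb" "\<And>\<rho> z. \<rho> \<in> emb \<Longrightarrow> z \<in> K \<Longrightarrow> \<sigma> (\<rho> z) = \<pi> \<rho> z"
proof -
  have "\<exists>\<rho>'\<in>emb. \<forall>z\<in>K. \<sigma> (\<rho> z) = \<rho>' z" if "\<rho> \<in> emb" for \<rho>
    using Gal_emb[OF Gal_comp[OF \<sigma> emb_Gal[OF that]]] by (metis o_apply)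
  then obtain \<pi> where \<pi>: "\<And>\<rho>. \<rho> \<in> emb \<Longrightarrow> \<pi> \<rho> \<in> emb" "\<And>\<rho> z. \<rho> \<in> emb \<Longrightarrow> z \<in> K \<Longrightarrow> \<sigma> (\<rho> z) = \<pi> \<rho> z"
    by metis
  have "inj_on \<pi> emb"
  proof (rule inj_onI)
    fix \<rho> \<rho>' assume *: "\<rho> \<in> emb" "\<rho>' \<in> emb" "\<pi> \<rho> = \<pi> \<rho>'"
    then have "\<sigma> (\<rho> \<theta>) = \<sigma> (\<rho>' \<theta>)" using \<pi>(2) \<theta>_K by metis
    then have "\<rho> \<theta> = \<rho>' \<theta>"
      using Gal_inj[OF \<sigma>] Gal_algebraic[OF emb_Gal \<theta>_alg] *(1,2) by blast
    then show "\<rho> = \<rho>'" using emb_inj * by blast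
  qed
  moreover have "\<pi> ` emb \<subseteq> emb" using \<pi>(1) by auto
  ultimately have "bij_betw \<pi> emb emb"
    using endo_inj_surj[OF finite_emb] by (auto simp: bij_betw_def)
  then show ?thesis using \<pi>(2) that by blast
qed

text \<open>In general a power of the minimal polynomial of \<open>z\<close>; the degree is
  \<open>deg\<close> for every \<open>z\<close>.\<close>

definition char_poly_K :: "complex \<Rightarrow> complex poly" where
  "char_poly_K z = lin_prod (\<lambda>\<rho>. \<rho> z) emb"

lemma coeff_char_poly_K: "z \<in> K \<Longrightarrow> coeff (char_poly_K z) k \<in> \<rat>"
  unfolding char_poly_K_def
proof (rule coeff_lin_prod_in_field[OF alg_field_Rats finite_emb])
  fix \<sigma> assume "\<sigma> \<in> Gal \<rat>" and z: "z \<in> K"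
  then obtain \<pi> where "bij_betw \<pi> emb emb" "\<And>\<rho> z. \<rho> \<in> emb \<Longrightarrow> z \<in> K \<Longrightarrow> \<sigma> (\<rho> z) = \<pi> \<rho> z"
    using Gal_permutes_emb by blast
  then show "\<exists>\<pi>. bij_betw \<pi> emb emb \<and> (\<forall>\<rho>\<in>emb. \<sigma> (\<rho> z) = \<pi> \<rho> z)" using z by blast
qed (use Gal_algebraic[OF emb_Gal] K_algebraic in blast)

lemma degree_char_poly_K: "degree (char_poly_K z) = deg"
  by (simp add: char_poly_K_def degree_lin_prod finite_emb card_emb)

lemma lead_coeff_char_poly_K: "lead_coeff (char_poly_K z) = 1"
  by (simp add: char_poly_K_def lead_coeff_lin_prod finite_emb)

lemma poly_char_poly_K: "z \<in> K \<Longrightarrow> poly (char_poly_K z) z = 0"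
proof -
  assume z: "z \<in> K"
  obtain \<rho> where "\<rho> \<in> emb" "\<And>z. z \<in> K \<Longrightarrow> id z = \<rho> z"
    using Gal_emb[OF id_Gal] by blast
  then show ?thesis
    using z finite_emb by (auto simp: char_poly_K_def poly_lin_prod intro!: prod_zero bexI[of _ \<rho>])
qed

definition Nm :: "complex \<Rightarrow> complex" where "Nm z = (\<Prod>\<rho>\<in>emb. \<rho> z)"

lemma Nm_rat: "z \<in> K \<Longrightarrow> Nm z \<in> \<rat>"
proof -
  assume z: "z \<in> K"
  have "poly (char_poly_K z) 0 = (\<Prod>\<rho>\<in>emb. -1) * Nm z"
    by (simp add: char_poly_K_def poly_lin_prod[OF finite_emb] Nm_def prod_uminus)
  then have "Nm z = (- 1) ^ deg * coeff (char_poly_K z) 0"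
    by (simp add: poly_0_coeff_0 card_emb flip: power_mult_distrib)
  then show ?thesis using coeff_char_poly_K[OF z, of 0] by simp
qed

lemma Nm_algebraic_int: "algebraic_int z \<Longrightarrow> algebraic_int (Nm z)"
  unfolding Nm_def by (rule algebraic_int_prod) (rule Gal_algebraic_int[OF emb_Gal])

lemma Nm_int: "z \<in> K \<Longrightarrow> algebraic_int z \<Longrightarrow> Nm z \<in> \<int>"
  using Nm_rat Nm_algebraic_int rational_algebraic_int_is_int by blast

lemma Nm_eq_0_iff: "z \<in> K \<Longrightarrow> Nm z = 0 \<longleftrightarrow> z = 0"
  using finite_emb emb_nonempty Gal_eq_0_iff[OF emb_Gal] K_algebraic by (auto simp: Nm_def)

text \<open>Reduction modulo the characteristic polynomial of \<theta> brings the degree below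
  \<open>deg\<close>.\<close>

lemma K_basis:
  assumes "z \<in> K"
  obtains c :: "nat \<Rightarrow> rat" where "z = (\<Sum>j<deg. of_rat (c j) * \<theta> ^ j)"
proof -
  obtain f where f: "z = poly (map_poly of_rat f) \<theta>" using assms by (auto simp: K_def adjoin_def)
  obtain p where p: "char_poly_K \<theta> = map_poly of_rat p"
    using ratpolyE coeff_char_poly_K[OF \<theta>_K] by metis
  have d: "degree p = deg" using degree_char_poly_K[of \<theta>] by (simp add: p)
  have "f = f div p * p + f mod p" by simp
  then have "z = poly (map_poly of_rat (f div p)) \<theta> * poly (map_poly of_rat p) \<theta> + poly (map_poly of_rat (f mod p)) \<theta>"
    unfolding f by (metis map_poly_of_rat_mult map_poly_of_rat_add poly_mult poly_add)
  then have z: "z = poly (map_poly of_rat (f mod p)) \<theta>"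
    using poly_char_poly_K[OF \<theta>_K] p by simp
  have "p \<noteq> 0" using d deg_pos by auto
  then have "degree (f mod p) < deg"
    using degree_mod_less_degree[of p f] d deg_pos by (cases "p dvd f") (auto simp: mod_eq_0_iff_dvd)
  then have "z = (\<Sum>j\<le>deg - 1. of_rat (coeff (f mod p) j) * \<theta> ^ j)"
    unfolding z by (subst poly_eq_sum_atMost[of _ "deg - 1"]) (auto simp: coeff_map_poly)
  moreover have "{..deg - 1} = {..<deg}" using deg_pos by auto
  ultimately show ?thesis using that by metis
qed

text \<open>A rational polynomial of degree below \<open>deg\<close> with root \<theta> would vanish
  at all \<open>deg\<close> distinct conjugates of \<theta>.\<close>

lemma K_basis_unique:
  fixes c :: "nat \<Rightarrow> rat"
  assumes "(\<Sum>j<deg. of_rat (c j) * \<theta> ^ j) = 0" "j < deg"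
  shows "c j = 0"
proof -
  define f where "f = Poly (map c [0..<deg])"
  have coeff_f: "coeff f j = (if j < deg then c j else 0)" for j
    by (simp add: f_def coeff_Poly_eq nth_default_def)
  have df: "degree f \<le> deg - 1"
    by (rule degree_le) (auto simp: coeff_f)
  then have "poly (map_poly of_rat f) \<theta> = (\<Sum>j\<le>deg - 1. of_rat (coeff f j) * \<theta> ^ j)"
    by (subst poly_eq_sum_atMost[of _ "deg - 1"]) (auto simp: coeff_map_poly)
  also have "{..deg - 1} = {..<deg}" using deg_pos by auto
  finally have 0: "poly (map_poly of_rat f) \<theta> = 0" using assms(1) by (simp add: coeff_f)
  have "poly (map_poly of_rat f) t = 0" if "t \<in> conj_set" for t
    using that Gal_adjoin_poly[OF _ \<theta>_alg, of _ \<rat> f] 0 Gal_0 by (auto simp: conj_set_def)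
  then have sub: "conj_set \<subseteq> {t. poly (map_poly of_rat f) t = 0}" by auto
  have "f = 0"
  proof (rule ccontr)
    assume f: "f \<noteq> 0"
    then have nz: "map_poly of_rat f \<noteq> (0 :: complex poly)" by simp
    have "deg \<le> card {t :: complex. poly (map_poly of_rat f) t = 0}"
      unfolding deg_def by (rule card_mono[OF poly_roots_finite[OF nz] sub])
    also have "\<dots> \<le> degree (map_poly of_rat f :: complex poly)"
      by (rule card_poly_roots_bound[OF nz])
    finally show False using df deg_pos by simp
  qed
  then show ?thesis using coeff_f[of j] assms(2) by simp
qed

text \<open>The characteristic polynomial of such a \<open>z\<close> has integer coefficients
  bounded in terms of \<open>T\<close> and \<open>deg\<close>, so \<open>z\<close> is a root of one
  of finitely many polynomials.\<close>

lemma finite_bounded_integers: "finite {z \<in> K. algebraic_int z \<and> (\<forall>\<rho>\<in>emb. cmod (\<rho> z) \<le> T)}"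
proof -
  define T' where "T' = max T 0"
  define C where "C = \<lceil>(1 + T') ^ deg\<rceil>"
  let ?P = "{p :: int poly. degree p \<le> deg \<and> (\<forall>i. \<bar>coeff p i\<bar> \<le> C)}"
  have "{z \<in> K. algebraic_int z \<and> (\<forall>\<rho>\<in>emb. cmod (\<rho> z) \<le> T)}
      \<subseteq> (\<Union>p\<in>?P - {0}. {z. poly (map_poly of_int p) z = 0})"
  proof clarify
    fix z assume z: "z \<in> K" "algebraic_int z" "\<forall>\<rho>\<in>emb. cmod (\<rho> z) \<le> T"
    have "algebraic_int (coeff (char_poly_K z) i)" for i
      unfolding char_poly_K_def
      by (rule coeff_lin_prod_algebraic_int[OF finite_emb]) (rule Gal_algebraic_int[OF emb_Gal z(2)])
    then have "coeff (char_poly_K z) i \<in> \<int>" for i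
      using coeff_char_poly_K[OF z(1)] rational_algebraic_int_is_int by blast
    then obtain p where p: "char_poly_K z = map_poly of_int p"
      using intpolyE by metis
    have "\<bar>coeff p i\<bar> \<le> C" for i
    proof -
      have "cmod (coeff (char_poly_K z) i) \<le> (1 + T') ^ card emb"
        unfolding char_poly_K_def
        by (rule norm_coeff_lin_prod_le[OF _ finite_emb]) (use z(3) in \<open>auto simp: T'_def intro: max.coboundedI1\<close>)
      then have "real_of_int \<bar>coeff p i\<bar> \<le> (1 + T') ^ deg"
        by (simp add: p coeff_map_poly card_emb)
      then show ?thesis unfolding C_def by linarith
    qed
    moreover have "degree p = deg" using degree_char_poly_K[of z] by (simp add: p)
    moreover have "p \<noteq> 0" using lead_coeff_char_poly_K[of z] by (auto simp: p)
    ultimately show "z \<in> (\<Union>p\<in>?P - {0}. {z. poly (map_poly of_int p) z = 0})"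
      using poly_char_poly_K[OF z(1)] p by auto
  qed
  moreover have "finite (\<Union>p\<in>?P - {0}. {z :: complex. poly (map_poly of_int p) z = 0})"
    using finite_bounded_int_polys by (intro finite_UN_I poly_roots_finite) auto
  ultimately show ?thesis by (rule finite_subset)
qed

end

section \<open>Extensions of the p-adic absolute value to algebraic numbers\<close>

lemma algebraic_1: "algebraic (1 :: complex)"
  by (rule rat_imp_algebraic) simp

lemma algebraic_divide: "algebraic x \<Longrightarrow> algebraic y \<Longrightarrow> algebraic (x / y :: complex)"
  unfolding divide_inverse by (intro algebraic_mult algebraic_inverse)

section \<open>Prime ideals of the ring of all algebraic integers\<close>

definition alg_ideal :: "complex set \<Rightarrow> bool" where
  "alg_ideal I \<longleftrightarrow> I \<subseteq> {x. algebraic_int x} \<and> 0 \<in> I \<and> (\<forall>x\<in>I. \<forall>y\<in>I. x + y \<in> I)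
     \<and> (\<forall>x\<in>I. \<forall>a. algebraic_int a \<longrightarrow> a * x \<in> I)"

locale prime_over =
  fixes p :: nat and P :: "complex set"
  assumes prime_p: "prime p"
    and ideal: "alg_ideal P"
    and p_in: "of_nat p \<in> P"
    and proper: "1 \<notin> P"
    and prime_P: "algebraic_int x \<Longrightarrow> algebraic_int y \<Longrightarrow> x * y \<in> P \<Longrightarrow> x \<in> P \<or> y \<in> P"

text \<open>Zorn's lemma for the proper ideals containing \<open>p\<close>. The ideal generated by
  \<open>p\<close> is proper because \<open>1 / p\<close> is rational and not an integer, hence not
  integral. A maximal such ideal is prime: multiply two representations of 1.\<close>

lemma prime_over_exists:
  assumes p: "prime p"
  obtains P where "prime_over p P"
proof -
  define \<A> where "\<A> = {I. alg_ideal I \<and> of_nat p \<in> I \<and> 1 \<notin> I}"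
  have "\<exists>M\<in>\<A>. \<forall>Y\<in>\<A>. M \<subseteq> Y \<longrightarrow> Y = M"
  proof (rule subset_Zorn_nonempty)
    define I where "I = {of_nat p * a | a :: complex. algebraic_int a}"
    have "1 \<notin> I"
    proof
      assume "1 \<in> I"
      then obtain a :: complex where a: "1 = of_nat p * a" "algebraic_int a" by (auto simp: I_def)
      then have "a = inverse (of_nat p)" by (metis inverse_unique)
      then have "a \<in> \<rat>" by simp
      then obtain n where "a = of_int n"
        using rational_algebraic_int_is_int[OF a(2)] by (auto elim: Ints_cases)
      then have "of_int (int p * n) = (1 :: complex)" using a(1) by simp
      then have "int p * n = 1" by (metis of_int_eq_1_iff)
      then show False using p by (simp add: zmult_eq_1_iff prime_nat_iff)
    qed
    moreover have "alg_ideal I"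
      unfolding alg_ideal_def
    proof (intro conjI ballI allI impI subsetI CollectI)
      fix x assume "x \<in> I"
      then show "algebraic_int x" by (auto simp: I_def)
    next
      show "0 \<in> I" by (auto simp: I_def intro!: exI[of _ 0])
    next
      fix x y assume "x \<in> I" "y \<in> I"
      then obtain a b where "x = of_nat p * a" "algebraic_int a" "y = of_nat p * b" "algebraic_int b"
        by (auto simp: I_def)
      then show "x + y \<in> I" by (auto simp: I_def distrib_left intro!: exI[of _ "a + b"])
    next
      fix x a :: complex assume "x \<in> I" and a: "algebraic_int a"
      then obtain b where "x = of_nat p * b" "algebraic_int b" by (auto simp: I_def)
      then show "a * x \<in> I" using a by (auto simp: I_def intro!: exI[of _ "a * b"])
    qed
    moreover have "of_nat p \<in> I" by (auto simp: I_def intro!: exI[of _ 1])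
    ultimately show "\<A> \<noteq> {}" by (auto simp: \<A>_def)
  next
    fix C assume C: "C \<noteq> {}" "subset.chain \<A> C"
    then have CA: "c \<in> \<A>" if "c \<in> C" for c using that by (auto simp: subset_chain_def)
    have two: "\<exists>c\<in>C. z \<in> c \<and> w \<in> c" if "z \<in> \<Union>C" "w \<in> \<Union>C" for z w
      using that C(2) unfolding subset_chain_def by blast
    have "alg_ideal (\<Union>C)"
      unfolding alg_ideal_def
    proof (intro conjI ballI allI impI subsetI CollectI)
      fix x assume "x \<in> \<Union>C"
      then obtain c where "c \<in> C" "x \<in> c" by blast
      then show "algebraic_int x" using CA[of c] by (auto simp: \<A>_def alg_ideal_def)
    next
      show "0 \<in> \<Union>C" using C(1) CA by (auto simp: \<A>_def alg_ideal_def)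
    next
      fix x y assume "x \<in> \<Union>C" "y \<in> \<Union>C"
      then obtain c where c: "c \<in> C" "x \<in> c" "y \<in> c" using two by blast
      then have "x + y \<in> c" using CA[OF c(1)] by (simp add: \<A>_def alg_ideal_def)
      then show "x + y \<in> \<Union>C" using c by blast
    next
      fix x a :: complex assume "x \<in> \<Union>C" and a: "algebraic_int a"
      then obtain c where c: "c \<in> C" "x \<in> c" by blast
      then have "a * x \<in> c" using CA[OF c(1)] a by (simp add: \<A>_def alg_ideal_def)
      then show "a * x \<in> \<Union>C" using c by blast
    qed
    then show "\<Union>C \<in> \<A>" using C(1) CA by (auto simp: \<A>_def)
  qed
  then obtain M where M: "alg_ideal M" "of_nat p \<in> M" "1 \<notin> M"
    and max: "\<And>Y. Y \<in> \<A> \<Longrightarrow> M \<subseteq> Y \<Longrightarrow> Y = M"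
    by (auto simp: \<A>_def)
  have M0: "0 \<in> M" and Madd: "\<And>x y. x \<in> M \<Longrightarrow> y \<in> M \<Longrightarrow> x + y \<in> M"
    and Mmult: "\<And>x a. x \<in> M \<Longrightarrow> algebraic_int a \<Longrightarrow> a * x \<in> M"
    and Mint: "\<And>x. x \<in> M \<Longrightarrow> algebraic_int x"
    using M(1) unfolding alg_ideal_def by blast+
  have gen: "\<exists>m\<in>M. \<exists>a. algebraic_int a \<and> 1 = m + a * x" if x: "algebraic_int x" "x \<notin> M" for x
  proof -
    define N where "N = {m + a * x | m a. m \<in> M \<and> algebraic_int a}"
    have NI: "m + a * x \<in> N" if "m \<in> M" "algebraic_int a" for m a
      using that by (auto simp: N_def)
    have "alg_ideal N"
      unfolding alg_ideal_def
    proof (intro conjI ballI allI impI subsetI CollectI)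
      fix y assume "y \<in> N"
      then show "algebraic_int y" using x Mint by (auto simp: N_def)
    next
      show "0 \<in> N" using NI[OF M0, of 0] by simp
    next
      fix y z assume "y \<in> N" "z \<in> N"
      then obtain m a n b where *: "y = m + a * x" "m \<in> M" "algebraic_int a" "z = n + b * x" "n \<in> M" "algebraic_int b"
        by (auto simp: N_def)
      show "y + z \<in> N" using NI[OF Madd[OF *(2,5)] algebraic_int_add[OF *(3,6)]] by (simp add: * algebra_simps)
    next
      fix y c :: complex assume "y \<in> N" and c: "algebraic_int c"
      then obtain m a where *: "y = m + a * x" "m \<in> M" "algebraic_int a" by (auto simp: N_def)
      show "c * y \<in> N" using NI[OF Mmult[OF *(2) c] algebraic_int_mult[OF c *(3)]] by (simp add: * algebra_simps)
    qed
    moreover have sub: "M \<subseteq> N" using NI[of _ 0] by auto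
    moreover have "x \<in> N" using NI[OF M0, of 1] by simp
    ultimately have "1 \<in> N" using max[of N] M(2) x(2) unfolding \<A>_def by blast
    then show ?thesis by (auto simp: N_def)
  qed
  have "prime_over p M"
  proof
    fix x y assume xy: "algebraic_int x" "algebraic_int y" "x * y \<in> M"
    show "x \<in> M \<or> y \<in> M"
    proof (rule ccontr)
      assume "\<not> (x \<in> M \<or> y \<in> M)"
      then obtain m a n b where m: "m \<in> M" "algebraic_int a" "1 = m + a * x"
        and n: "n \<in> M" "algebraic_int b" "1 = n + b * y"
        using gen[OF xy(1)] gen[OF xy(2)] by blast
      have "1 = (m + a * x) * (n + b * y)" using m(3) n(3) by simp
      also have "\<dots> = (n + b * y) * m + ((a * x) * n + (a * b) * (x * y))" by (simp add: algebra_simps)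
      also have "\<dots> \<in> M"
        using xy m n Mint[OF n(1)]
        by (intro Madd[OF Mmult[OF m(1)] Madd[OF Mmult[OF n(1)] Mmult[OF xy(3)]]]) auto
      finally show False using M(3) by simp
    qed
  qed (use p M in auto)
  then show ?thesis by (rule that)
qed

text \<open>What is used of an extension of the \<open>p\<close>-adic absolute value, normalised to
  \<open>1 / p\<close> at \<open>p\<close>. \<open>av_discrete\<close> bounds the denominators of
  value exponents, hence ramification indices, by degrees. By \<open>av_localize\<close> an element
  of the valuation ring has a denominator that is a unit there and lies in every field containing
  the element. As a locale predicate it can be quantified over all places.\<close>

locale padic_abs =
  fixes p :: nat and av :: "complex \<Rightarrow> real"
  assumes prime_p: "prime p"
    and av_0: "av 0 = 0"
    and av_pos: "algebraic x \<Longrightarrow> x \<noteq> 0 \<Longrightarrow> av x > 0"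
    and av_mult: "algebraic x \<Longrightarrow> algebraic y \<Longrightarrow> av (x * y) = av x * av y"
    and av_add: "algebraic x \<Longrightarrow> algebraic y \<Longrightarrow> av (x + y) \<le> max (av x) (av y)"
    and av_integral: "algebraic_int x \<Longrightarrow> av x \<le> 1"
    and av_p: "av (of_nat p) = 1 / p"
    and av_coprime: "\<not> int p dvd n \<Longrightarrow> av (of_int n) = 1"
    and av_discrete: "f \<noteq> 0 \<Longrightarrow> poly (map_poly of_int f) x = 0 \<Longrightarrow> x \<noteq> 0 \<Longrightarrow>
      \<exists>k j. 0 < k \<and> k \<le> degree (f :: int poly) \<and> av x ^ k = p powi j"
    and av_localize: "algebraic x \<Longrightarrow> av x \<le> 1 \<Longrightarrow>
      \<exists>c. algebraic_int c \<and> av c = 1 \<and> algebraic_int (c * x) \<and> (\<forall>F. alg_field F \<longrightarrow> x \<in> F \<longrightarrow> c \<in> F)"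

section \<open>Localisation at a prime, a valuation ring, and its absolute value\<close>

context prime_over
begin

lemma P_int: "x \<in> P \<Longrightarrow> algebraic_int x"
  and P_0: "0 \<in> P"
  and P_add: "x \<in> P \<Longrightarrow> y \<in> P \<Longrightarrow> x + y \<in> P"
  and P_mult: "x \<in> P \<Longrightarrow> algebraic_int a \<Longrightarrow> a * x \<in> P"
  using ideal unfolding alg_ideal_def by blast+

lemma P_uminus: "x \<in> P \<Longrightarrow> - x \<in> P"
  using P_mult[of x "-1"] by simp

lemma P_diff: "x \<in> P \<Longrightarrow> y \<in> P \<Longrightarrow> x - y \<in> P"
  using P_add[OF _ P_uminus, of x y] by simp

lemma P_of_int_iff: "of_int n \<in> P \<longleftrightarrow> int p dvd n"
proof
  assume n: "of_int n \<in> P"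
  show "int p dvd n"
  proof (rule ccontr)
    assume "\<not> int p dvd n"
    then have "gcd (int p) n = 1"
      using prime_p prime_imp_coprime[of "int p" n] by simp
    then obtain a b where "a * int p + b * n = 1"
      using bezout_int[of "int p" n] by metis
    then have "1 = of_int a * of_nat p + of_int b * (of_int n :: complex)"
      by (metis of_int_1 of_int_add of_int_mult of_int_of_nat_eq)
    also have "\<dots> \<in> P" by (intro P_add P_mult p_in n algebraic_int_of_int)
    finally show False using proper by simp
  qed
next
  assume "int p dvd n"
  then obtain k where "n = int p * k" by (auto elim: dvdE)
  then have "of_int n = of_int k * (of_nat p :: complex)" by simp
  then show "of_int n \<in> P" using P_mult[OF p_in algebraic_int_of_int] by simp
qed

text \<open>\<open>V\<close> is the localisation of the algebraic integers at \<open>P\<close>,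
  \<open>N\<close> its maximal ideal and \<open>U\<close> its group of units.\<close>

definition V :: "complex set" where
  "V = {a / s | a s. algebraic_int a \<and> algebraic_int s \<and> s \<notin> P}"

definition N :: "complex set" where
  "N = {a / s | a s. a \<in> P \<and> algebraic_int s \<and> s \<notin> P}"

definition U :: "complex set" where
  "U = {a / s | a s. algebraic_int a \<and> a \<notin> P \<and> algebraic_int s \<and> s \<notin> P}"

lemma V_I: "algebraic_int a \<Longrightarrow> algebraic_int s \<Longrightarrow> s \<notin> P \<Longrightarrow> a / s \<in> V"
  and N_I: "a \<in> P \<Longrightarrow> algebraic_int s \<Longrightarrow> s \<notin> P \<Longrightarrow> a / s \<in> N"
  and U_I: "algebraic_int a \<Longrightarrow> a \<notin> P \<Longrightarrow> algebraic_int s \<Longrightarrow> s \<notin> P \<Longrightarrow> a / s \<in> U"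
  unfolding V_def N_def U_def by blast+

lemma V_eq: "V = N \<union> U"
  using P_int unfolding V_def N_def U_def by blast

lemma N_U_disjoint: "x \<in> N \<Longrightarrow> x \<in> U \<Longrightarrow> False"
proof -
  assume N: "x \<in> N" and U: "x \<in> U"
  obtain a s where a: "x = a / s" "a \<in> P" "algebraic_int s" "s \<notin> P"
    using N by (auto simp: N_def)
  obtain b t where b: "x = b / t" "algebraic_int b" "b \<notin> P" "algebraic_int t" "t \<notin> P"
    using U by (auto simp: U_def)
  note * = a b
  have "s \<noteq> 0" "t \<noteq> 0" using P_0 * by auto
  then have "b * s = t * a" using *(1,5) by (simp add: field_simps)
  then have "b * s \<in> P" using P_mult[OF *(2,8)] by simp
  then show False using prime_P[OF *(6,3)] * by blast
qed

lemma V_integral: "algebraic_int x \<Longrightarrow> x \<in> V"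
  using V_I[of x 1] proper by simp

lemma U_integral: "algebraic_int x \<Longrightarrow> x \<notin> P \<Longrightarrow> x \<in> U"
  using U_I[of x 1] proper by simp

lemma N_P: "x \<in> P \<Longrightarrow> x \<in> N"
  using N_I[of x 1] proper by simp

lemma not_P_mult: "algebraic_int s \<Longrightarrow> s \<notin> P \<Longrightarrow> algebraic_int t \<Longrightarrow> t \<notin> P \<Longrightarrow> s * t \<notin> P"
  using prime_P by blast

lemma V_add: "x \<in> V \<Longrightarrow> y \<in> V \<Longrightarrow> x + y \<in> V"
  and N_add: "x \<in> N \<Longrightarrow> y \<in> N \<Longrightarrow> x + y \<in> N"
proof -
  have eq: "a / s + b / t = (t * a + s * b) / (s * t)" if "s \<notin> P" "t \<notin> P" for a s b t :: complex
  proof -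
    have "s \<noteq> 0" "t \<noteq> 0" using that P_0 by metis+
    then show ?thesis by (simp add: add_divide_distrib)
  qed
  show "x + y \<in> V" if xy: "x \<in> V" "y \<in> V"
  proof -
    obtain a s b t where *: "x = a / s" "algebraic_int a" "algebraic_int s" "s \<notin> P"
      "y = b / t" "algebraic_int b" "algebraic_int t" "t \<notin> P"
      using xy by (auto simp: V_def)
    have "algebraic_int (t * a + s * b)" "algebraic_int (s * t)" using * by auto
    then show ?thesis using eq[OF *(4,8)] not_P_mult[OF *(3,4,7,8)] * unfolding V_def by blast
  qed
  show "x + y \<in> N" if xy: "x \<in> N" "y \<in> N"
  proof -
    obtain a s b t where *: "x = a / s" "a \<in> P" "algebraic_int s" "s \<notin> P"
      "y = b / t" "b \<in> P" "algebraic_int t" "t \<notin> P"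
      using xy by (auto simp: N_def)
    have "t * a + s * b \<in> P" "algebraic_int (s * t)" using * by (auto intro: P_add P_mult)
    then show ?thesis using eq[OF *(4,8)] not_P_mult[OF *(3,4,7,8)] * unfolding N_def by blast
  qed
qed

lemma V_mult: "x \<in> V \<Longrightarrow> y \<in> V \<Longrightarrow> x * y \<in> V"
  and N_mult: "x \<in> V \<Longrightarrow> y \<in> N \<Longrightarrow> x * y \<in> N"
  and U_mult: "x \<in> U \<Longrightarrow> y \<in> U \<Longrightarrow> x * y \<in> U"
proof -
  show "x * y \<in> V" if xy: "x \<in> V" "y \<in> V"
  proof -
    obtain a s b t where *: "x = a / s" "algebraic_int a" "algebraic_int s" "s \<notin> P"
      "y = b / t" "algebraic_int b" "algebraic_int t" "t \<notin> P"
      using xy by (auto simp: V_def)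
    have "algebraic_int (a * b)" "algebraic_int (s * t)" "x * y = (a * b) / (s * t)" using * by auto
    then show ?thesis using not_P_mult[OF *(3,4,7,8)] unfolding V_def by blast
  qed
  show "x * y \<in> N" if xy: "x \<in> V" "y \<in> N"
  proof -
    obtain a s b t where *: "x = a / s" "algebraic_int a" "algebraic_int s" "s \<notin> P"
      "y = b / t" "b \<in> P" "algebraic_int t" "t \<notin> P"
      using xy by (auto simp: N_def V_def)
    have "a * b \<in> P" "algebraic_int (s * t)" "x * y = (a * b) / (s * t)" using * by (auto intro: P_mult)
    then show ?thesis using not_P_mult[OF *(3,4,7,8)] unfolding N_def by blast
  qed
  show "x * y \<in> U" if xy: "x \<in> U" "y \<in> U"
  proof -
    obtain a s b t where *: "x = a / s" "algebraic_int a" "a \<notin> P" "algebraic_int s" "s \<notin> P"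
      "y = b / t" "algebraic_int b" "b \<notin> P" "algebraic_int t" "t \<notin> P"
      using xy by (auto simp: U_def)
    have "algebraic_int (a * b)" "algebraic_int (s * t)" "x * y = (a * b) / (s * t)" using * by auto
    then show ?thesis using not_P_mult[OF *(4,5,9,10)] not_P_mult[OF *(2,3,7,8)] unfolding U_def by blast
  qed
qed

lemma U_inverse: "x \<in> U \<Longrightarrow> inverse x \<in> U"
  unfolding U_def by force

lemma U_divide: "x \<in> U \<Longrightarrow> y \<in> U \<Longrightarrow> x / y \<in> U"
  using U_mult[OF _ U_inverse] by (simp add: divide_inverse)

lemma U_nonzero: "x \<in> U \<Longrightarrow> x \<noteq> 0"
  using N_U_disjoint N_P[OF P_0] by blast

lemma U_1: "1 \<in> U"
  using U_integral[of 1] proper by simp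

lemma U_power: "x \<in> U \<Longrightarrow> x ^ n \<in> U"
  by (induction n) (auto intro: U_1 U_mult)

lemma V_power: "x \<in> V \<Longrightarrow> x ^ n \<in> V"
  by (induction n) (auto intro: V_mult V_integral)

lemma N_power: "x \<in> N \<Longrightarrow> n > 0 \<Longrightarrow> x ^ n \<in> N"
  using N_mult[OF V_power, of x x "n - 1"] V_eq by (cases n) (auto simp: mult.commute)

lemma N_sum: "(\<And>i. i \<in> I \<Longrightarrow> f i \<in> N) \<Longrightarrow> sum f I \<in> N"
  by (induction I rule: infinite_finite_induct) (auto intro: N_add N_P P_0)

lemma N_uminus: "x \<in> N \<Longrightarrow> - x \<in> N"
  using N_mult[of "-1" x] V_integral[of "-1"] by simp

lemma P_pow: "n > 0 \<Longrightarrow> of_nat p ^ n \<in> N"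
  by (rule N_power[OF N_P[OF p_in]])

lemma p_powi_U_iff: "of_nat p powi n \<in> U \<longleftrightarrow> n = 0"
proof
  assume U: "of_nat p powi n \<in> U"
  show "n = 0"
  proof (rule ccontr)
    assume n: "n \<noteq> 0"
    have "of_nat p ^ nat \<bar>n\<bar> \<in> U"
      using U U_inverse[OF U] n by (cases "n > 0") (auto simp: power_int_def power_inverse)
    then show False using P_pow[of "nat \<bar>n\<bar>"] n N_U_disjoint by auto
  qed
qed (simp add: U_1)

text \<open>
  If no Horner partial sum of a primitive integer polynomial with root \<open>x\<close> lies outside \<open>P\<close>, a
  coefficient outside \<open>P\<close> exhibits \<open>1 / x\<close> as an element of the maximal ideal.
\<close>

lemma localize:
  assumes x: "algebraic x" "x \<noteq> 0" and nN: "inverse x \<notin> N"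
  obtains c where "algebraic_int c" "c \<notin> P" "algebraic_int (c * x)" "\<And>F. alg_field F \<Longrightarrow> x \<in> F \<Longrightarrow> c \<in> F"
proof -
  obtain f0 where f0: "f0 \<noteq> 0" "poly (map_poly of_int f0) x = 0" using x(1) by (rule algebraicE')
  define f where "f = primitive_part f0"
  have f: "f \<noteq> 0" "content f = 1" using f0(1) by (auto simp: f_def)
  have "f0 = Polynomial.smult (content f0) f" by (simp add: f_def)
  then have "poly (map_poly of_int f0) x = of_int (content f0) * poly (map_poly of_int f) x"
    by (metis of_int_hom.map_poly_hom_smult poly_smult)
  then have root: "poly (map_poly of_int f) x = 0" using f0 by simp
  define n where "n = degree f"
  let ?d = "horner_part f x"
  have d_int: "algebraic_int (?d k)" if "k \<le> n" for k
    using algebraic_int_horner_part[OF f(1) root] that by (simp add: n_def)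
  have dn: "?d n = 0" using horner_part_degree[of f x] root by (simp add: n_def)
  have "\<exists>k<n. ?d k \<notin> P"
  proof (rule ccontr)
    assume "\<not> (\<exists>k<n. ?d k \<notin> P)"
    then have dP: "?d k \<in> P" if "k \<le> n" for k using dn P_0 that by (cases "k = n") auto
    have "\<exists>i. \<not> int p dvd coeff f i"
    proof (rule ccontr)
      assume "\<not> (\<exists>i. \<not> int p dvd coeff f i)"
      then have "[:int p:] dvd f" by (simp add: const_poly_dvd_iff)
      then have "int p dvd content f" by (simp add: const_poly_dvd_iff_dvd_content)
      then show False using f(2) prime_p by auto
    qed
    then obtain i where i: "of_int (coeff f i) \<notin> P" using P_of_int_iff by blast
    then have "i \<le> n" using P_0 by (auto simp: n_def intro!: le_degree)
    moreover have "i \<noteq> n" using dP[of 0] i by (auto simp: horner_part_0 n_def)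
    ultimately obtain k where k: "k < n" "i = n - Suc k"
      by (metis Suc_diff_Suc diff_diff_cancel diff_less_Suc le_neq_implies_less less_imp_le not_less_eq_eq Suc_le_lessD diff_le_self zero_less_diff)
    \<comment> \<open>Modulo \<open>P\<close>, the number \<open>e\<close> is minus a coefficient
      outside \<open>P\<close>, while \<open>?d k\<close> lies in \<open>P\<close>; the quotient
      \<open>?d k / e\<close> is \<open>1 / x\<close>.\<close>
    define e where "e = ?d (Suc k) - of_int (coeff f i)"
    have e: "e = x * ?d k" unfolding e_def k(2) n_def by (simp add: horner_part_Suc)
    have "e \<notin> P"
    proof
      assume "e \<in> P"
      then have "?d (Suc k) - e \<in> P" using dP k by (intro P_diff) auto
      then show False using i by (simp add: e_def)
    qed
    moreover have "algebraic_int e" unfolding e_def using d_int k by auto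
    moreover have "inverse x = ?d k / e"
    proof -
      have "e \<noteq> 0" using \<open>e \<notin> P\<close> P_0 by auto
      then show ?thesis using x(2) e by (simp add: field_simps)
    qed
    ultimately have "inverse x \<in> N" using dP[of k] k unfolding N_def by auto
    then show False using nN by simp
  qed
  then obtain k where k: "k < n" "?d k \<notin> P" by blast
  have "?d k * x = ?d (Suc k) - of_int (coeff f (n - Suc k))"
    by (simp add: horner_part_Suc n_def)
  then have "algebraic_int (?d k * x)" using d_int[of "Suc k"] k by auto
  moreover have "?d k \<in> F" if F: "alg_field F" "x \<in> F" for F
    unfolding horner_part_def
    by (intro alg_field_sum[OF F(1)] alg_field_mult[OF F(1)] alg_field_power[OF F]) (auto intro: alg_field_rat[OF F(1)])
  ultimately show ?thesis using that k d_int[of k] by auto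
qed

text \<open>The valuation ring property of \<open>V\<close>. It stands in for a total order on
  values until the absolute value exists.\<close>

lemma V_or_inverse_N: "algebraic x \<Longrightarrow> x \<noteq> 0 \<Longrightarrow> x \<in> V \<or> inverse x \<in> N"
proof (rule disjCI)
  assume x: "algebraic x" "x \<noteq> 0" "inverse x \<notin> N"
  obtain c where c: "algebraic_int c" "c \<notin> P" "algebraic_int (c * x)" using localize[OF x] by blast
  then have "c \<noteq> 0" using P_0 by auto
  then have "x = (c * x) / c" by simp
  then show "x \<in> V" using c unfolding V_def by blast
qed

lemma int_decompose:
  assumes "n \<noteq> (0 :: int)"
  obtains e u where "of_int n = of_nat p ^ e * u" "u \<in> U"
proof -
  have "\<not> is_unit (int p)" using prime_p by auto
  then obtain m where m: "n = int p ^ multiplicity (int p) n * m" "\<not> int p dvd m"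
    using multiplicity_decompose'[of n "int p"] assms by blast
  then have "of_int n = of_nat p ^ multiplicity (int p) n * (of_int m :: complex)"
    by (metis of_int_mult of_int_of_nat_eq of_int_power)
  moreover have "of_int m \<in> U" using m(2) P_of_int_iff by (auto intro: U_integral)
  ultimately show ?thesis by (rule that)
qed

lemma finite_preorder_max:
  assumes "finite T" "T \<noteq> {}" "\<And>i j. i \<in> T \<Longrightarrow> j \<in> T \<Longrightarrow> R i j \<or> R j i"
    "\<And>i j k. R i j \<Longrightarrow> R j k \<Longrightarrow> R i k"
  shows "\<exists>m\<in>T. \<forall>i\<in>T. R i m"
  using assms(1,2,3)
proof (induction T rule: finite_ne_induct)
  case (insert x T)
  then obtain m where m: "m \<in> T" "\<forall>i\<in>T. R i m" by auto
  show ?case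
  proof (cases "R x m")
    case True
    then show ?thesis using m by auto
  next
    case False
    then have "R m x" using insert.prems m(1) by blast
    then have "\<forall>i\<in>T. R i x" using m(2) assms(4) by blast
    moreover have "R x x" using insert.prems by blast
    ultimately show ?thesis by auto
  qed
qed auto

text \<open>Newton polygon argument before values exist: the terms of the equation
  \<open>f x = 0\<close> are compared by divisibility in \<open>V\<close>. A largest term has an
  associate among the others, as otherwise division by it would put 1 into \<open>N\<close>. Two
  associate terms of exponents \<open>i' < i\<close> turn \<open>x ^ (i - i')\<close> into a unit
  times a power of \<open>p\<close>, because each nonzero integer coefficient is itself a power of
  \<open>p\<close> up to a unit.\<close>

lemma exponent_exists:
  assumes f: "f \<noteq> 0" "poly (map_poly of_int f) x = 0" and x: "x \<noteq> 0"
  obtains k j where "0 < k" "k \<le> degree (f :: int poly)" "x ^ k * of_nat p powi j \<in> U"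
proof -
  note result = that
  have alg: "algebraic x" using f by (intro algebraicI[of "map_poly of_int f"]) auto
  define T where "T = {i. coeff f i \<noteq> 0}"
  define t where "t = (\<lambda>i. of_int (coeff f i) * x ^ i)"
  have T: "finite T" unfolding T_def by (rule finite_subset[of _ "{..degree f}"]) (auto intro: le_degree)
  have t0: "t i \<noteq> 0" if "i \<in> T" for i using that x by (auto simp: T_def t_def)
  have t_alg: "algebraic (t i)" for i
    unfolding t_def using alg by (intro algebraic_mult algebraic_power) (auto intro: rat_imp_algebraic)
  have tot: "t i / t j \<in> V \<or> t j / t i \<in> V" if ij: "i \<in> T" "j \<in> T" for i j
  proof -
    have "algebraic (t i / t j)"
      by (intro algebraic_divide t_alg)
    then show ?thesis
      using V_or_inverse_N[of "t i / t j"] t0[OF ij(1)] t0[OF ij(2)] by (auto simp: V_eq)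
  qed
  have "T \<noteq> {}" using f(1) by (auto simp: T_def poly_eq_iff)
  define R where "R = (\<lambda>i j. i \<in> T \<and> j \<in> T \<and> t i / t j \<in> V)"
  have "\<exists>m\<in>T. \<forall>i\<in>T. R i m"
  proof (rule finite_preorder_max[OF T \<open>T \<noteq> {}\<close>])
    show "R i j \<or> R j i" if "i \<in> T" "j \<in> T" for i j using tot that by (simp add: R_def)
    show "R i k" if "R i j" "R j k" for i j k
      using V_mult[of "t i / t j" "t j / t k"] that t0 by (simp add: R_def)
  qed
  then obtain m where m: "m \<in> T" "\<And>i. i \<in> T \<Longrightarrow> t i / t m \<in> V" by (auto simp: R_def)
  have "\<exists>i\<in>T - {m}. t i / t m \<in> U"
  proof (rule ccontr)
    assume "\<not> (\<exists>i\<in>T - {m}. t i / t m \<in> U)"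
    then have "(\<Sum>i\<in>T - {m}. t i / t m) \<in> N" using m by (intro N_sum) (auto simp: V_eq)
    moreover have "(\<Sum>i\<in>T. t i) = 0"
    proof -
      have "(\<Sum>i\<in>T. t i) = (\<Sum>i\<le>degree f. t i)"
        using T by (intro sum.mono_neutral_left) (auto simp: T_def t_def intro: le_degree)
      then show ?thesis using f(2) by (simp add: poly_altdef t_def coeff_map_poly)
    qed
    then have "(\<Sum>i\<in>T. t i / t m) = 0" by (simp flip: sum_divide_distrib)
    then have "1 + (\<Sum>i\<in>T - {m}. t i / t m) = 0"
      using m(1) t0 T by (simp add: sum.remove[of T m])
    then have "1 = - (\<Sum>i\<in>T - {m}. t i / t m)" by (simp add: eq_neg_iff_add_eq_0)
    ultimately have "1 \<in> N" using N_uminus by metis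
    then show False using N_U_disjoint U_1 by blast
  qed
  then obtain i where i: "i \<in> T" "i \<noteq> m" "t i / t m \<in> U" by blast
  have *: thesis if "i \<in> T" "i' \<in> T" "i' < i" "t i / t i' \<in> U" for i i'
  proof -
    obtain e u where e: "of_int (coeff f i) = of_nat p ^ e * u" "u \<in> U"
      using int_decompose[of "coeff f i"] \<open>i \<in> T\<close> by (auto simp: T_def)
    obtain e' u' where e': "of_int (coeff f i') = of_nat p ^ e' * u'" "u' \<in> U"
      using int_decompose[of "coeff f i'"] \<open>i' \<in> T\<close> by (auto simp: T_def)
    have p0: "of_nat p \<noteq> (0 :: complex)" using prime_p by auto
    have "x ^ i = x ^ (i - i') * x ^ i'" using that(3) by (simp flip: power_add)
    then have "t i / t i' = x ^ (i - i') * (of_nat p ^ e / of_nat p ^ e') * (u / u')"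
      using x by (simp add: t_def e e')
    moreover have "(of_nat p :: complex) ^ e / of_nat p ^ e' = of_nat p powi (int e - int e')"
      using p0 by (simp add: power_int_diff)
    ultimately have "x ^ (i - i') * of_nat p powi (int e - int e') = (t i / t i') / (u / u')"
      using U_nonzero e e' by simp
    moreover have "\<dots> \<in> U" by (rule U_divide[OF that(4) U_divide[OF e(2) e'(2)]])
    moreover have "i - i' \<le> degree f" using \<open>i \<in> T\<close> le_degree[of f i] by (simp add: T_def)
    ultimately show thesis using result[of "i - i'" "int e - int e'"] \<open>i' < i\<close> by simp
  qed
  show thesis
  proof (cases "m < i")
    case True
    then show thesis using * i m(1) by blast
  next
    case False
    moreover have "t m / t i \<in> U" using U_inverse[OF i(3)] by simp
    ultimately show thesis using *[of m i] i m(1) by simp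
  qed
qed

definition expo :: "complex \<Rightarrow> nat \<times> int \<Rightarrow> bool" where
  "expo x kj \<longleftrightarrow> fst kj > 0 \<and> x ^ fst kj * of_nat p powi snd kj \<in> U"

text \<open>If \<open>x ^ k * of_nat p powi j\<close> is a unit, any absolute value with value
  \<open>1 / p\<close> at \<open>p\<close> satisfies \<open>av x ^ k = p powi j\<close>. The choice
  of the pair is immaterial by \<open>expo_unique\<close>.\<close>

definition av :: "complex \<Rightarrow> real" where
  "av x = (if x = 0 then 0 else let kj = (SOME kj. expo x kj) in p powr (real_of_int (snd kj) / real (fst kj)))"

lemma p_gt_1: "real p > 1"
  using prime_p by (simp add: prime_nat_iff)

lemma p_nonzero: "of_nat p \<noteq> (0 :: complex)"
  using p_gt_1 by auto

lemma expo_power: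
  "((x :: complex) ^ k * of_nat p powi j) ^ l = x ^ (k * l) * of_nat p powi (j * int l)"
  by (simp only: power_mult_distrib power_int_mult power_int_of_nat power_mult)

text \<open>Raising each relation to the exponent of the other one eliminates \<open>x\<close> and
  leaves a power of \<open>p\<close> that is a unit, so its exponent is 0.\<close>

lemma expo_unique:
  assumes "expo x (k, j)" "expo x (k', j')"
  shows "j / k = j' / (k' :: nat)"
proof -
  have k: "k > 0" "k' > 0" and U: "x ^ k * of_nat p powi j \<in> U" "x ^ k' * of_nat p powi j' \<in> U"
    using assms by (auto simp: expo_def)
  have "x \<noteq> 0" using U_nonzero[OF U(1)] k by auto
  have "(x ^ k * of_nat p powi j) ^ k' / (x ^ k' * of_nat p powi j') ^ k \<in> U"
    by (intro U_divide U_power U)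
  also have "(x ^ k * of_nat p powi j) ^ k' / (x ^ k' * of_nat p powi j') ^ k
      = of_nat p powi (j * int k') / of_nat p powi (j' * int k)"
    unfolding expo_power using \<open>x \<noteq> 0\<close> by (simp add: mult.commute[of k' k])
  also have "\<dots> = of_nat p powi (j * int k' - j' * int k)"
    using p_nonzero by (simp add: power_int_diff)
  finally have "j * int k' = j' * int k" by (simp add: p_powi_U_iff)
  then have "real_of_int j * real k' = real_of_int j' * real k" by (metis of_int_mult of_int_of_nat_eq)
  then show ?thesis using k by (simp add: field_simps)
qed

lemma av_eqI:
  assumes "k > 0" "x ^ k * of_nat p powi j \<in> U"
  shows "av x = p powr (j / k)"
proof -
  have e: "expo x (k, j)" using assms by (simp add: expo_def)
  have "x \<noteq> 0" using U_nonzero[OF assms(2)] assms(1) by auto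
  define kj where "kj = (SOME kj. expo x kj)"
  have "expo x kj" unfolding kj_def by (rule someI[of "expo x", OF e])
  then have "snd kj / fst kj = j / k" using expo_unique[OF e, of "fst kj" "snd kj"] by simp
  then show ?thesis using \<open>x \<noteq> 0\<close> by (simp add: av_def Let_def flip: kj_def)
qed

lemma exponent:
  assumes "algebraic x" "x \<noteq> 0"
  obtains k j where "k > 0" "x ^ k * of_nat p powi j \<in> U" "av x = p powr (j / k)"
proof -
  obtain f where "f \<noteq> 0" "poly (map_poly of_int f) x = 0" using assms(1) by (rule algebraicE')
  then show ?thesis using exponent_exists[OF _ _ assms(2)] av_eqI that by metis
qed

lemma av_N: "x \<in> N \<Longrightarrow> algebraic x \<Longrightarrow> av x < 1"
proof (cases "x = 0")
  case False
  assume x: "x \<in> N" "algebraic x"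
  obtain k j where k: "k > 0" "x ^ k * of_nat p powi j \<in> U" "av x = p powr (j / k)"
    using exponent[OF x(2) False] .
  have "j < 0"
  proof (rule ccontr)
    assume "\<not> j < 0"
    then have "of_nat p powi j * x ^ k \<in> N"
      using k(1) x(1) by (intro N_mult N_power) (auto simp: power_int_def intro!: V_integral)
    then show False using k(2) N_U_disjoint by (metis mult.commute)
  qed
  then have "j / k < 0" using k(1) by (simp add: divide_less_0_iff)
  then show ?thesis using k(3) p_gt_1 by (simp add: powr_less_one)
qed (simp add: av_def)

lemma av_U: "x \<in> U \<Longrightarrow> av x = 1"
  using av_eqI[of 1 x 0] p_gt_1 by simp

lemma av_V: "x \<in> V \<Longrightarrow> algebraic x \<Longrightarrow> av x \<le> 1"
  using av_N[of x] av_U[of x] by (auto simp: V_eq)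

lemma av_positive:
  assumes "algebraic x" "x \<noteq> 0"
  shows "av x > 0"
proof -
  obtain k j where "av x = p powr (j / real k)"
    using exponent[OF assms] by blast
  then show ?thesis using p_gt_1 by simp
qed

lemma av_times:
  assumes "algebraic x" "algebraic y"
  shows "av (x * y) = av x * av y"
proof (cases "x = 0 \<or> y = 0")
  case False
  then have nz: "x \<noteq> 0" "y \<noteq> 0" by auto
  obtain k j where k: "k > 0" "x ^ k * of_nat p powi j \<in> U" "av x = p powr (j / k)"
    using exponent[OF assms(1) nz(1)] .
  obtain k' j' where k': "k' > 0" "y ^ k' * of_nat p powi j' \<in> U" "av y = p powr (j' / k')"
    using exponent[OF assms(2) nz(2)] .
  have "(x ^ k * of_nat p powi j) ^ k' * (y ^ k' * of_nat p powi j') ^ k \<in> U"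
    by (intro U_mult U_power k k')
  also have "(x ^ k * of_nat p powi j) ^ k' * (y ^ k' * of_nat p powi j') ^ k
      = (x * y) ^ (k * k') * (of_nat p powi (j * int k') * of_nat p powi (j' * int k))"
    by (simp only: expo_power mult.commute[of k' k]) (simp only: power_mult_distrib mult_ac)
  also have "\<dots> = (x * y) ^ (k * k') * of_nat p powi (j * int k' + j' * int k)"
    using p_nonzero by (simp add: power_int_add)
  finally have "av (x * y) = p powr (real_of_int (j * int k' + j' * int k) / real (k * k'))"
    using k(1) k'(1) by (intro av_eqI) auto
  also have "real_of_int (j * int k' + j' * int k) / real (k * k') = j / k + j' / k'"
    using k(1) k'(1) by (simp add: add_divide_distrib)
  finally show ?thesis using k(3) k'(3) by (simp add: powr_add)
qed (auto simp: av_def)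

text \<open>The ultrametric inequality is \<open>1 + y / x \<in> V\<close>, where \<open>x\<close>
  is the number that divides the other one in \<open>V\<close>.\<close>

lemma av_plus:
  assumes "algebraic x" "algebraic y"
  shows "av (x + y) \<le> max (av x) (av y)"
proof -
  have *: "av (x + y) \<le> av x" if xy: "algebraic x" "algebraic y" "x \<noteq> 0" "y / x \<in> V" for x y
  proof -
    have alg: "algebraic (1 + y / x)"
      by (intro algebraic_add algebraic_1 algebraic_divide xy)
    have "x + y = x * (1 + y / x)" using xy(3) by (simp add: distrib_left)
    then have "av (x + y) = av x * av (1 + y / x)" using av_times[OF xy(1) alg] by simp
    also have "av (1 + y / x) \<le> 1"
      by (rule av_V[OF V_add[OF V_integral[OF algebraic_int_1] xy(4)] alg])
    finally show ?thesis using av_positive[OF xy(1,3)] by (simp add: mult_left_le)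
  qed
  show ?thesis
  proof (cases "x = 0 \<or> y = 0")
    case False
    then have nz: "x \<noteq> 0" "y \<noteq> 0" by auto
    then have "y / x \<in> V \<or> x / y \<in> V"
      using V_or_inverse_N[of "y / x"] algebraic_divide[OF assms(2,1)] by (auto simp: V_eq)
    then show ?thesis
      using *[of x y] *[of y x] assms nz by (auto simp: add.commute le_max_iff_disj)
  qed (auto simp: le_max_iff_disj)
qed

lemma padic_abs_av: "padic_abs p av"
proof
  show "av (of_nat p) = 1 / p"
    using av_eqI[of 1 "of_nat p" "-1"] p_nonzero p_gt_1 U_1
    by (simp add: power_int_minus powr_minus divide_inverse)
next
  fix n assume "\<not> int p dvd n"
  then show "av (of_int n) = 1" using P_of_int_iff by (auto intro!: av_U U_integral)
next
  fix f :: "int poly" and x :: complex assume f: "f \<noteq> 0" "poly (map_poly of_int f) x = 0" "x \<noteq> 0"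
  obtain k j where k: "0 < k" "k \<le> degree f" "x ^ k * of_nat p powi j \<in> U"
    using exponent_exists[OF f] .
  have "av x ^ k = (p powr (j / k)) powr real k"
    using av_eqI[OF k(1,3)] p_gt_1 by (simp add: powr_realpow)
  also have "\<dots> = p powr real_of_int j" using k(1) by (simp add: powr_powr)
  also have "\<dots> = p powi j" using p_gt_1 by (intro powr_real_of_int') auto
  finally have "av x ^ k = p powi j" .
  then show "\<exists>k j. 0 < k \<and> k \<le> degree f \<and> av x ^ k = p powi j" using k by blast
next
  fix x assume x: "algebraic x" "av x \<le> 1"
  show "\<exists>c. algebraic_int c \<and> av c = 1 \<and> algebraic_int (c * x) \<and> (\<forall>F. alg_field F \<longrightarrow> x \<in> F \<longrightarrow> c \<in> F)"
  proof (cases "x = 0")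
    case True
    then show ?thesis
      using av_U[OF U_1] alg_field_rat[of _ 1] by (intro exI[of _ 1]) simp
  next
    case False
    have "inverse x \<notin> N"
    proof
      assume "inverse x \<in> N"
      then have "av (inverse x) < 1" using x by (intro av_N algebraic_inverse)
      moreover have "av x * av (inverse x) = 1"
        using av_times[of x "inverse x"] x False av_U[OF U_1] by (simp add: algebraic_inverse)
      moreover have "av (inverse x) > 0" using x(1) False by (intro av_positive algebraic_inverse) auto
      ultimately show False
        using x(2) av_positive[OF x(1) False] mult_mono[of "av x" 1 "av (inverse x)" "av (inverse x)"] by simp
    qed
    from localize[OF x(1) False this] show ?thesis
      using av_U U_integral by metis
  qed
next
  fix x :: complex assume x: "algebraic_int x"
  show "av x \<le> 1" by (rule av_V[OF V_integral[OF x] algebraic_int_imp_algebraic[OF x]])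
qed (simp_all add: prime_p av_positive av_times av_plus av_def[of 0])

end

lemma padic_abs_exists:
  assumes "prime p"
  obtains av where "padic_abs p av"
  using prime_over_exists[OF assms] prime_over.padic_abs_av by metis

section \<open>Radicals and ramification\<close>

context padic_abs
begin

lemma p_gt_1: "real p > 1"
  using prime_p by (simp add: prime_nat_iff)

lemma av_1: "av 1 = 1"
  using av_coprime[of 1] prime_p by (simp add: prime_nat_iff)

lemma av_nonneg: "algebraic x \<Longrightarrow> av x \<ge> 0"
  using av_pos[of x] av_0 by (cases "x = 0") auto

lemma av_power: "algebraic x \<Longrightarrow> av (x ^ n) = av x ^ n"
  by (induction n) (simp_all add: av_1 av_mult algebraic_power)

lemma av_inverse: "algebraic x \<Longrightarrow> av (inverse x) = inverse (av x)"
proof (cases "x = 0")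
  case False
  assume x: "algebraic x"
  have "av x * av (inverse x) = 1"
    using av_mult[OF x algebraic_inverse[OF x]] False av_1 by simp
  then show ?thesis by (metis inverse_unique)
qed (simp add: av_0)

lemma av_divide: "algebraic x \<Longrightarrow> algebraic y \<Longrightarrow> av (x / y) = av x / av y"
  unfolding divide_inverse by (simp add: av_mult algebraic_inverse av_inverse)

lemma av_prod: "(\<And>i. i \<in> I \<Longrightarrow> algebraic (f i)) \<Longrightarrow> av (\<Prod>i\<in>I. f i) = (\<Prod>i\<in>I. av (f i))"
proof (induction I rule: infinite_finite_induct)
  case (insert i I)
  have "algebraic (\<Prod>i\<in>I. f i)"
    using insert.prems by (intro alg_field_prod[OF alg_field_algebraics, simplified]) auto
  then show ?case using insert by (simp add: av_mult)
qed (simp_all add: av_1)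

lemma av_sum_le:
  "(\<And>i. i \<in> I \<Longrightarrow> algebraic (f i)) \<Longrightarrow> (\<And>i. i \<in> I \<Longrightarrow> av (f i) \<le> B) \<Longrightarrow> B \<ge> 0 \<Longrightarrow> av (\<Sum>i\<in>I. f i) \<le> B"
proof (induction I rule: infinite_finite_induct)
  case (insert i I)
  have "algebraic (f i)" "algebraic (\<Sum>i\<in>I. f i)" using insert.prems(1) by auto
  then have "av (f i + (\<Sum>i\<in>I. f i)) \<le> max (av (f i)) (av (\<Sum>i\<in>I. f i))" by (rule av_add)
  also have "\<dots> \<le> B" using insert by simp
  finally show ?case using insert.hyps by simp
qed (simp_all add: av_0)

lemma av_root_of_unity: "algebraic x \<Longrightarrow> x ^ n = 1 \<Longrightarrow> n > 0 \<Longrightarrow> av x = 1"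
  using av_power[of x n] av_1 av_nonneg[of x] power_eq_imp_eq_base[of "av x" n 1] by simp

text \<open>The power of \<open>p\<close> dividing \<open>n\<close> is at most \<bar>n\<bar>. This
  remnant of the product formula is the lower bound against which \<open>p\<close>-adically small
  conjugates are weighed.\<close>

lemma av_of_int_ge:
  assumes "n \<noteq> 0"
  shows "av (of_int n) \<ge> 1 / \<bar>of_int n\<bar>"
proof -
  have "\<not> is_unit (int p)" using prime_p by auto
  then obtain e m where m: "n = int p ^ e * m" "\<not> int p dvd m"
    using multiplicity_decompose'[of n "int p"] assms by blast
  have "of_int n = of_nat p ^ e * (of_int m :: complex)"
    unfolding m(1) by simp
  then have "av (of_int n) = (1 / p) ^ e"
    using av_coprime[OF m(2)] by (simp add: av_mult av_power av_p rat_imp_algebraic algebraic_power)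
  moreover have "m \<noteq> 0" using assms m by auto
  then have "real p ^ e \<le> \<bar>of_int n\<bar>"
    unfolding m(1) using p_gt_1 by (simp add: abs_mult)
  ultimately show ?thesis using p_gt_1 by (simp add: power_one_over frac_le)
qed

end

section \<open>Kummer theory over a field containing the roots of unity of order
  \<open>m\<close>\<close>

locale kummer = normal_field +
  fixes m :: nat
  assumes m_pos: "m > 0" and unity_K: "z ^ m = 1 \<Longrightarrow> z \<in> K"
begin

definition rad :: "complex \<Rightarrow> bool" where
  "rad y \<longleftrightarrow> algebraic y \<and> y \<noteq> 0 \<and> y ^ m \<in> K"

text \<open>Equality of the Kummer characters \<sigma> \<mapsto> \<sigma> y / y. For radicals it
  means that \<open>y\<close> and \<open>z\<close> differ by a factor in \<open>K\<close>.\<close>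

definition same_char :: "complex \<Rightarrow> complex \<Rightarrow> bool" where
  "same_char y z \<longleftrightarrow> (\<forall>\<sigma>\<in>Gal K. \<sigma> y / y = \<sigma> z / z)"

lemma rad_algebraic: "rad y \<Longrightarrow> algebraic y" and rad_nonzero: "rad y \<Longrightarrow> y \<noteq> 0"
  by (auto simp: rad_def)

lemma rad_mult: "rad y \<Longrightarrow> rad z \<Longrightarrow> rad (y * z)"
  by (auto simp: rad_def power_mult_distrib intro: alg_field_mult[OF alg_field_K])

lemma rad_inverse: "rad y \<Longrightarrow> rad (inverse y)"
  by (auto simp: rad_def power_inverse intro: alg_field_inverse[OF alg_field_K] algebraic_inverse)

lemma rad_divide: "rad y \<Longrightarrow> rad z \<Longrightarrow> rad (y / z)"
  unfolding divide_inverse by (intro rad_mult rad_inverse)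

lemma rad_K: "k \<in> K \<Longrightarrow> k \<noteq> 0 \<Longrightarrow> rad k"
  by (auto simp: rad_def K_algebraic intro: alg_field_power[OF alg_field_K])

lemma rad_char:
  assumes "rad y" "\<sigma> \<in> Gal K"
  shows "(\<sigma> y / y) ^ m = 1" "\<sigma> y / y \<in> K"
proof -
  have "\<sigma> y ^ m = y ^ m"
    using assms Gal_power[OF assms(2), of y m] Gal_fix[OF assms(2)] by (auto simp: rad_def)
  then show "(\<sigma> y / y) ^ m = 1" using assms(1) by (simp add: rad_def power_divide)
  then show "\<sigma> y / y \<in> K" by (rule unity_K)
qed

lemma same_char_ratio:
  assumes "rad y" "rad z" "same_char y z"
  shows "y / z \<in> K"
proof (rule fixed_by_Gal[OF alg_field_K])
  show "algebraic (y / z)" using assms by (intro algebraic_divide rad_algebraic)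
  fix \<sigma> assume \<sigma>: "\<sigma> \<in> Gal K"
  have nz: "\<sigma> z \<noteq> 0" "y \<noteq> 0" "z \<noteq> 0"
    using assms Gal_eq_0_iff[OF \<sigma>] rad_nonzero rad_algebraic by auto
  have "\<sigma> y / y = \<sigma> z / z" using assms(3) \<sigma> by (simp add: same_char_def)
  then have "\<sigma> y / \<sigma> z = y / z" using nz by (simp add: field_simps)
  then show "\<sigma> (y / z) = y / z" using assms rad_algebraic by (simp add: Gal_divide[OF \<sigma>])
qed

lemma ratio_same_char:
  assumes "rad y" "k \<in> K" "k \<noteq> 0"
  shows "same_char (k * y) y"
  unfolding same_char_def
proof
  fix \<sigma> assume \<sigma>: "\<sigma> \<in> Gal K"
  show "\<sigma> (k * y) / (k * y) = \<sigma> y / y"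
    using assms Gal_fix[OF \<sigma> assms(2)] by (simp add: Gal_mult[OF \<sigma>] K_algebraic rad_algebraic)
qed

lemma same_char_sym: "same_char y z \<Longrightarrow> same_char z y"
  and same_char_trans: "same_char y z \<Longrightarrow> same_char z w \<Longrightarrow> same_char y w"
  and same_char_refl: "same_char y y"
  by (simp_all add: same_char_def)

definition distinct_chars :: "complex set \<Rightarrow> bool" where
  "distinct_chars Y \<longleftrightarrow> (\<forall>y\<in>Y. \<forall>z\<in>Y. same_char y z \<longrightarrow> y = z)"

text \<open>Artin's argument: choose \<sigma> at which the characters of \<open>a\<close> and
  \<open>y\<close> differ. Applying \<sigma> to the relation and subtracting its multiple by the
  character value of \<open>a\<close> removes the \<open>a\<close> term and multiplies the
  coefficient of \<open>y\<close> by a nonzero factor. The coefficients stay in \<open>K\<close>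
  because the character values are roots of unity of order \<open>m\<close>.\<close>

lemma independent_chars:
  assumes "finite Y" "\<And>y. y \<in> Y \<Longrightarrow> rad y" "distinct_chars Y" "\<And>y. y \<in> Y \<Longrightarrow> c y \<in> K"
    "(\<Sum>y\<in>Y. c y * y) = 0" "y \<in> Y"
  shows "c y = 0"
  using assms
proof (induction Y arbitrary: c y rule: finite_induct)
  case (insert a Y)
  have rads: "rad a" "\<And>y. y \<in> Y \<Longrightarrow> rad y" using insert.prems(1) by auto
  have cK: "c a \<in> K" "\<And>y. y \<in> Y \<Longrightarrow> c y \<in> K" using insert.prems(3) by auto
  have dY: "distinct_chars Y" using insert.prems(2) by (auto simp: distinct_chars_def)
  have sum0: "c a * a + (\<Sum>y\<in>Y. c y * y) = 0" using insert.prems(4) insert.hyps by simp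
  have alg: "algebraic (c y * y)" if "y \<in> insert a Y" for y
    using that insert.prems(1,3) by (intro algebraic_mult K_algebraic rad_algebraic) auto
  have Y0: "c y = 0" if y: "y \<in> Y" for y
  proof -
    have "a \<noteq> y" using insert.hyps y by auto
    then have "\<not> same_char a y" using insert.prems(2) y by (auto simp: distinct_chars_def)
    then obtain \<sigma> where \<sigma>: "\<sigma> \<in> Gal K" "\<sigma> a / a \<noteq> \<sigma> y / y" by (auto simp: same_char_def)
    define \<chi> where "\<chi> = (\<lambda>z. \<sigma> z / z)"
    have act: "\<sigma> (c z * z) = \<chi> z * (c z * z)" if "z \<in> insert a Y" for z
    proof -
      have "\<sigma> (c z * z) = \<sigma> (c z) * \<sigma> z"
        using that insert.prems(1,3) by (intro Gal_mult[OF \<sigma>(1)] K_algebraic rad_algebraic) auto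
      also have "\<sigma> (c z) = c z" using that insert.prems(3) by (intro Gal_fix[OF \<sigma>(1)]) auto
      finally show ?thesis using that insert.prems(1) rad_nonzero by (simp add: \<chi>_def)
    qed
    have "\<sigma> (c a * a + (\<Sum>z\<in>Y. c z * z)) = \<chi> a * (c a * a) + (\<Sum>z\<in>Y. \<chi> z * (c z * z))"
      using alg act by (simp add: Gal_add[OF \<sigma>(1)] Gal_sum[OF \<sigma>(1)] algebraic_sum)
    then have "\<chi> a * (c a * a) + (\<Sum>z\<in>Y. \<chi> z * (c z * z)) = 0"
      using sum0 Gal_0[OF \<sigma>(1)] by simp
    moreover have "\<chi> a * (c a * a) + \<chi> a * (\<Sum>z\<in>Y. c z * z) = 0"
      using sum0 by (metis distrib_left mult_zero_right)
    ultimately have "(\<Sum>z\<in>Y. \<chi> z * (c z * z)) - \<chi> a * (\<Sum>z\<in>Y. c z * z) = 0"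
      by (metis add_diff_cancel_left diff_self)
    then have "(\<Sum>z\<in>Y. ((\<chi> z - \<chi> a) * c z) * z) = 0"
      by (simp add: sum_distrib_left sum_subtractf[symmetric] algebra_simps)
    moreover have "(\<chi> z - \<chi> a) * c z \<in> K" if "z \<in> Y" for z
      unfolding \<chi>_def
      using rad_char(2)[OF rads(2)[OF that] \<sigma>(1)] rad_char(2)[OF rads(1) \<sigma>(1)] cK(2)[OF that]
      by (intro alg_field_mult[OF alg_field_K] alg_field_diff[OF alg_field_K])
    ultimately have "(\<chi> y - \<chi> a) * c y = 0"
      using insert.IH[of "\<lambda>z. (\<chi> z - \<chi> a) * c z" y] rads(2) dY y by blast
    then show "c y = 0" using \<sigma>(2) by (auto simp: \<chi>_def)
  qed
  then have "c a * a = 0" using sum0 by simp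
  then have "c a = 0" using rad_nonzero[OF rads(1)] by simp
  then show ?case using Y0 insert.prems(5) by auto
qed simp

text \<open>Radicals with equal characters are merged and cancelling ones dropped, which makes
  independence of characters applicable. The property \<open>Q\<close> is stable under merging; it
  will be integrality, or membership in a multiplicative set of radicals.\<close>

lemma group_by_char:
  assumes "\<And>y. y \<in> set ys \<Longrightarrow> rad y \<and> Q y"
    and closed: "\<And>y z. rad y \<Longrightarrow> Q y \<Longrightarrow> Q z \<Longrightarrow> rad z \<Longrightarrow> same_char y z \<Longrightarrow> y + z \<noteq> 0 \<Longrightarrow> Q (y + z)"
  shows "\<exists>Y. finite Y \<and> (\<forall>y\<in>Y. rad y \<and> Q y) \<and> distinct_chars Y \<and> sum_list ys = \<Sum>Y"
  using assms(1)
proof (induction ys)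
  case Nil
  then show ?case by (intro exI[of _ "{}"]) (simp add: distinct_chars_def)
next
  case (Cons h ys)
  then obtain Y where Y: "finite Y" "\<forall>y\<in>Y. rad y \<and> Q y" "distinct_chars Y" "sum_list ys = \<Sum>Y" by auto
  have h: "rad h" "Q h" using Cons.prems by auto
  show ?case
  proof (cases "\<exists>y\<in>Y. same_char h y")
    case False
    then have "h \<notin> Y" using same_char_refl by blast
    then show ?thesis using Y h False
      by (intro exI[of _ "insert h Y"]) (auto simp: distinct_chars_def dest: same_char_sym)
  next
    case True
    then obtain y where y: "y \<in> Y" "same_char h y" by blast
    have ry: "rad y" "Q y" using Y y by auto
    have sum: "sum_list (h # ys) = (h + y) + \<Sum>(Y - {y})"
      using Y(1,4) y(1) by (simp add: sum.remove[of Y y])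
    have dY: "distinct_chars (Y - {y})" using Y(3) by (auto simp: distinct_chars_def)
    show ?thesis
    proof (cases "h + y = 0")
      case True
      then show ?thesis using Y dY sum by (intro exI[of _ "Y - {y}"]) auto
    next
      case False
      define k where "k = h / y + 1"
      have k: "k \<in> K" unfolding k_def
        using alg_field_add[OF alg_field_K same_char_ratio[OF h(1) ry(1) y(2)] K_rat[of 1]] by simp
      have eq: "h + y = k * y" using rad_nonzero[OF ry(1)] by (simp add: k_def field_simps)
      then have k0: "k \<noteq> 0" using False by auto
      have sc: "same_char (h + y) y" unfolding eq by (rule ratio_same_char[OF ry(1) k k0])
      have "rad (h + y)" unfolding eq by (rule rad_mult[OF rad_K[OF k k0] ry(1)])
      moreover have "Q (h + y)" using closed h ry y(2) False by blast
      moreover have diff: "\<not> same_char (h + y) z" if "z \<in> Y - {y}" for z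
        using that Y(3) y(1) same_char_trans[OF same_char_sym[OF sc], of z] by (auto simp: distinct_chars_def)
      moreover have "h + y \<notin> Y - {y}" using diff same_char_refl by blast
      ultimately show ?thesis using Y dY sum
        by (intro exI[of _ "insert (h + y) (Y - {y})"]) (auto simp: distinct_chars_def dest: same_char_sym)
    qed
  qed
qed

text \<open>Kummer duality for a possibly infinite \<open>H\<close>. The sums of elements of
  \<open>H\<close> form a field \<open>F\<close>. If \<open>y\<close> were in it, independence of
  characters would give \<open>y\<close> the character of some \<open>h \<in> H\<close>, so that
  \<open>y\<close> would be a \<open>K\<close>-multiple of \<open>h\<close> and lie in
  \<open>H\<close>. Hence some automorphism over \<open>F\<close> moves \<open>y\<close>.\<close>

lemma rad_moved:
  assumes H: "\<And>h. h \<in> H \<Longrightarrow> rad h" "\<And>k. k \<in> K \<Longrightarrow> k \<noteq> 0 \<Longrightarrow> k \<in> H"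
    "\<And>h h'. h \<in> H \<Longrightarrow> h' \<in> H \<Longrightarrow> h * h' \<in> H"
    and y: "rad y" "y \<notin> H"
  obtains \<sigma> where "\<sigma> \<in> Gal K" "\<And>h. h \<in> H \<Longrightarrow> \<sigma> h = h" "\<sigma> y \<noteq> y"
proof -
  define F where "F = {sum_list hs | hs. set hs \<subseteq> H}"
  have HF: "H \<subseteq> F"
  proof
    fix h assume "h \<in> H"
    then show "h \<in> F" unfolding F_def by (intro CollectI exI[of _ "[h]"]) simp
  qed
  have zero: "0 \<in> F" unfolding F_def by (intro CollectI exI[of _ "[]"]) simp
  have add: "x + z \<in> F" if xz: "x \<in> F" "z \<in> F" for x z
  proof -
    obtain hs where "x = sum_list hs" "set hs \<subseteq> H" using xz(1) by (auto simp: F_def)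
    moreover obtain gs where "z = sum_list gs" "set gs \<subseteq> H" using xz(2) by (auto simp: F_def)
    ultimately show ?thesis unfolding F_def by (intro CollectI exI[of _ "hs @ gs"]) simp
  qed
  have smult: "h * x \<in> F" if hx: "h \<in> H" "x \<in> F" for h x
  proof -
    obtain hs where "x = sum_list hs" "set hs \<subseteq> H" using hx(2) by (auto simp: F_def)
    then show ?thesis unfolding F_def using hx(1) H(3)
      by (intro CollectI exI[of _ "map ((*) h) hs"]) (auto simp: sum_list_const_mult)
  qed
  have mult: "x * z \<in> F" if xz: "x \<in> F" "z \<in> F" for x z
  proof -
    obtain hs where hs: "x = sum_list hs" "set hs \<subseteq> H" using xz(1) by (auto simp: F_def)
    have "sum_list hs * z \<in> F" using hs(2)
      by (induction hs) (auto simp: distrib_right zero intro: add smult xz(2))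
    then show ?thesis using hs by simp
  qed
  have KF: "K \<subseteq> F" using H(2) HF zero by blast
  have F: "alg_field F"
    unfolding alg_field_def
  proof (intro conjI ballI)
    show "\<rat> \<subseteq> F" using KF K_rat by blast
    fix x assume "x \<in> F"
    then obtain hs where hs: "x = sum_list hs" "set hs \<subseteq> H" by (auto simp: F_def)
    have "algebraic (sum_list hs)" using hs(2) H(1) rad_algebraic
      by (induction hs) auto
    then show "algebraic x" using hs by simp
  qed (use add mult in auto)
  have "y \<notin> F"
  proof
    assume "y \<in> F"
    then obtain hs where hs: "y = sum_list hs" "set hs \<subseteq> H" by (auto simp: F_def)
    have "h + h' \<in> H" if "rad h" "h \<in> H" "h' \<in> H" "rad h'" "same_char h h'" "h + h' \<noteq> 0" for h h'
    proof -
      define k where "k = h / h' + 1"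
      have k: "k \<in> K" unfolding k_def
        using alg_field_add[OF alg_field_K same_char_ratio[OF that(1,4,5)] K_rat[of 1]] by simp
      have eq: "h + h' = k * h'" using rad_nonzero[OF that(4)] by (simp add: k_def field_simps)
      then have "k \<noteq> 0" using that(6) by auto
      then show ?thesis unfolding eq using H(2,3) k that(3) by blast
    qed
    from group_by_char[of hs "\<lambda>h. h \<in> H", OF _ this]
    obtain Y where Y: "finite Y" "\<forall>h\<in>Y. rad h \<and> h \<in> H" "distinct_chars Y" "y = \<Sum>Y"
      using hs H(1) by auto
    show False
    proof (cases "\<exists>h\<in>Y. same_char y h")
      case True
      then obtain h where h: "h \<in> Y" "same_char y h" by blast
      then have "y / h \<in> K" using same_char_ratio y(1) Y(2) by blast
      moreover have "h \<noteq> 0" using h(1) Y(2) rad_nonzero by blast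
      moreover have "y = (y / h) * h" "y / h \<noteq> 0" using \<open>h \<noteq> 0\<close> rad_nonzero[OF y(1)] by auto
      ultimately show False using H(2,3) h(1) Y(2) y(2) by metis
    next
      case False
      then have "y \<notin> Y" using same_char_refl by blast
      have d: "distinct_chars (insert y Y)"
        using Y(3) False by (auto simp: distinct_chars_def dest: same_char_sym)
      define c where "c = (\<lambda>z. if z = y then - 1 else 1 :: complex)"
      have "(\<Sum>z\<in>Y. c z * z) = \<Sum>Y"
        using \<open>y \<notin> Y\<close> by (intro sum.cong) (auto simp: c_def)
      then have "(\<Sum>z\<in>insert y Y. c z * z) = 0"
        using Y(1,4) \<open>y \<notin> Y\<close> by (simp add: c_def)
      then have "c y = 0"
        using Y(1,2) y(1) d by (intro independent_chars[of "insert y Y" c y]) (auto simp: c_def intro!: K_rat)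
      then show False by (simp add: c_def)
    qed
  qed
  then obtain \<sigma> where "\<sigma> \<in> Gal F" "\<sigma> y \<noteq> y"
    using Gal_moves[OF F rad_algebraic[OF y(1)]] by blast
  then show ?thesis
    using that[of \<sigma>] Gal_mono[of \<sigma> F K] KF Gal_fix[of \<sigma> F] HF by blast
qed

end

lemma Gal_funpow: "\<sigma> \<in> Gal F \<Longrightarrow> \<sigma> ^^ n \<in> Gal F"
  by (induction n) (use id_Gal Gal_comp in \<open>auto simp: id_def\<close>)

section \<open>Eigenvectors in abelian extensions of exponent dividing \<open>m\<close>\<close>

context kummer
begin

text \<open>The elements of abelian extensions of \<open>K\<close> of exponent dividing
  \<open>m\<close>. Imposing the conditions at all conjugates \<open>\<rho> z\<close> makes the set
  stable under \<open>Gal K\<close>.\<close>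

definition abelian_part :: "complex set" where
  "abelian_part = {z. algebraic z \<and>
     (\<forall>\<sigma>\<in>Gal K. \<forall>\<tau>\<in>Gal K. \<forall>\<rho>\<in>Gal K. \<sigma> (\<tau> (\<rho> z)) = \<tau> (\<sigma> (\<rho> z))) \<and>
     (\<forall>\<sigma>\<in>Gal K. \<forall>\<rho>\<in>Gal K. (\<sigma> ^^ m) (\<rho> z) = \<rho> z)}"

lemma ab_algebraic: "z \<in> abelian_part \<Longrightarrow> algebraic z"
  by (simp add: abelian_part_def)

lemma ab_comm: "z \<in> abelian_part \<Longrightarrow> \<sigma> \<in> Gal K \<Longrightarrow> \<tau> \<in> Gal K \<Longrightarrow> \<sigma> (\<tau> z) = \<tau> (\<sigma> z)"
  using id_Gal[of K] by (force simp: abelian_part_def)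

lemma ab_exponent: "z \<in> abelian_part \<Longrightarrow> \<sigma> \<in> Gal K \<Longrightarrow> (\<sigma> ^^ m) z = z"
  using id_Gal[of K] by (force simp: abelian_part_def)

lemma ab_Gal:
  assumes z: "z \<in> abelian_part" and \<sigma>: "\<sigma> \<in> Gal K"
  shows "\<sigma> z \<in> abelian_part"
  unfolding abelian_part_def
proof (intro CollectI conjI ballI)
  show "algebraic (\<sigma> z)" by (rule Gal_algebraic[OF \<sigma> ab_algebraic[OF z]])
next
  fix \<tau> \<tau>' \<rho> assume *: "\<tau> \<in> Gal K" "\<tau>' \<in> Gal K" "\<rho> \<in> Gal K"
  have "\<rho> \<circ> \<sigma> \<in> Gal K" by (rule Gal_comp[OF *(3) \<sigma>])
  then have "\<tau> (\<tau>' ((\<rho> \<circ> \<sigma>) z)) = \<tau>' (\<tau> ((\<rho> \<circ> \<sigma>) z))"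
    using z * unfolding abelian_part_def by blast
  then show "\<tau> (\<tau>' (\<rho> (\<sigma> z))) = \<tau>' (\<tau> (\<rho> (\<sigma> z)))" by simp
next
  fix \<tau> \<rho> assume *: "\<tau> \<in> Gal K" "\<rho> \<in> Gal K"
  have "\<rho> \<circ> \<sigma> \<in> Gal K" by (rule Gal_comp[OF *(2) \<sigma>])
  then have "(\<tau> ^^ m) ((\<rho> \<circ> \<sigma>) z) = (\<rho> \<circ> \<sigma>) z"
    using z * unfolding abelian_part_def by blast
  then show "(\<tau> ^^ m) (\<rho> (\<sigma> z)) = \<rho> (\<sigma> z)" by simp
qed

lemma ab_add:
  assumes "z \<in> abelian_part" "w \<in> abelian_part"
  shows "z + w \<in> abelian_part"
  unfolding abelian_part_def
proof (intro CollectI conjI ballI)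
  note a = ab_algebraic[OF assms(1)] ab_algebraic[OF assms(2)]
  show "algebraic (z + w)" using a by (rule algebraic_add)
  fix \<sigma> \<tau> \<rho> assume *: "\<sigma> \<in> Gal K" "\<tau> \<in> Gal K" "\<rho> \<in> Gal K"
  show "\<sigma> (\<tau> (\<rho> (z + w))) = \<tau> (\<sigma> (\<rho> (z + w)))"
    using ab_comm[OF ab_Gal[OF assms(1) *(3)] *(1,2)] ab_comm[OF ab_Gal[OF assms(2) *(3)] *(1,2)] a
    by (simp add: Gal_add[OF *(1)] Gal_add[OF *(2)] Gal_add[OF *(3)]
        Gal_algebraic[OF *(1)] Gal_algebraic[OF *(2)] Gal_algebraic[OF *(3)])
next
  note a = ab_algebraic[OF assms(1)] ab_algebraic[OF assms(2)]
  fix \<sigma> \<rho> assume *: "\<sigma> \<in> Gal K" "\<rho> \<in> Gal K"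
  show "(\<sigma> ^^ m) (\<rho> (z + w)) = \<rho> (z + w)"
    using ab_exponent[OF ab_Gal[OF assms(1) *(2)] *(1)] ab_exponent[OF ab_Gal[OF assms(2) *(2)] *(1)] a
    by (simp add: Gal_add[OF *(2)] Gal_add[OF Gal_funpow[OF *(1)]] Gal_algebraic[OF *(2)])
qed

lemma ab_scale:
  assumes "k \<in> K" "z \<in> abelian_part"
  shows "k * z \<in> abelian_part"
  unfolding abelian_part_def
proof (intro CollectI conjI ballI)
  have g: "\<gamma> (k * x) = k * \<gamma> x" if "\<gamma> \<in> Gal K" "algebraic x" for \<gamma> x
    using that Gal_mult[OF that(1) K_algebraic[OF assms(1)] that(2)] Gal_fix[OF that(1) assms(1)] by simp
  note a = ab_algebraic[OF assms(2)]
  show "algebraic (k * z)" using K_algebraic[OF assms(1)] a by (rule algebraic_mult)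
  fix \<sigma> \<tau> \<rho> assume *: "\<sigma> \<in> Gal K" "\<tau> \<in> Gal K" "\<rho> \<in> Gal K"
  show "\<sigma> (\<tau> (\<rho> (k * z))) = \<tau> (\<sigma> (\<rho> (k * z)))"
    using ab_comm[OF ab_Gal[OF assms(2) *(3)] *(1,2)] a
    by (simp add: g * Gal_algebraic[OF *(1)] Gal_algebraic[OF *(2)] Gal_algebraic[OF *(3)])
next
  have g: "\<gamma> (k * x) = k * \<gamma> x" if "\<gamma> \<in> Gal K" "algebraic x" for \<gamma> x
    using that Gal_mult[OF that(1) K_algebraic[OF assms(1)] that(2)] Gal_fix[OF that(1) assms(1)] by simp
  note a = ab_algebraic[OF assms(2)]
  fix \<sigma> \<rho> assume *: "\<sigma> \<in> Gal K" "\<rho> \<in> Gal K"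
  show "(\<sigma> ^^ m) (\<rho> (k * z)) = \<rho> (k * z)"
    using ab_exponent[OF ab_Gal[OF assms(2) *(2)] *(1)] a
    by (simp add: g * Gal_funpow Gal_algebraic[OF *(2)])
qed

lemma ab_0: "0 \<in> abelian_part"
  using Gal_0 Gal_funpow by (simp add: abelian_part_def) (metis Gal_0 Gal_funpow)

lemma ab_sum: "(\<And>i. i \<in> I \<Longrightarrow> f i \<in> abelian_part) \<Longrightarrow> (\<Sum>i\<in>I. f i) \<in> abelian_part"
  by (induction I rule: infinite_finite_induct) (auto intro: ab_add ab_0)

definition \<omega> :: complex where "\<omega> = cis (2 * pi / m)"

lemma \<omega>_power_m: "\<omega> ^ m = 1"
  using m_pos by (simp add: \<omega>_def DeMoivre)

lemma \<omega>_power_neq_1: "0 < j \<Longrightarrow> j < m \<Longrightarrow> \<omega> ^ j \<noteq> 1"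
proof
  assume j: "0 < j" "j < m" "\<omega> ^ j = 1"
  have "inj_on (\<lambda>k. cis (2 * pi * real k / real m)) {..<m}"
    using bij_betw_roots_unity[OF m_pos] by (simp add: bij_betw_def)
  moreover have "cis (2 * pi * real j / real m) = cis (2 * pi * real 0 / real m)"
    using j(3) by (simp add: \<omega>_def DeMoivre mult_ac)
  ultimately have "j = 0" using j(1,2) m_pos inj_onD[of _ "{..<m}" j 0] by blast
  then show False using j(1) by simp
qed

lemma \<omega>_algebraic_int: "algebraic_int \<omega>"
  by (rule algebraic_int_root[of 1 "Polynomial.monom 1 m"])
     (use m_pos \<omega>_power_m in \<open>auto simp: poly_monom degree_monom_eq\<close>)

lemma \<omega>_power_K: "\<omega> ^ n \<in> K"
  by (rule unity_K) (metis \<omega>_power_m power_mult mult.commute power_one)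

text \<open>
  \<open>proj \<sigma> k\<close> projects onto the \<open>\<omega> ^ k\<close>-eigenspace of \<open>\<sigma>\<close>, up to a factor \<open>m\<close>; the exponent
  \<open>k * (m - 1)\<close> stands for \<open>- k\<close>.
\<close>

definition proj :: "(complex \<Rightarrow> complex) \<Rightarrow> nat \<Rightarrow> complex \<Rightarrow> complex" where
  "proj \<sigma> k z = (\<Sum>j<m. \<omega> ^ (k * (m - 1) * j) * (\<sigma> ^^ j) z)"

text \<open>Orthogonality of the powers of the primitive root \<omega>: summation over
  \<open>k\<close> keeps only the term \<open>j = 0\<close>.\<close>

lemma sum_proj: "(\<Sum>k<m. proj \<sigma> k z) = of_nat m * z"
proof -
  have "(\<Sum>k<m. \<omega> ^ (k * (m - 1) * j)) = (if j = 0 then of_nat m else 0)" if j: "j < m" for j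
  proof (cases "j = 0")
    case False
    define \<xi> where "\<xi> = \<omega> ^ ((m - 1) * j)"
    have "\<xi> * \<omega> ^ j = \<omega> ^ (m * j)"
      using m_pos by (simp add: \<xi>_def algebra_simps flip: power_add)
    then have "\<xi> * \<omega> ^ j = 1" by (simp add: power_mult \<omega>_power_m)
    then have "\<xi> \<noteq> 1" using \<omega>_power_neq_1[of j] False j by auto
    have "\<xi> ^ m = (\<omega> ^ m) ^ ((m - 1) * j)"
      unfolding \<xi>_def by (metis mult.commute power_mult)
    then have "\<xi> ^ m = 1" by (simp add: \<omega>_power_m)
    have "(\<Sum>k<m. \<omega> ^ (k * (m - 1) * j)) = (\<Sum>k<m. \<xi> ^ k)"
      unfolding \<xi>_def by (intro sum.cong refl) (simp add: mult_ac flip: power_mult)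
    also have "\<dots> = (1 - \<xi> ^ m) / (1 - \<xi>)" using \<open>\<xi> \<noteq> 1\<close> by (simp add: sum_gp_strict)
    finally show ?thesis using \<open>\<xi> ^ m = 1\<close> False by simp
  qed simp
  then have "(\<Sum>j<m. (\<Sum>k<m. \<omega> ^ (k * (m - 1) * j)) * (\<sigma> ^^ j) z)
      = (\<Sum>j<m. (if j = 0 then of_nat m else 0) * (\<sigma> ^^ j) z)"
    by (intro sum.cong) auto
  also have "\<dots> = of_nat m * z"
    using m_pos by (simp add: if_distrib[of "\<lambda>x. x * _"] sum.delta cong: if_cong)
  finally show ?thesis
    unfolding proj_def by (subst sum.swap) (simp add: sum_distrib_right)
qed

context
  fixes \<sigma> :: "complex \<Rightarrow> complex" and z :: complex
  assumes \<sigma>: "\<sigma> \<in> Gal K" and z: "z \<in> abelian_part"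
begin

lemma funpow_ab: "(\<sigma> ^^ j) z \<in> abelian_part"
  by (rule ab_Gal[OF z Gal_funpow[OF \<sigma>]])

lemma proj_ab: "proj \<sigma> k z \<in> abelian_part"
  unfolding proj_def by (intro ab_sum ab_scale \<omega>_power_K funpow_ab)

lemma proj_algebraic_int: "algebraic_int z \<Longrightarrow> algebraic_int (proj \<sigma> k z)"
  unfolding proj_def
  by (intro algebraic_int_sum algebraic_int_mult algebraic_int_power \<omega>_algebraic_int Gal_algebraic_int[OF Gal_funpow[OF \<sigma>]])

lemma Gal_proj:
  assumes \<tau>: "\<tau> \<in> Gal K"
  shows "\<tau> (proj \<sigma> k z) = proj \<sigma> k (\<tau> z)"
proof -
  have "\<tau> (\<omega> ^ (k * (m - 1) * j) * (\<sigma> ^^ j) z) = \<omega> ^ (k * (m - 1) * j) * (\<sigma> ^^ j) (\<tau> z)" for j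
    using Gal_mult[OF \<tau> K_algebraic[OF \<omega>_power_K] ab_algebraic[OF funpow_ab]] Gal_fix[OF \<tau> \<omega>_power_K]
      ab_comm[OF z \<tau> Gal_funpow[OF \<sigma>]] by simp
  moreover have "\<tau> (proj \<sigma> k z) = (\<Sum>j<m. \<tau> (\<omega> ^ (k * (m - 1) * j) * (\<sigma> ^^ j) z))"
    unfolding proj_def
    by (intro Gal_sum[OF \<tau>] algebraic_mult K_algebraic[OF \<omega>_power_K] ab_algebraic[OF funpow_ab])
  ultimately show ?thesis by (simp add: proj_def)
qed

text \<open>Applying \<sigma> shifts the summation index by one, and the sum is cyclic because
  \<open>\<sigma> ^^ m\<close> fixes \<open>z\<close>.\<close>

lemma proj_eigen: "\<sigma> (proj \<sigma> k z) = \<omega> ^ k * proj \<sigma> k z"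
proof -
  define f where "f = (\<lambda>j. \<omega> ^ (k * (m - 1) * j) * (\<sigma> ^^ j) z)"
  have f: "\<omega> ^ (k * (m - 1) * j) * (\<sigma> ^^ j) (\<sigma> z) = \<omega> ^ k * f (Suc j)" for j
  proof -
    have "k + k * (m - 1) * Suc j = m * k + k * (m - 1) * j"
      using m_pos by (cases m) (auto simp: algebra_simps)
    then have "\<omega> ^ k * \<omega> ^ (k * (m - 1) * Suc j) = \<omega> ^ (m * k) * \<omega> ^ (k * (m - 1) * j)"
      by (metis power_add)
    also have "\<omega> ^ (m * k) = 1" by (simp add: power_mult \<omega>_power_m)
    finally have "\<omega> ^ k * \<omega> ^ (k * (m - 1) * Suc j) = \<omega> ^ (k * (m - 1) * j)" by simp
    then show ?thesis by (simp only: f_def funpow_Suc_right o_apply flip: mult.assoc)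
  qed
  have "\<sigma> (proj \<sigma> k z) = (\<Sum>j<m. \<omega> ^ k * f (Suc j))"
    unfolding Gal_proj[OF \<sigma>] unfolding proj_def by (intro sum.cong refl f)
  also have "\<dots> = \<omega> ^ k * (\<Sum>j<m. f (Suc j))" by (simp add: sum_distrib_left)
  also have "(\<Sum>j<m. f (Suc j)) = (\<Sum>j<m. f j)"
  proof -
    have "f m = (\<omega> ^ m) ^ (k * (m - 1)) * z"
      using ab_exponent[OF z \<sigma>] by (simp add: f_def mult.commute flip: power_mult)
    then have "f m = f 0" by (simp add: f_def \<omega>_power_m)
    moreover have "(\<Sum>j<m. f (Suc j)) + f 0 = (\<Sum>j<m. f j) + f m"
      using sum.lessThan_Suc_shift[of f m] by (simp add: add.commute)
    ultimately show ?thesis by simp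
  qed
  finally show ?thesis by (simp add: f_def proj_def)
qed

end

text \<open>Successive projections, each at the cost of a factor \<open>m\<close>. As everything
  commutes, eigenvectors of earlier automorphisms stay eigenvectors. The clause on
  \<open>\<sigma> x = \<tau> x\<close> says that the components lie in the field generated by
  \<open>x\<close> over \<open>K\<close>; it lets a finite list \<open>ss\<close> control all of
  \<open>Gal K\<close>.\<close>

lemma eigen_decomposition:
  assumes x: "x \<in> abelian_part" "algebraic_int x" and "set ss \<subseteq> Gal K"
  shows "\<exists>ys. of_nat (m ^ length ss) * x = sum_list ys \<and> (\<forall>y\<in>set ys. y \<in> abelian_part \<and> algebraic_int y
    \<and> (\<forall>\<sigma>\<in>Gal K. \<forall>\<tau>\<in>Gal K. \<sigma> x = \<tau> x \<longrightarrow> \<sigma> y = \<tau> y) \<and> (\<forall>\<sigma>\<in>set ss. \<exists>k. \<sigma> y = \<omega> ^ k * y))"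
  using assms(3)
proof (induction ss)
  case Nil
  then show ?case using x by (intro exI[of _ "[x]"]) auto
next
  case (Cons s ss)
  then obtain ys where sum: "of_nat (m ^ length ss) * x = sum_list ys"
    and ys: "\<And>y. y \<in> set ys \<Longrightarrow> y \<in> abelian_part" "\<And>y. y \<in> set ys \<Longrightarrow> algebraic_int y"
      "\<And>y \<sigma> \<tau>. y \<in> set ys \<Longrightarrow> \<sigma> \<in> Gal K \<Longrightarrow> \<tau> \<in> Gal K \<Longrightarrow> \<sigma> x = \<tau> x \<Longrightarrow> \<sigma> y = \<tau> y"
      "\<And>y \<sigma>. y \<in> set ys \<Longrightarrow> \<sigma> \<in> set ss \<Longrightarrow> \<exists>k. \<sigma> y = \<omega> ^ k * y"
    by auto
  have s: "s \<in> Gal K" and ss: "set ss \<subseteq> Gal K" using Cons.prems by auto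
  define zs where "zs = concat (map (\<lambda>y. map (\<lambda>k. proj s k y) [0..<m]) ys)"
  have "sum_list (map (\<lambda>k. proj s k y) [0..<m]) = of_nat m * y" for y
    using sum_proj[of s y] by (simp add: sum_list_sum_nth atLeast0LessThan)
  then have "sum_list zs = of_nat m * sum_list ys"
    unfolding zs_def by (induction ys) (simp_all add: distrib_left)
  then have "of_nat (m ^ length (s # ss)) * x = sum_list zs"
    by (simp add: mult.assoc flip: sum)
  moreover have "z \<in> abelian_part \<and> algebraic_int z
    \<and> (\<forall>\<sigma>\<in>Gal K. \<forall>\<tau>\<in>Gal K. \<sigma> x = \<tau> x \<longrightarrow> \<sigma> z = \<tau> z) \<and> (\<forall>\<sigma>\<in>set (s # ss). \<exists>k. \<sigma> z = \<omega> ^ k * z)"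
    if zz: "z \<in> set zs" for z
  proof -
    obtain y k where z: "z = proj s k y" and y: "y \<in> set ys" using zz by (auto simp: zs_def)
    note ya = ys(1)[OF y]
    have 1: "z \<in> abelian_part" "algebraic_int z"
      unfolding z by (rule proj_ab[OF s ya], rule proj_algebraic_int[OF s ya ys(2)[OF y]])
    have 2: "\<sigma> z = \<tau> z" if "\<sigma> \<in> Gal K" "\<tau> \<in> Gal K" "\<sigma> x = \<tau> x" for \<sigma> \<tau>
      unfolding z using ys(3)[OF y that] by (simp add: Gal_proj[OF s ya] that)
    have 3: "\<exists>k. \<sigma> z = \<omega> ^ k * z" if "\<sigma> \<in> set (s # ss)" for \<sigma>
    proof (cases "\<sigma> = s")
      case True
      then show ?thesis using proj_eigen[OF s ya] z by blast
    next
      case False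
      then have \<sigma>: "\<sigma> \<in> set ss" "\<sigma> \<in> Gal K" using that ss by auto
      obtain l where l: "\<sigma> y = \<omega> ^ l * y" using ys(4)[OF y \<sigma>(1)] by blast
      have "(s ^^ j) (\<omega> ^ l * y) = \<omega> ^ l * (s ^^ j) y" for j
        using Gal_mult[OF Gal_funpow[OF s] K_algebraic[OF \<omega>_power_K] ab_algebraic[OF ya]]
          Gal_fix[OF Gal_funpow[OF s] \<omega>_power_K] by simp
      then have "proj s k (\<omega> ^ l * y) = \<omega> ^ l * proj s k y"
        by (simp add: proj_def sum_distrib_left mult_ac)
      then show ?thesis using l z Gal_proj[OF s ya \<sigma>(2)] by auto
    qed
    show ?thesis using 1 2 3 by blast
  qed
  ultimately show ?case by blast
qed

text \<open>The list of automorphisms represents all conjugates of \<open>x\<close> over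
  \<open>K\<close>. Every \<sigma> therefore acts on each component as some representative does,
  namely by a power of \<omega>, and the \<open>m\<close>-th power of the component is
  fixed.\<close>

lemma radical_decomposition:
  assumes x: "x \<in> abelian_part" "algebraic_int x"
  obtains r Y where "finite Y" "\<And>y. y \<in> Y \<Longrightarrow> rad y" "\<And>y. y \<in> Y \<Longrightarrow> algebraic_int y"
    "distinct_chars Y" "of_nat (m ^ r) * x = \<Sum>Y"
proof -
  define Or where "Or = (\<lambda>\<sigma>. \<sigma> x) ` Gal K"
  have fin: "finite Or" unfolding Or_def by (rule finite_rat_poly_orbit[OF ab_algebraic[OF x(1)]])
  obtain os where os: "set os = Or" using finite_list[OF fin] by blast
  define rep where "rep = (\<lambda>t. SOME \<sigma>. \<sigma> \<in> Gal K \<and> \<sigma> x = t)"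
  have rep: "rep t \<in> Gal K" "rep t x = t" if t: "t \<in> Or" for t
  proof -
    have "\<exists>\<sigma>. \<sigma> \<in> Gal K \<and> \<sigma> x = t" using t by (auto simp: Or_def)
    from someI_ex[OF this] show "rep t \<in> Gal K" "rep t x = t" by (auto simp: rep_def)
  qed
  define ss where "ss = map rep os"
  have "set ss \<subseteq> Gal K" using rep os by (auto simp: ss_def)
  then obtain ys where sum: "of_nat (m ^ length ss) * x = sum_list ys"
    and ys: "\<forall>y\<in>set ys. y \<in> abelian_part \<and> algebraic_int y
    \<and> (\<forall>\<sigma>\<in>Gal K. \<forall>\<tau>\<in>Gal K. \<sigma> x = \<tau> x \<longrightarrow> \<sigma> y = \<tau> y) \<and> (\<forall>\<sigma>\<in>set ss. \<exists>k. \<sigma> y = \<omega> ^ k * y)"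
    using eigen_decomposition[OF x, of ss] by metis
  have rad: "rad y" if y: "y \<in> set ys" "y \<noteq> 0" for y
  proof -
    have alg: "algebraic y" using ys y by blast
    have "y ^ m \<in> K"
    proof (rule fixed_by_Gal[OF alg_field_K])
      fix \<sigma> assume \<sigma>: "\<sigma> \<in> Gal K"
      then have o: "\<sigma> x \<in> Or" by (auto simp: Or_def)
      then have "\<sigma> y = rep (\<sigma> x) y" using ys y(1) \<sigma> rep[OF o] by metis
      moreover have "rep (\<sigma> x) \<in> set ss" using o os by (simp add: ss_def)
      ultimately obtain k where "\<sigma> y = \<omega> ^ k * y" using ys y(1) by metis
      then have "\<sigma> y ^ m = (\<omega> ^ m) ^ k * y ^ m"
        by (metis power_mult_distrib power_mult mult.commute)
      then show "\<sigma> (y ^ m) = y ^ m" by (simp add: Gal_power[OF \<sigma> alg] \<omega>_power_m)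
    qed (use alg in blast)
    then show ?thesis using alg y by (simp add: rad_def)
  qed
  have "\<exists>Y. finite Y \<and> (\<forall>y\<in>Y. rad y \<and> algebraic_int y) \<and> distinct_chars Y \<and> sum_list (filter (\<lambda>y. y \<noteq> 0) ys) = \<Sum>Y"
    by (rule group_by_char) (use rad ys in auto)
  moreover have "sum_list (filter (\<lambda>y. y \<noteq> 0) ys) = sum_list ys"
    by (induction ys) auto
  ultimately show ?thesis using that sum by metis
qed

text \<open>The characteristic polynomial has degree \<open>deg\<close>, so value exponents on
  \<open>K\<close> have denominators at most \<open>deg\<close>, and a value below 1 is at most
  \<open>p powr (- 1 / deg)\<close>.\<close>

lemma av_value_gap:
  assumes "padic_abs p av" and z: "z \<in> K" "algebraic_int z" "av z < 1"
  shows "av z ^ deg \<le> 1 / p"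
proof (cases "z = 0")
  case True
  then show ?thesis using padic_abs.av_0[OF assms(1)] deg_pos by (simp add: zero_power)
next
  case False
  interpret padic_abs p av by fact
  have "algebraic_int (coeff (char_poly_K z) i)" for i
    unfolding char_poly_K_def
    by (rule coeff_lin_prod_algebraic_int[OF finite_emb]) (rule Gal_algebraic_int[OF emb_Gal z(2)])
  then have "coeff (char_poly_K z) i \<in> \<int>" for i
    using coeff_char_poly_K[OF z(1)] rational_algebraic_int_is_int by blast
  then obtain f where f: "char_poly_K z = map_poly of_int f" using intpolyE by metis
  have "f \<noteq> 0" using lead_coeff_char_poly_K[of z] by (auto simp: f)
  then obtain k j where k: "0 < k" "k \<le> degree f" "av z ^ k = p powi j"
    using av_discrete[of f z] poly_char_poly_K[OF z(1)] f False by metis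
  have pos: "av z > 0" using av_pos[OF K_algebraic[OF z(1)] False] .
  have "av z ^ k < 1" using power_strict_mono[of "av z" 1 k] z(3) pos k(1) by simp
  moreover have "real p ^ nat j \<ge> 1" using p_gt_1 by (intro one_le_power) simp
  ultimately have "j < 0" using k(3) by (cases "j \<ge> 0") (auto simp: power_int_def)
  then have "real p powi j \<le> real p powi (-1)"
    using p_gt_1 by (intro power_int_increasing) auto
  then have "av z ^ k \<le> 1 / p" using k(3) by (simp add: power_int_minus divide_inverse)
  moreover have "k \<le> deg" using k(2) degree_char_poly_K[of z] f by simp
  then have "av z ^ deg \<le> av z ^ k" using pos z(3) by (intro power_decreasing) auto
  ultimately show ?thesis by linarith
qed

text \<open>
  The elements of \<open>Gal K\<close> fixing all radicals unramified at \<open>\<rho>\<close> play the role of the inertia group: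
  if \<open>\<sigma>\<close> is one of them that moves \<open>x\<close>, then \<open>\<sigma> x - x\<close> is divisible by the primes below \<open>\<rho>\<close>, and
  its norm is too large for a number of bounded house unless \<open>p\<close> is small.
\<close>

lemma unramified_components:
  assumes av: "padic_abs p av" and \<rho>: "\<rho> \<in> Gal \<rat>"
    and x: "algebraic_int x" "\<And>\<gamma>. \<gamma> \<in> Gal \<rat> \<Longrightarrow> cmod (\<gamma> x) \<le> T" and T: "T \<ge> 1"
    and Y: "finite Y" "\<And>y. y \<in> Y \<Longrightarrow> rad y" "\<And>y. y \<in> Y \<Longrightarrow> algebraic_int y"
      "distinct_chars Y" "of_nat (m ^ r) * x = \<Sum>Y"
    and p: "p > m" "real p > (2 * T) ^ (m * deg\<^sup>2)"
    and y: "y \<in> Y"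
  shows "\<exists>z\<in>K. z \<noteq> 0 \<and> av (\<rho> (z * y)) = 1"
proof (rule ccontr)
  interpret padic_abs p av by fact
  \<comment> \<open>The radicals with a \<open>K\<close>-multiple of value 1 at the place given by
    \<open>av\<close> and \<rho>. Kummer duality provides the automorphism that fixes them and moves
    \<open>y\<close>.\<close>
  define H where "H = {h. rad h \<and> (\<exists>z\<in>K. z \<noteq> 0 \<and> av (\<rho> (z * h)) = 1)}"
  assume "\<not> (\<exists>z\<in>K. z \<noteq> 0 \<and> av (\<rho> (z * y)) = 1)"
  then have "y \<notin> H" by (auto simp: H_def)
  have H_K: "k \<in> H" if k: "k \<in> K" "k \<noteq> 0" for k
    unfolding H_def using rad_K[OF k] k Gal_1[OF \<rho>] av_1 alg_field_inverse[OF alg_field_K k(1)]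
    by (intro CollectI conjI bexI[of _ "inverse k"]) auto
  have H_mult: "h * h' \<in> H" if hh: "h \<in> H" "h' \<in> H" for h h'
  proof -
    obtain z z' where z: "z \<in> K" "z \<noteq> 0" "av (\<rho> (z * h)) = 1" "z' \<in> K" "z' \<noteq> 0" "av (\<rho> (z' * h')) = 1"
      and r: "rad h" "rad h'"
      using hh by (auto simp: H_def)
    have a: "algebraic (z * h)" "algebraic (z' * h')"
      using algebraic_mult[OF K_algebraic rad_algebraic] z r by blast+
    have "\<rho> ((z * z') * (h * h')) = \<rho> (z * h) * \<rho> (z' * h')"
      using Gal_mult[OF \<rho> a] by (simp add: mult_ac)
    then have "av (\<rho> ((z * z') * (h * h'))) = 1"
      using z a by (simp add: av_mult Gal_algebraic[OF \<rho>])
    then show ?thesis unfolding H_def using rad_mult[OF r] z alg_field_mult[OF alg_field_K]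
      by (intro CollectI conjI bexI[of _ "z * z'"]) auto
  qed
  have H_rad: "rad h" if "h \<in> H" for h using that by (simp add: H_def)
  obtain \<sigma> where \<sigma>: "\<sigma> \<in> Gal K" "\<And>h. h \<in> H \<Longrightarrow> \<sigma> h = h" "\<sigma> y \<noteq> y"
    using rad_moved[of H, OF H_rad H_K H_mult Y(2)[OF y] \<open>y \<notin> H\<close>] by blast
  have \<rho>': "\<rho>' \<in> Gal \<rat>" if "\<rho>' \<in> Gal K" for \<rho>' using that by (rule Gal_Rats)
  define u where "u = \<sigma> x - x"
  define n :: nat where "n = m ^ r"
  have x_alg: "algebraic x" using x(1) by blast
  have Y_alg: "algebraic y" if "y \<in> Y" for y using Y(2) that rad_algebraic by blast
  have u_int: "algebraic_int u"
    unfolding u_def using x(1) Gal_algebraic_int[OF \<sigma>(1)] by blast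
  have nu: "of_nat n * u = (\<Sum>y\<in>Y. (\<sigma> y / y - 1) * y)"
  proof -
    have "of_nat n * \<sigma> x = \<sigma> (\<Sum>Y)"
      using Gal_mult[OF \<sigma>(1), of "of_nat n" x] Gal_of_nat[OF \<sigma>(1), of n] x_alg Y(5)
      by (simp add: n_def rat_imp_algebraic)
    also have "\<dots> = (\<Sum>y\<in>Y. \<sigma> y)" using Gal_sum[OF \<sigma>(1), of Y "\<lambda>y. y"] Y_alg by simp
    finally have "of_nat n * u = (\<Sum>y\<in>Y. \<sigma> y - y)"
      using Y(5) by (simp add: u_def n_def right_diff_distrib sum_subtractf)
    also have "\<dots> = (\<Sum>y\<in>Y. (\<sigma> y / y - 1) * y)"
      using Y(2) rad_nonzero by (intro sum.cong) (auto simp: left_diff_distrib)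
    finally show ?thesis .
  qed
  \<comment> \<open>The coefficient \<open>\<sigma> y / y - 1\<close> in the expansion of
    \<open>of_nat n * u\<close> is nonzero, and independence of characters excludes
    cancellation.\<close>
  have "u \<noteq> 0"
  proof
    assume "u = 0"
    then have "(\<Sum>y\<in>Y. (\<sigma> y / y - 1) * y) = 0" using nu by simp
    moreover have "\<sigma> y / y - 1 \<in> K" if "y \<in> Y" for y
      using alg_field_diff[OF alg_field_K rad_char(2)[OF Y(2)[OF that] \<sigma>(1)] K_rat[of 1]] by simp
    ultimately have "\<sigma> y / y - 1 = 0"
      using independent_chars[OF Y(1,2,4), of "\<lambda>y. \<sigma> y / y - 1" y] y by blast
    then show False using \<sigma>(3) rad_nonzero[OF Y(2)[OF y]] by simp
  qed
  have small: "av (\<rho> (\<tau> u)) ^ (m * deg) \<le> 1 / p" if \<tau>: "\<tau> \<in> Gal K" for \<tau>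
  proof -
    define \<gamma> where "\<gamma> = \<rho> \<circ> \<tau>"
    have \<gamma>: "\<gamma> \<in> Gal \<rat>" unfolding \<gamma>_def by (rule Gal_comp[OF \<rho> Gal_Rats[OF \<tau>]])
    \<comment> \<open>A radical \<open>z \<in> Y\<close> outside \<open>H\<close> is integral of
      value different from 1, so less than 1. The value gap applied to the image of
      \<open>z ^ m\<close>, which lies in \<open>K\<close>, bounds its value by this root of
      \<open>1 / p\<close>.\<close>
    define B where "B = root (m * deg) (1 / p)"
    have md: "m * deg > 0" using m_pos deg_pos by simp
    have B: "B \<ge> 0" "B ^ (m * deg) = 1 / p"
      using md by (simp_all add: B_def)
    have summand: "av (\<gamma> ((\<sigma> z / z - 1) * z)) \<le> B" if z: "z \<in> Y" for z
    proof (cases "z \<in> H")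
      case True
      then have "\<sigma> z / z - 1 = 0" using \<sigma>(2) rad_nonzero[OF Y(2)[OF z]] by simp
      then show ?thesis using B(1) by (simp add: Gal_0[OF \<gamma>] av_0)
    next
      case False
      note rz = Y(2)[OF z]
      have kz: "\<tau> z / z \<in> K" "(\<tau> z / z) ^ m = 1" using rad_char[OF rz \<tau>] by auto
      \<comment> \<open>\<tau> multiplies \<open>z\<close> by a root of unity only, which is why the
        same smallness holds at every conjugate \<open>\<rho> (\<tau> u)\<close>.\<close>
      have \<gamma>z: "av (\<gamma> z) = av (\<rho> z)"
      proof -
        have "\<gamma> z = \<rho> (\<tau> z / z) * \<rho> z"
          using Gal_mult[OF \<rho> K_algebraic[OF kz(1)] rad_algebraic[OF rz]] rad_nonzero[OF rz] by (simp add: \<gamma>_def)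
        moreover have "\<rho> (\<tau> z / z) ^ m = 1"
          using Gal_power[OF \<rho> K_algebraic[OF kz(1)], of m] kz(2) Gal_1[OF \<rho>] by simp
        ultimately show ?thesis
          using av_mult[of "\<rho> (\<tau> z / z)" "\<rho> z"] av_root_of_unity[of "\<rho> (\<tau> z / z)" m] m_pos
            Gal_algebraic[OF \<rho>] K_algebraic[OF kz(1)] rad_algebraic[OF rz] by simp
      qed
      have "1 \<in> K" by (rule K_rat) simp
      have "av (\<rho> z) \<noteq> 1"
      proof
        assume "av (\<rho> z) = 1"
        then have "z \<in> H"
          unfolding H_def using rz \<open>1 \<in> K\<close> by (intro CollectI conjI bexI[of _ 1]) simp_all
        with False show False by simp
      qed
      moreover have "av (\<rho> z) \<le> 1" by (rule av_integral[OF Gal_algebraic_int[OF \<rho> Y(3)[OF z]]])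
      ultimately have lt: "av (\<gamma> z) < 1" using \<gamma>z by simp
      have za: "algebraic (\<gamma> z)" by (rule Gal_algebraic[OF \<gamma> rad_algebraic[OF rz]])
      have "av (\<gamma> (z ^ m)) = av (\<gamma> z) ^ m"
        using Gal_power[OF \<gamma> rad_algebraic[OF rz]] av_power[OF za] by simp
      moreover have "av (\<gamma> z) ^ m < 1"
        using power_strict_mono[OF lt av_nonneg[OF za] m_pos] by simp
      ultimately have "(av (\<gamma> z) ^ m) ^ deg \<le> 1 / p"
        using av_value_gap[OF av, of "\<gamma> (z ^ m)"] Gal_K_image[OF \<gamma>] rz Y(3)[OF z] Gal_algebraic_int[OF \<gamma>, of "z ^ m"]
        by (auto simp: rad_def)
      then have "av (\<gamma> z) ^ (m * deg) \<le> B ^ (m * deg)" using B(2) by (simp add: power_mult)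
      then have zB: "av (\<gamma> z) \<le> B" using power_mono_iff[OF av_nonneg[OF za] B(1) md] by simp
      have cK: "\<sigma> z / z - 1 \<in> K"
        using alg_field_diff[OF alg_field_K rad_char(2)[OF rz \<sigma>(1)] K_rat[of 1]] by simp
      have "algebraic_int (\<sigma> z / z)"
        by (rule algebraic_int_root[of 1 "Polynomial.monom 1 m"])
           (use m_pos rad_char(1)[OF rz \<sigma>(1)] in \<open>auto simp: poly_monom degree_monom_eq\<close>)
      then have "algebraic_int (\<sigma> z / z - 1)" by auto
      then have c1: "av (\<gamma> (\<sigma> z / z - 1)) \<le> 1" by (intro av_integral Gal_algebraic_int[OF \<gamma>])
      have "av (\<gamma> ((\<sigma> z / z - 1) * z)) = av (\<gamma> (\<sigma> z / z - 1)) * av (\<gamma> z)"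
        using Gal_mult[OF \<gamma> K_algebraic[OF cK] rad_algebraic[OF rz]]
          av_mult[OF Gal_algebraic[OF \<gamma> K_algebraic[OF cK]] za] by simp
      also have "\<dots> \<le> 1 * B"
        using c1 zB av_nonneg[OF za] by (intro mult_mono) auto
      finally show ?thesis by simp
    qed
    have ta: "algebraic ((\<sigma> z / z - 1) * z)" if "z \<in> Y" for z
    proof -
      have "\<sigma> z / z - 1 \<in> K"
        using alg_field_diff[OF alg_field_K rad_char(2)[OF Y(2)[OF that] \<sigma>(1)] K_rat[of 1]] by simp
      then show ?thesis using Y_alg[OF that] K_algebraic by blast
    qed
    have "\<gamma> (of_nat n * u) = (\<Sum>z\<in>Y. \<gamma> ((\<sigma> z / z - 1) * z))"
      unfolding nu by (rule Gal_sum[OF \<gamma> ta])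
    then have "av (\<gamma> (of_nat n * u)) \<le> B"
      using av_sum_le[of Y "\<lambda>z. \<gamma> ((\<sigma> z / z - 1) * z)" B] summand B(1) Gal_algebraic[OF \<gamma> ta] by simp
    moreover have "av (\<gamma> (of_nat n * u)) = av (\<gamma> u)"
    proof -
      \<comment> \<open>As \<open>p > m\<close>, the denominator \<open>m ^ r\<close> of the
        decomposition is a unit at \<open>p\<close>.\<close>
      have "\<not> int p dvd int m" using p(1) m_pos by (auto dest: zdvd_imp_le)
      then have "\<not> int p dvd int n"
        unfolding n_def of_nat_power using prime_p by (metis prime_dvd_power prime_int_nat_transfer prime_nat_int_transfer)
      then have "av (of_nat n) = 1" using av_coprime[of "int n"] by simp
      then show ?thesis
        using Gal_mult[OF \<gamma>, of "of_nat n" u] Gal_of_nat[OF \<gamma>, of n] u_int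
          av_mult[of "of_nat n" "\<gamma> u"] Gal_algebraic[OF \<gamma>, of u] by (auto simp: rat_imp_algebraic)
    qed
    ultimately have "av (\<gamma> u) \<le> B" by simp
    then have "av (\<gamma> u) ^ (m * deg) \<le> B ^ (m * deg)"
      using av_nonneg Gal_algebraic[OF \<gamma>] u_int by (intro power_mono) auto
    then show ?thesis using B(2) by (simp add: \<gamma>_def)
  qed
  \<comment> \<open>All conjugates of \<open>u\<close>; \<open>C1\<close> collects those already
    known to be small. Each conjugation over \<rat> is an embedding of \<open>K\<close> after an
    element of \<open>Gal K\<close>, so \<open>C\<close> is covered by \<open>deg\<close> sets of
    the cardinality of \<open>C1\<close>.\<close>
  define C where "C = (\<lambda>\<gamma>. \<gamma> u) ` Gal \<rat>"
  define C1 where "C1 = (\<lambda>\<tau>. \<rho> (\<tau> u)) ` Gal K"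
  have u_alg: "algebraic u" using u_int by blast
  have finC: "finite C" unfolding C_def by (rule finite_rat_poly_orbit[OF u_alg])
  have C1C: "C1 \<subseteq> C"
  proof
    fix w assume "w \<in> C1"
    then obtain \<tau> where "\<tau> \<in> Gal K" "w = (\<rho> \<circ> \<tau>) u" by (auto simp: C1_def)
    then show "w \<in> C" unfolding C_def using Gal_comp[OF \<rho> Gal_Rats] by blast
  qed
  have card_orbit: "card ((\<lambda>\<tau>. \<gamma> (\<tau> u)) ` Gal K) = card ((\<lambda>\<tau>. \<tau> u) ` Gal K)" if \<gamma>: "\<gamma> \<in> Gal \<rat>" for \<gamma>
  proof -
    have "(\<lambda>\<tau>. \<gamma> (\<tau> u)) ` Gal K = \<gamma> ` ((\<lambda>\<tau>. \<tau> u) ` Gal K)" by (simp add: image_image)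
    moreover have "inj_on \<gamma> ((\<lambda>\<tau>. \<tau> u) ` Gal K)"
      using Gal_inj[OF \<gamma>] Gal_algebraic u_alg by (auto intro!: inj_onI)
    ultimately show ?thesis by (simp add: card_image)
  qed
  have "C \<subseteq> (\<Union>\<gamma>\<in>emb. (\<lambda>\<tau>. \<gamma> (\<tau> u)) ` Gal K)"
  proof
    fix w assume "w \<in> C"
    then obtain \<gamma> where \<gamma>: "\<gamma> \<in> Gal \<rat>" "w = \<gamma> u" by (auto simp: C_def)
    obtain \<epsilon> where \<epsilon>: "\<epsilon> \<in> emb" "\<And>z. z \<in> K \<Longrightarrow> \<gamma> z = \<epsilon> z" using Gal_emb[OF \<gamma>(1)] by blast
    obtain \<epsilon>' where \<epsilon>': "\<epsilon>' \<in> Gal \<rat>" "\<And>x. algebraic x \<Longrightarrow> \<epsilon> (\<epsilon>' x) = x" "\<And>x. algebraic x \<Longrightarrow> \<epsilon>' (\<epsilon> x) = x"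
      using Gal_inverse_exists[OF emb_Gal[OF \<epsilon>(1)]] rat_imp_algebraic by blast
    have "\<epsilon>' \<circ> \<gamma> \<in> Gal \<rat>" by (rule Gal_comp[OF \<epsilon>'(1) \<gamma>(1)])
    moreover have "(\<epsilon>' \<circ> \<gamma>) z = z" if "z \<in> K" for z
      using \<epsilon>(2)[OF that] \<epsilon>'(3) K_algebraic[OF that] by simp
    ultimately have "\<epsilon>' \<circ> \<gamma> \<in> Gal K" unfolding Gal_def by blast
    moreover have "w = \<epsilon> ((\<epsilon>' \<circ> \<gamma>) u)" using \<epsilon>'(2) Gal_algebraic[OF \<gamma>(1) u_alg] \<gamma>(2) by simp
    ultimately show "w \<in> (\<Union>\<gamma>\<in>emb. (\<lambda>\<tau>. \<gamma> (\<tau> u)) ` Gal K)" using \<epsilon>(1) by blast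
  qed
  moreover have "finite (\<Union>\<gamma>\<in>emb. (\<lambda>\<tau>. \<gamma> (\<tau> u)) ` Gal K)"
    using finite_emb finite_rat_poly_orbit[OF u_alg, of K] by (auto simp flip: image_image[of _ "\<lambda>\<tau>. \<tau> u"])
  ultimately have "card C \<le> card (\<Union>\<gamma>\<in>emb. (\<lambda>\<tau>. \<gamma> (\<tau> u)) ` Gal K)" by (rule card_mono[rotated])
  also have "\<dots> \<le> (\<Sum>\<gamma>\<in>emb. card ((\<lambda>\<tau>. \<gamma> (\<tau> u)) ` Gal K))" by (rule card_UN_le[OF finite_emb])
  also have "\<dots> = deg * card C1"
    using card_orbit[OF \<rho>] card_orbit[OF emb_Gal] by (simp add: C1_def card_emb)
  finally have cards: "card C \<le> deg * card C1" .
  have C_alg: "algebraic w" "algebraic_int w" "w \<noteq> 0" "cmod w \<le> 2 * T" if w: "w \<in> C" for w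
  proof -
    obtain \<gamma> where \<gamma>: "\<gamma> \<in> Gal \<rat>" "w = \<gamma> u" using w by (auto simp: C_def)
    show "algebraic w" "algebraic_int w" "w \<noteq> 0"
      using \<gamma> Gal_algebraic[OF \<gamma>(1) u_alg] Gal_algebraic_int[OF \<gamma>(1) u_int] Gal_eq_0_iff[OF \<gamma>(1) u_alg] \<open>u \<noteq> 0\<close> by auto
    have "w = (\<gamma> \<circ> \<sigma>) x - \<gamma> x"
      using \<gamma>(2) Gal_diff[OF \<gamma>(1) Gal_algebraic[OF \<sigma>(1) x_alg] x_alg] by (simp add: u_def)
    then have "cmod w \<le> cmod ((\<gamma> \<circ> \<sigma>) x) + cmod (\<gamma> x)" by (metis norm_triangle_ineq4)
    then show "cmod w \<le> 2 * T" using x(2)[OF \<gamma>(1)] x(2)[OF Gal_comp[OF \<gamma>(1) Gal_Rats[OF \<sigma>(1)]]] by simp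
  qed
  \<comment> \<open>The product of the distinct conjugates is a nonzero rational integer of absolute
    value at most \<open>(2 * T) ^ card C\<close>, so its \<open>p\<close>-adic value is at least
    the inverse of this. The factors in \<open>C1\<close> push that value down, which contradicts
    the size of \<open>p\<close>.\<close>
  define M where "M = \<Prod>C"
  have "M \<in> \<rat>"
  proof (rule fixed_by_Gal[OF alg_field_Rats])
    show "algebraic M" unfolding M_def
      using algebraic_int_prod[of C "\<lambda>w. w"] C_alg(2) by (intro algebraic_int_imp_algebraic) auto
    fix \<gamma> assume \<gamma>: "\<gamma> \<in> Gal \<rat>"
    have "inj_on \<gamma> C" using Gal_inj[OF \<gamma>] C_alg(1) by (auto intro!: inj_onI)
    moreover have "\<gamma> ` C \<subseteq> C"
    proof
      fix w assume "w \<in> \<gamma> ` C"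
      then obtain \<gamma>' where "\<gamma>' \<in> Gal \<rat>" "w = (\<gamma> \<circ> \<gamma>') u" by (auto simp: C_def)
      then show "w \<in> C" unfolding C_def using Gal_comp[OF \<gamma>] by blast
    qed
    ultimately have "bij_betw \<gamma> C C" using endo_inj_surj[OF finC] by (auto simp: bij_betw_def)
    then have "(\<Prod>w\<in>C. \<gamma> w) = M" unfolding M_def by (rule prod.reindex_bij_betw)
    then show "\<gamma> M = M" using Gal_prod[OF \<gamma>, of C "\<lambda>w. w"] C_alg(1) by (simp add: M_def)
  qed
  moreover have "algebraic_int M" unfolding M_def using algebraic_int_prod[of C "\<lambda>w. w"] C_alg(2) by simp
  ultimately obtain M' where M': "M = of_int M'"
    using rational_algebraic_int_is_int by (metis Ints_cases)
  have "M \<noteq> 0" unfolding M_def using finC C_alg(3) by simp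
  then have M'0: "M' \<noteq> 0" using M' by auto
  have "cmod M \<le> (2 * T) ^ card C"
    unfolding M_def prod_norm[symmetric] using C_alg(4) prod_mono[of C cmod "\<lambda>_. 2 * T"] by simp
  then have M'_le: "\<bar>real_of_int M'\<bar> \<le> (2 * T) ^ card C" by (simp add: M')
  have "av M = (\<Prod>w\<in>C. av w)" unfolding M_def using C_alg(1) by (rule av_prod)
  also have "\<dots> = (\<Prod>w\<in>C1. av w) * (\<Prod>w\<in>C - C1. av w)"
    using prod.subset_diff[OF C1C finC] by (simp add: mult.commute)
  also have "\<dots> \<le> (\<Prod>w\<in>C1. av w) * 1"
    using C_alg(1,2) C1C by (intro mult_left_mono prod_le_1 prod_nonneg) (auto intro: av_nonneg av_integral)
  finally have "av M \<le> (\<Prod>w\<in>C1. av w)" by simp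
  then have "av M ^ (m * deg) \<le> (\<Prod>w\<in>C1. av w) ^ (m * deg)"
    using av_nonneg \<open>algebraic_int M\<close> by (intro power_mono) auto
  also have "\<dots> = (\<Prod>w\<in>C1. av w ^ (m * deg))" by (rule prod_power_distrib)
  also have "\<dots> \<le> (\<Prod>w\<in>C1. 1 / p)"
    using small C_alg(1) C1C by (intro prod_mono) (auto simp: C1_def intro!: zero_le_power av_nonneg)
  also have "\<dots> = (1 / p) ^ card C1" by simp
  finally have up: "av M ^ (m * deg) \<le> (1 / p) ^ card C1" .
  have "(1 / \<bar>real_of_int M'\<bar>) ^ (m * deg) \<le> av M ^ (m * deg)"
    using av_of_int_ge[OF M'0] M' by (intro power_mono) auto
  then have "(1 / \<bar>real_of_int M'\<bar>) ^ (m * deg) \<le> (1 / p) ^ card C1" using up by linarith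
  then have "real p ^ card C1 \<le> \<bar>real_of_int M'\<bar> ^ (m * deg)"
    using M'0 p_gt_1 by (simp add: power_one_over field_simps)
  also have "\<dots> \<le> ((2 * T) ^ card C) ^ (m * deg)" using M'_le by (intro power_mono) auto
  also have "\<dots> = (2 * T) ^ (card C * (m * deg))" by (simp add: power_mult)
  also have "\<dots> \<le> (2 * T) ^ ((deg * card C1) * (m * deg))"
    using T cards by (intro power_increasing mult_right_mono) auto
  also have "\<dots> = ((2 * T) ^ (m * deg\<^sup>2)) ^ card C1"
    by (simp only: power2_eq_square mult_ac flip: power_mult)
  finally have "real p ^ card C1 \<le> ((2 * T) ^ (m * deg\<^sup>2)) ^ card C1" .
  moreover have "card C1 > 0"
  proof -
    have "finite C1" using finC C1C finite_subset by blast
    moreover have "C1 \<noteq> {}" unfolding C1_def using id_Gal by blast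
    ultimately show ?thesis by (simp add: card_gt_0_iff)
  qed
  ultimately have "real p \<le> (2 * T) ^ (m * deg\<^sup>2)"
    using power_mono_iff[of "real p" "(2 * T) ^ (m * deg\<^sup>2)" "card C1"] T by simp
  then show False using p(2) by simp
qed

end

section \<open>Finiteness of the classes of radicals\<close>

lemma pigeonhole_PiE:
  assumes "finite A" "finite I" "\<And>i. i \<in> I \<Longrightarrow> finite (B i)"
    "\<And>a i. a \<in> A \<Longrightarrow> i \<in> I \<Longrightarrow> f a i \<in> B i" "(\<Prod>i\<in>I. card (B i)) < card A"
  obtains a b where "a \<in> A" "b \<in> A" "a \<noteq> b" "\<And>i. i \<in> I \<Longrightarrow> f a i = f b i"
proof -
  have "(\<lambda>a. restrict (f a) I) ` A \<subseteq> PiE I B" using assms(4) by auto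
  moreover have "finite (PiE I B)" using assms(2,3) by (rule finite_PiE)
  ultimately have "card ((\<lambda>a. restrict (f a) I) ` A) \<le> card (PiE I B)" by (rule card_mono[rotated])
  also have "\<dots> < card A" using assms(2,5) by (simp add: card_PiE)
  finally have "\<not> inj_on (\<lambda>a. restrict (f a) I) A" by (rule pigeonhole)
  then obtain a b where ab: "a \<in> A" "b \<in> A" "a \<noteq> b" "restrict (f a) I = restrict (f b) I"
    by (auto simp: inj_on_def)
  then show ?thesis using that by (metis restrict_apply')
qed

text \<open>A prime dividing the reduced denominator would give \<open>r\<close> a value above 1 at
  any place over that prime.\<close>

lemma rat_p_integral_imp_int:
  assumes r: "r \<in> \<rat>" and le: "\<And>p av. padic_abs p av \<Longrightarrow> av r \<le> 1"
  shows "r \<in> \<int>"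
proof -
  obtain a b where ab: "b > 0" "Rings.coprime a b" "r = of_int a / of_int b"
    using r by (auto elim: Rats_cases')
  have "b = 1"
  proof (rule ccontr)
    assume "b \<noteq> 1"
    then obtain q where q: "prime q" "q dvd b"
      using prime_divisor_exists[of b] ab(1) by auto
    define p where "p = nat q"
    have p: "prime p" "int p = q" using q(1) by (auto simp: p_def prime_ge_0_int)
    obtain av where av: "padic_abs p av" using p(1) by (rule padic_abs_exists)
    interpret padic_abs p av by fact
    have "\<not> int p dvd a" using ab(2) q p by (metis coprime_common_divisor not_prime_unit)
    then have 1: "av (of_int a) = 1" by (rule av_coprime)
    obtain c where c: "b = int p * c" using q(2) p(2) by (auto elim: dvdE)
    have "av (of_int b) = av (of_nat p) * av (of_int c)"
      using av_mult[of "of_nat p" "of_int c"] by (simp add: c rat_imp_algebraic)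
    also have "\<dots> \<le> (1 / p) * 1"
      unfolding av_p by (intro mult_left_mono av_integral) auto
    also have "\<dots> < 1" using p_gt_1 by simp
    finally have "av (of_int b) < 1" .
    moreover have "av (of_int b) > 0" using ab(1) by (intro av_pos) (auto intro: rat_imp_algebraic)
    moreover have "av r = av (of_int a) / av (of_int b)"
      unfolding ab(3) by (intro av_divide rat_imp_algebraic) auto
    ultimately have "av r > 1" using 1 by simp
    then show False using le[OF av] by simp
  qed
  then show ?thesis using ab(3) by simp
qed

section \<open>Box principle in a fixed number field\<close>

context normal_field
begin

text \<open>Bounds every embedding of a number whose coordinates in the power basis are at most 1 in
  absolute value; the outer sum yields one constant for all embeddings.\<close>

definition \<theta>_bound :: real where "\<theta>_bound = (\<Sum>\<rho>\<in>emb. \<Sum>j<deg. cmod (\<rho> \<theta>) ^ j)"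

lemma \<theta>_bound_ge: "\<rho> \<in> emb \<Longrightarrow> (\<Sum>j<deg. cmod (\<rho> \<theta>) ^ j) \<le> \<theta>_bound"
  unfolding \<theta>_bound_def by (rule member_le_sum[OF _ _ finite_emb]) (auto intro: sum_nonneg)

lemma \<theta>_bound_pos: "\<theta>_bound \<ge> 1"
proof -
  obtain \<rho> where \<rho>: "\<rho> \<in> emb" using emb_nonempty by blast
  have "(1 :: real) = cmod (\<rho> \<theta>) ^ 0" by simp
  also have "\<dots> \<le> (\<Sum>j<deg. cmod (\<rho> \<theta>) ^ j)"
    by (rule member_le_sum[of 0]) (use deg_pos in auto)
  also have "\<dots> \<le> \<theta>_bound" by (rule \<theta>_bound_ge[OF \<rho>])
  finally show ?thesis .
qed

definition comb :: "(nat \<Rightarrow> rat) \<Rightarrow> complex" where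
  "comb q = (\<Sum>j<deg. of_rat (q j) * \<theta> ^ j)"

lemma comb_K: "comb q \<in> K"
  unfolding comb_def
proof (rule alg_field_sum[OF alg_field_K])
  fix j show "of_rat (q j) * \<theta> ^ j \<in> K"
    by (rule alg_field_mult[OF alg_field_K K_rat alg_field_power[OF alg_field_K \<theta>_K]]) simp
qed

lemma comb_int: "algebraic_int (comb (\<lambda>j. of_int (c j)))"
  unfolding comb_def
proof (rule algebraic_int_sum)
  fix j show "algebraic_int (of_rat (of_int (c j)) * \<theta> ^ j)"
    using algebraic_int_of_int[of "c j"] \<theta>_int by auto
qed

lemma comb_diff: "comb (\<lambda>j. q j - r j) = comb q - comb r"
  by (simp add: comb_def of_rat_diff left_diff_distrib sum_subtractf)

lemma comb_scale: "comb (\<lambda>j. a * q j) = of_rat a * comb q"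
  by (simp add: comb_def of_rat_mult sum_distrib_left mult.assoc)

lemma Gal_comb:
  assumes "\<rho> \<in> Gal \<rat>"
  shows "\<rho> (comb q) = (\<Sum>j<deg. of_rat (q j) * \<rho> \<theta> ^ j)"
proof -
  have "algebraic (of_rat (q j) * \<theta> ^ j)" for j
    using algebraic_mult[OF rat_imp_algebraic algebraic_power[OF \<theta>_alg]] by simp
  then have "\<rho> (comb q) = (\<Sum>j<deg. \<rho> (of_rat (q j) * \<theta> ^ j))"
    unfolding comb_def by (intro Gal_sum[OF assms])
  also have "\<dots> = (\<Sum>j<deg. of_rat (q j) * \<rho> \<theta> ^ j)"
    using \<theta>_alg by (intro sum.cong refl)
      (simp add: Gal_mult[OF assms] Gal_power[OF assms] Gal_rat[OF assms] rat_imp_algebraic algebraic_power)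
  finally show ?thesis .
qed

lemma norm_comb_le:
  assumes "\<rho> \<in> emb" "\<And>j. j < deg \<Longrightarrow> \<bar>q j\<bar> \<le> e" "e \<ge> 0"
  shows "cmod (\<rho> (comb q)) \<le> of_rat e * \<theta>_bound"
proof -
  have "cmod (\<rho> (comb q)) \<le> (\<Sum>j<deg. cmod (of_rat (q j) * \<rho> \<theta> ^ j))"
    unfolding Gal_comb[OF emb_Gal[OF assms(1)]] by (rule norm_sum)
  also have "\<dots> \<le> (\<Sum>j<deg. of_rat e * cmod (\<rho> \<theta>) ^ j)"
  proof (rule sum_mono)
    fix j assume "j \<in> {..<deg}"
    then have "\<bar>q j\<bar> \<le> e" using assms(2) by simp
    then have "(of_rat \<bar>q j\<bar> :: real) \<le> of_rat e" by (simp add: of_rat_less_eq)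
    moreover have "cmod (of_rat (q j)) = of_rat \<bar>q j\<bar>"
    proof -
      have "of_rat (q j) = (of_real (of_rat (q j)) :: complex)"
        by (cases "q j") (simp add: of_rat_rat)
      then show ?thesis by (simp add: abs_if of_rat_minus split: if_splits)
    qed
    ultimately show "cmod (of_rat (q j) * \<rho> \<theta> ^ j) \<le> of_rat e * cmod (\<rho> \<theta>) ^ j"
      by (simp add: norm_mult norm_power mult_right_mono)
  qed
  also have "\<dots> = of_rat e * (\<Sum>j<deg. cmod (\<rho> \<theta>) ^ j)" by (simp add: sum_distrib_left)
  also have "\<dots> \<le> of_rat e * \<theta>_bound"
    using \<theta>_bound_ge[OF assms(1)] assms(3) by (intro mult_left_mono) auto
  finally show ?thesis .
qed

text \<open>Among the \<open>Q ^ deg + 1\<close> multiples of \<open>g\<close> by natural numbers up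
  to \<open>Q ^ deg\<close>, two have coordinate vectors that fall, modulo 1, into the same cube of
  side \<open>1 / Q\<close>. Their difference is an integer plus a number whose embeddings are at
  most \<open>\<theta>_bound / Q < 1\<close>.\<close>

lemma hurwitz:
  obtains M :: nat where "M > 0" "\<And>g. g \<in> K \<Longrightarrow> \<exists>t w. 0 < t \<and> t \<le> M \<and> w \<in> K \<and> algebraic_int w
    \<and> (\<forall>\<rho>\<in>emb. cmod (\<rho> (of_nat t * g - w)) < 1)"
proof -
  define Q :: nat where "Q = nat \<lceil>\<theta>_bound\<rceil> + 1"
  have Q: "real Q > \<theta>_bound" "Q > 0" unfolding Q_def by linarith+
  have "\<exists>t w. 0 < t \<and> t \<le> Q ^ deg \<and> w \<in> K \<and> algebraic_int w
    \<and> (\<forall>\<rho>\<in>emb. cmod (\<rho> (of_nat t * g - w)) < 1)" if "g \<in> K" for g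
  proof -
    obtain q where g: "g = comb q" using K_basis[OF \<open>g \<in> K\<close>] unfolding comb_def by blast
    define f where "f = (\<lambda>(t::nat) j. \<lfloor>of_nat Q * frac (of_nat t * q j)\<rfloor>)"
    have fQ: "f t j \<in> {0..<int Q}" for t j
    proof -
      have "of_nat Q * frac (of_nat t * q j) < of_nat Q * 1"
        using Q(2) frac_lt_1[of "of_nat t * q j"] by (intro mult_strict_left_mono) auto
      then show ?thesis by (simp add: f_def floor_less_iff)
    qed
    have "(\<Prod>j\<in>{..<deg}. card {0..<int Q}) < card {..Q ^ deg}" by simp
    from pigeonhole_PiE[of "{..Q ^ deg}" "{..<deg}" "\<lambda>_. {0..<int Q}" f, OF _ _ _ fQ this]
    obtain t1 t2 where t: "t1 \<in> {..Q ^ deg}" "t2 \<in> {..Q ^ deg}" "t1 \<noteq> t2" "\<And>j. j \<in> {..<deg} \<Longrightarrow> f t1 j = f t2 j"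
      by auto
    have main: ?thesis if "t1 < t2" "t2 \<le> Q ^ deg" "\<And>j. j < deg \<Longrightarrow> f t1 j = f t2 j" for t1 t2
    proof -
      define w where "w = comb (\<lambda>j. of_int (\<lfloor>of_nat t2 * q j\<rfloor> - \<lfloor>of_nat t1 * q j\<rfloor>))"
      define d where "d = (\<lambda>j. frac (of_nat t2 * q j) - frac (of_nat t1 * q j))"
      have "of_nat (t2 - t1) * g = comb (\<lambda>j. of_nat (t2 - t1) * q j)"
        unfolding g comb_scale by simp
      then have eq: "of_nat (t2 - t1) * g - w = comb d"
        unfolding w_def d_def using that(1)
        by (simp add: frac_def of_nat_diff algebra_simps flip: comb_diff)
      have "\<bar>d j\<bar> \<le> 1 / of_nat Q" if j: "j < deg" for j
      proof -
        have "\<lfloor>of_nat Q * frac (of_nat t1 * q j)\<rfloor> = \<lfloor>of_nat Q * frac (of_nat t2 * q j)\<rfloor>"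
          using \<open>\<And>j. j < deg \<Longrightarrow> f t1 j = f t2 j\<close>[OF j] by (simp add: f_def)
        then have "\<bar>of_nat Q * frac (of_nat t2 * q j) - of_nat Q * frac (of_nat t1 * q j)\<bar> < 1"
          by linarith
        then have "of_nat Q * \<bar>d j\<bar> < 1"
          by (simp add: d_def abs_mult flip: right_diff_distrib)
        then show ?thesis using Q(2) by (simp add: field_simps)
      qed
      then have "cmod (\<rho> (of_nat (t2 - t1) * g - w)) < 1" if "\<rho> \<in> emb" for \<rho>
      proof -
        have "cmod (\<rho> (comb d)) \<le> of_rat (1 / of_nat Q) * \<theta>_bound"
          using \<open>\<And>j. j < deg \<Longrightarrow> \<bar>d j\<bar> \<le> 1 / of_nat Q\<close> by (intro norm_comb_le[OF that]) auto
        also have "\<dots> < 1" using Q by (simp add: of_rat_divide field_simps)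
        finally show ?thesis by (simp add: eq)
      qed
      moreover have "w \<in> K" "algebraic_int w" unfolding w_def by (rule comb_K, rule comb_int)
      ultimately show ?thesis
        using that by (intro exI[of _ "t2 - t1"] exI[of _ w]) auto
    qed
    show ?thesis
      using main[of t1 t2] main[of t2 t1] t by (cases "t1 < t2") auto
  qed
  then show ?thesis using that[of "Q ^ deg"] Q(2) by simp
qed

text \<open>Minkowski's theorem for a box with sides inversely proportional to the weights
  \<open>a\<close>, by the pigeonhole principle on integer coordinate vectors with entries in
  \<open>{0..<int H}\<close>. The weights must agree at complex conjugate embeddings because the
  modulus is controlled by combining the two.\<close>

lemma minkowski:
  assumes a: "\<And>\<rho>. \<rho> \<in> emb \<Longrightarrow> a \<rho> > 0" "(\<Prod>\<rho>\<in>emb. a \<rho>) \<le> D" "D \<ge> 1"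
    and sym: "\<And>\<rho> \<rho>'. \<rho> \<in> emb \<Longrightarrow> \<rho>' \<in> emb \<Longrightarrow> (\<And>z. z \<in> K \<Longrightarrow> \<rho>' z = cnj (\<rho> z)) \<Longrightarrow> a \<rho>' = a \<rho>"
  shows "\<exists>z\<in>K. z \<noteq> 0 \<and> algebraic_int z \<and> (\<forall>\<rho>\<in>emb. cmod (\<rho> z) * a \<rho> \<le> 14 * \<theta>_bound * (D + 1))"
proof -
  define S where "S = \<theta>_bound"
  \<comment> \<open>The factor 7 absorbs the number of cells per embedding:
    \<open>2 * \<lceil>2 * x\<rceil> + 1 \<le> 7 * x\<close> for
    \<open>x = H * S / l \<rho>\<close>, with \<open>H\<close> taken so large that
    \<open>x \<ge> 1\<close>. The factor \<open>D + 1\<close> makes the total number of cells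
    strictly smaller than \<open>H ^ deg\<close>.\<close>
  define s where "s = 7 * S * (D + 1)"
  define l where "l = (\<lambda>\<rho>. s / a \<rho>)"
  define H :: nat where "H = nat \<lceil>\<Sum>\<rho>\<in>emb. l \<rho> / S\<rceil> + 1"
  have S: "S \<ge> 1" unfolding S_def by (rule \<theta>_bound_pos)
  have s: "s > 0" using S a(3) by (simp add: s_def)
  have l: "l \<rho> > 0" if "\<rho> \<in> emb" for \<rho> using s a(1)[OF that] by (simp add: l_def)
  have H: "real H * S \<ge> l \<rho>" if "\<rho> \<in> emb" for \<rho>
  proof -
    have "l \<rho> / S \<le> (\<Sum>\<rho>\<in>emb. l \<rho> / S)"
      using l S by (intro member_le_sum[OF that _ finite_emb]) (auto intro!: divide_nonneg_nonneg less_imp_le)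
    also have "\<dots> \<le> real H" unfolding H_def by linarith
    finally show ?thesis using S by (simp add: field_simps)
  qed
  define el where "el = (\<lambda>c. comb (\<lambda>j. of_int (c j)))"
  \<comment> \<open>One real linear form per embedding. At the conjugate embedding it reads
    \<open>Re z - Im z\<close>, and both together bound the modulus. Using real and imaginary part
    at each embedding would double the number of forms and spoil the count against
    \<open>H ^ deg\<close>.\<close>
  define \<Lambda> where "\<Lambda> = (\<lambda>z. Re z + Im z)"
  define A where "A = (PiE {..<deg} (\<lambda>_. {0..<int H}))"
  define B where "B = (\<lambda>\<rho>. \<lceil>2 * real H * S / l \<rho>\<rceil>)"
  define f where "f = (\<lambda>c \<rho>. \<lfloor>\<Lambda> (\<rho> (el c)) / l \<rho>\<rfloor>)"
  have bound: "cmod (\<rho> (el c)) \<le> real H * S" if c: "c \<in> A" and \<rho>: "\<rho> \<in> emb" for c \<rho>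
  proof -
    have "\<bar>(of_int (c j) :: rat)\<bar> \<le> of_nat H" if "j < deg" for j
    proof -
      have "c j \<in> {0..<int H}" using c that by (auto simp: A_def PiE_def Pi_def)
      then have "of_int (c j) \<le> (of_int (int H) :: rat)" "c j \<ge> 0" by (simp_all only: of_int_le_iff) auto
      then show ?thesis by simp
    qed
    then have "cmod (\<rho> (el c)) \<le> of_rat (of_nat H) * \<theta>_bound"
      unfolding el_def by (intro norm_comb_le[OF \<rho>]) auto
    then show ?thesis by (simp add: S_def)
  qed
  have fB: "f c \<rho> \<in> {- B \<rho>..B \<rho>}" if c: "c \<in> A" and \<rho>: "\<rho> \<in> emb" for c \<rho>
  proof -
    have "\<bar>\<Lambda> (\<rho> (el c))\<bar> \<le> 2 * (real H * S)"
      using bound[OF c \<rho>] abs_Re_le_cmod[of "\<rho> (el c)"] abs_Im_le_cmod[of "\<rho> (el c)"]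
      unfolding \<Lambda>_def by linarith
    then have "\<bar>\<Lambda> (\<rho> (el c)) / l \<rho>\<bar> \<le> 2 * real H * S / l \<rho>"
      using l[OF \<rho>] divide_right_mono[of "\<bar>\<Lambda> (\<rho> (el c))\<bar>" "2 * (real H * S)" "l \<rho>"]
      by (simp add: abs_divide mult.assoc)
    then have "\<lfloor>\<Lambda> (\<rho> (el c)) / l \<rho>\<rfloor> \<le> \<lceil>2 * real H * S / l \<rho>\<rceil> \<and> - \<lceil>2 * real H * S / l \<rho>\<rceil> \<le> \<lfloor>\<Lambda> (\<rho> (el c)) / l \<rho>\<rfloor>"
      by linarith
    then show ?thesis by (simp add: f_def B_def)
  qed
  have cardB: "real (card {- B \<rho>..B \<rho>}) \<le> 7 * real H * S / l \<rho>" if \<rho>: "\<rho> \<in> emb" for \<rho>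
  proof -
    define x where "x = real H * S / l \<rho>"
    have ge1: "x \<ge> 1" using H[OF \<rho>] l[OF \<rho>] by (simp add: x_def)
    have B: "B \<rho> = \<lceil>2 * x\<rceil>" by (simp add: B_def x_def mult.assoc)
    then have "B \<rho> \<ge> 0" using ge1 by linarith
    then have "real (card {- B \<rho>..B \<rho>}) = 2 * B \<rho> + 1" by simp
    also have "\<dots> \<le> 7 * x" unfolding B using ge1 by linarith
    finally show ?thesis by (simp add: x_def mult.assoc)
  qed
  have "real (\<Prod>\<rho>\<in>emb. card {- B \<rho>..B \<rho>}) \<le> (\<Prod>\<rho>\<in>emb. 7 * real H * S / l \<rho>)"
    unfolding of_nat_prod using cardB by (intro prod_mono) auto
  also have "\<dots> = (\<Prod>\<rho>\<in>emb. (real H / (D + 1)) * a \<rho>)"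
  proof (rule prod.cong[OF refl])
    fix \<rho>
    have "7 * real H * S / l \<rho> = (7 * S) * (real H * a \<rho>) / ((7 * S) * (D + 1))"
      by (simp add: l_def s_def mult_ac)
    also have "\<dots> = real H * a \<rho> / (D + 1)" using S by (intro mult_divide_mult_cancel_left) simp
    finally show "7 * real H * S / l \<rho> = real H / (D + 1) * a \<rho>" by simp
  qed
  also have "\<dots> = (real H / (D + 1)) ^ deg * (\<Prod>\<rho>\<in>emb. a \<rho>)"
    unfolding prod.distrib by (simp add: card_emb)
  also have "\<dots> \<le> (real H / (D + 1)) ^ deg * D"
    using a(2,3) by (intro mult_left_mono) auto
  also have "\<dots> = real H ^ deg * (D / (D + 1) ^ deg)" by (simp add: power_divide)
  also have "\<dots> < real H ^ deg * 1"
  proof (rule mult_strict_left_mono)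
    have "D + 1 \<le> (D + 1) ^ deg" using a(3) deg_pos by (simp add: self_le_power)
    then show "D / (D + 1) ^ deg < 1" using a(3) by (simp add: divide_less_eq) 
  qed (simp add: H_def)
  finally have "real (\<Prod>\<rho>\<in>emb. card {- B \<rho>..B \<rho>}) < real (H ^ deg)" by simp
  then have "(\<Prod>\<rho>\<in>emb. card {- B \<rho>..B \<rho>}) < H ^ deg" by (simp only: of_nat_less_iff)
  moreover have "card A = H ^ deg" unfolding A_def by (simp add: card_PiE)
  ultimately have lt: "(\<Prod>\<rho>\<in>emb. card {- B \<rho>..B \<rho>}) < card A" by simp
  have "finite A" unfolding A_def by (intro finite_PiE) auto
  from pigeonhole_PiE[of A emb "\<lambda>\<rho>. {- B \<rho>..B \<rho>}" f, OF this finite_emb _ fB lt]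
  obtain c c' where c: "c \<in> A" "c' \<in> A" "c \<noteq> c'" "\<And>\<rho>. \<rho> \<in> emb \<Longrightarrow> f c \<rho> = f c' \<rho>" by auto
  define z where "z = el c - el c'"
  have z: "z = comb (\<lambda>j. of_int (c j - c' j))" unfolding z_def el_def by (simp flip: comb_diff)
  have "z \<noteq> 0"
  proof
    assume "z = 0"
    then have "c j = c' j" if "j < deg" for j
      using K_basis_unique[of "\<lambda>j. of_int (c j - c' j)" j] that by (simp add: z comb_def)
    then have "c = c'" using c(1,2) unfolding A_def by (intro PiE_ext) auto
    then show False using c(3) by simp
  qed
  have small: "\<bar>\<Lambda> (\<rho> z)\<bar> \<le> l \<rho>" if \<rho>: "\<rho> \<in> emb" for \<rho>
  proof -
    have "algebraic (el c)" for c unfolding el_def using comb_K K_algebraic by blast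
    then have "\<rho> z = \<rho> (el c) - \<rho> (el c')"
      unfolding z_def by (intro Gal_diff[OF emb_Gal[OF \<rho>]])
    moreover have "\<bar>\<Lambda> (\<rho> (el c)) / l \<rho> - \<Lambda> (\<rho> (el c')) / l \<rho>\<bar> < 1"
      using c(4)[OF \<rho>] unfolding f_def by linarith
    then have "\<bar>(\<Lambda> (\<rho> (el c)) - \<Lambda> (\<rho> (el c'))) / l \<rho>\<bar> < 1" by (simp add: diff_divide_distrib)
    then have "\<bar>\<Lambda> (\<rho> (el c)) - \<Lambda> (\<rho> (el c'))\<bar> < l \<rho>" using l[OF \<rho>] by (simp add: abs_divide divide_less_eq)
    moreover have "\<Lambda> (\<rho> (el c) - \<rho> (el c')) = \<Lambda> (\<rho> (el c)) - \<Lambda> (\<rho> (el c'))" by (simp add: \<Lambda>_def)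
    ultimately show ?thesis by simp
  qed
  have "cmod (\<rho> z) * a \<rho> \<le> 14 * \<theta>_bound * (D + 1)" if \<rho>: "\<rho> \<in> emb" for \<rho>
  proof -
    have zK: "z \<in> K" unfolding z by (rule comb_K)
    obtain \<rho>' where \<rho>': "\<rho>' \<in> emb" "\<And>z. z \<in> K \<Longrightarrow> (cnj \<circ> \<rho>) z = \<rho>' z"
      using Gal_emb[OF Gal_comp[OF cnj_Gal emb_Gal[OF \<rho>]]] by blast
    then have "a \<rho>' = a \<rho>" using sym[OF \<rho> \<rho>'(1)] by simp
    then have "l \<rho>' = l \<rho>" by (simp add: l_def)
    then have "\<bar>Re (\<rho> z) - Im (\<rho> z)\<bar> \<le> l \<rho>"
      using small[OF \<rho>'(1)] \<rho>'(2)[OF zK] by (simp add: \<Lambda>_def flip: \<rho>'(2)[OF zK])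
    moreover have "\<bar>Re (\<rho> z) + Im (\<rho> z)\<bar> \<le> l \<rho>" using small[OF \<rho>] by (simp add: \<Lambda>_def)
    ultimately have "cmod (\<rho> z) \<le> 2 * l \<rho>" using cmod_le[of "\<rho> z"] by linarith
    then have "cmod (\<rho> z) * a \<rho> \<le> 2 * l \<rho> * a \<rho>" using a(1)[OF \<rho>] by (intro mult_right_mono) auto
    also have "\<dots> = 2 * s" using a(1)[OF \<rho>] by (simp add: l_def)
    finally show ?thesis by (simp add: s_def S_def)
  qed
  moreover have "z \<in> K" "algebraic_int z" unfolding z by (rule comb_K, rule comb_int)
  ultimately show ?thesis using \<open>z \<noteq> 0\<close> by blast
qed

end

lemma algebraic_int_power_iff: "m > 0 \<Longrightarrow> algebraic_int (z ^ m) \<Longrightarrow> algebraic_int (z :: complex)"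
  by (rule algebraic_int_root[of "z ^ m" "Polynomial.monom 1 m"]) (auto simp: poly_monom degree_monom_eq)

section \<open>Multiplier ideals and norms of radicals\<close>

context kummer
begin

text \<open>A fractional ideal of \<open>K\<close> that plays the role of the inverse of the ideal
  generated by the radical \<open>y\<close>.\<close>

definition cond_ideal :: "complex \<Rightarrow> complex set" where
  "cond_ideal y = {k \<in> K. algebraic_int (k * y)}"

text \<open>The power \<open>m\<close> brings the radical into \<open>K\<close>. The plain product
  of the \<open>\<rho> y\<close> would depend, up to a root of unity, on the representatives in
  \<open>emb\<close>.\<close>

definition radNm :: "complex \<Rightarrow> complex" where "radNm y = Nm (y ^ m)"

lemma radNm_rat: "rad y \<Longrightarrow> radNm y \<in> \<rat>"
  unfolding radNm_def by (rule Nm_rat) (simp add: rad_def)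

lemma radNm_nonzero: "rad y \<Longrightarrow> radNm y \<noteq> 0"
  using Nm_eq_0_iff[of "y ^ m"] by (simp add: radNm_def rad_def)

lemma radNm_int: "rad y \<Longrightarrow> algebraic_int y \<Longrightarrow> radNm y \<in> \<int>"
  unfolding radNm_def by (rule Nm_int) (auto simp: rad_def)

lemma radNm_eq: "rad y \<Longrightarrow> radNm y = (\<Prod>\<rho>\<in>emb. \<rho> y) ^ m"
  using Gal_power[OF emb_Gal rad_algebraic, of _ y m] by (simp add: radNm_def Nm_def prod_power_distrib)

lemma radNm_mult:
  assumes "rad y" "rad z"
  shows "radNm (y * z) = radNm y * radNm z"
proof -
  have "(\<Prod>\<rho>\<in>emb. \<rho> (y * z)) = (\<Prod>\<rho>\<in>emb. \<rho> y) * (\<Prod>\<rho>\<in>emb. \<rho> z)"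
    unfolding prod.distrib[symmetric]
    by (rule prod.cong[OF refl]) (rule Gal_mult[OF emb_Gal rad_algebraic[OF assms(1)] rad_algebraic[OF assms(2)]])
  then show ?thesis using assms by (simp add: radNm_eq rad_mult power_mult_distrib)
qed

text \<open>
  As in Hurwitz' proof of the finiteness of the class number, an element of minimal norm generates
  the lattice of integers in \<open>K y\<close> up to a bounded denominator.
\<close>

lemma almost_generator:
  obtains D :: nat where "D > 0" "\<And>y. rad y \<Longrightarrow> algebraic_int y \<Longrightarrow>
    \<exists>k\<in>K. k \<noteq> 0 \<and> algebraic_int (k * y) \<and> (\<forall>l\<in>cond_ideal (k * y). algebraic_int (of_nat D * l))"
proof -
  obtain M :: nat where M: "M > 0" "\<And>g. g \<in> K \<Longrightarrow> \<exists>t w. 0 < t \<and> t \<le> M \<and> w \<in> K \<and> algebraic_int w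
    \<and> (\<forall>\<rho>\<in>emb. cmod (\<rho> (of_nat t * g - w)) < 1)"
    using hurwitz by blast
  have "\<exists>k\<in>K. k \<noteq> 0 \<and> algebraic_int (k * y) \<and> (\<forall>l\<in>cond_ideal (k * y). algebraic_int (of_nat (fact M) * l))"
    if y: "rad y" "algebraic_int y" for y
  proof -
    \<comment> \<open>For admissible \<open>k\<close> the norm is a rational integer, so its
      absolute value is a natural number and attains a minimum.\<close>
    define g where "g = (\<lambda>k. nat \<lfloor>cmod (radNm (k * y))\<rfloor>)"
    define P where "P = (\<lambda>k. k \<in> K \<and> k \<noteq> 0 \<and> algebraic_int (k * y))"
    have "P 1" using y K_rat[of 1] by (simp add: P_def)
    then obtain k where k: "P k" and min: "\<And>k'. P k' \<Longrightarrow> g k \<le> g k'"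
      using ex_has_least_nat[of P 1 g] by blast
    have g: "real (g k') = cmod (radNm (k' * y))" if "P k'" for k'
    proof -
      have "radNm (k' * y) \<in> \<int>"
        using that radNm_int[OF rad_mult[OF rad_K y(1)]] unfolding P_def by blast
      then obtain n where "radNm (k' * y) = of_int n" by (auto elim: Ints_cases)
      then show ?thesis by (simp add: g_def)
    qed
    define \<beta> where "\<beta> = k * y"
    have \<beta>: "rad \<beta>" "algebraic_int \<beta>"
      using k y(1) unfolding \<beta>_def P_def by (auto intro: rad_mult rad_K)
    have "algebraic_int (of_nat (fact M) * l)" if l: "l \<in> cond_ideal \<beta>" for l
    proof -
      have lK: "l \<in> K" "algebraic_int (l * \<beta>)" using l by (auto simp: cond_ideal_def)
      obtain t w where t: "0 < t" "t \<le> M" "w \<in> K" "algebraic_int w" "\<forall>\<rho>\<in>emb. cmod (\<rho> (of_nat t * l - w)) < 1"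
        using M(2)[OF lK(1)] by blast
      define h where "h = of_nat t * l - w"
      have hK: "h \<in> K" unfolding h_def
        using alg_field_diff[OF alg_field_K alg_field_mult[OF alg_field_K K_rat[of "of_nat t"] lK(1)] t(3)] by simp
      \<comment> \<open>Otherwise \<open>h * k\<close> would be admissible of smaller norm, all
        embeddings of \<open>h\<close> being below 1. Thus \<open>t * l\<close> is the integer
        \<open>w\<close>, and \<open>t \<le> M\<close> divides \<open>fact M\<close>.\<close>
      have "h = 0"
      proof (rule ccontr)
        assume h0: "h \<noteq> 0"
        have "h * \<beta> = of_nat t * (l * \<beta>) - w * \<beta>" by (simp add: h_def algebra_simps)
        then have "algebraic_int (h * \<beta>)" using lK(2) t(4) \<beta>(2) by auto
        then have P: "P (h * k)"
          using k hK h0 alg_field_mult[OF alg_field_K] unfolding P_def by (auto simp: \<beta>_def mult.assoc)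
        have "radNm ((h * k) * y) = radNm h * radNm \<beta>"
          using radNm_mult[OF rad_K[OF hK h0] \<beta>(1)] by (simp add: \<beta>_def mult.assoc)
        moreover have "cmod (radNm h) < 1"
        proof -
          have "cmod (radNm h) = (\<Prod>\<rho>\<in>emb. cmod (\<rho> h)) ^ m"
            by (simp add: radNm_eq[OF rad_K[OF hK h0]] norm_power prod_norm)
          moreover have "(\<Prod>\<rho>\<in>emb. cmod (\<rho> h)) < (\<Prod>\<rho>\<in>emb. 1)"
          proof -
            obtain \<rho>0 where "\<rho>0 \<in> emb" using emb_nonempty by blast
            then show ?thesis
              using t(5) finite_emb by (intro prod_mono_strict[of \<rho>0]) (auto simp: h_def intro: less_imp_le)
          qed
          ultimately show ?thesis
            using m_pos power_strict_mono[of "\<Prod>\<rho>\<in>emb. cmod (\<rho> h)" 1 m] by (simp add: prod_nonneg)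
        qed
        ultimately have "cmod (radNm ((h * k) * y)) < cmod (radNm \<beta>)"
          using radNm_nonzero[OF \<beta>(1)] by (simp add: norm_mult)
        then have "g (h * k) < g k" using g[OF P] g[OF k] by (simp add: \<beta>_def)
        then show False using min[OF P] by simp
      qed
      then have "of_nat t * l = w" by (simp add: h_def)
      moreover obtain c where "fact M = t * c" using dvd_fact[of t M] t(1,2) by (auto elim: dvdE)
      ultimately have "of_nat (fact M) * l = of_nat c * w" by (metis of_nat_mult mult.assoc mult.commute)
      then show ?thesis using t(4) algebraic_int_mult[OF algebraic_int_of_nat[of c] t(4)] by simp
    qed
    then show ?thesis using k unfolding P_def \<beta>_def by blast
  qed
  then show ?thesis using that[of "fact M"] by simp
qed

text \<open>Each such \<open>J\<close> contains \<int>[\<theta>] and has common denominator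
  \<open>D\<close>. Reducing coordinates modulo 1 shows that \<open>J\<close> is recovered from the
  \<open>f\<close> in the finite set \<Phi> with \<open>f / D\<close> in \<open>J\<close>, so there
  are at most as many \<open>J\<close> as subsets of \<Phi>.\<close>

lemma finite_cond_ideals:
  fixes D :: nat
  assumes D: "D > 0"
  shows "finite {J. \<exists>y. rad y \<and> algebraic_int y \<and> J = cond_ideal y \<and> (\<forall>l\<in>J. algebraic_int (of_nat D * l))}"
proof -
  define \<Phi> where "\<Phi> = {z \<in> K. algebraic_int z \<and> (\<forall>\<rho>\<in>emb. cmod (\<rho> z) \<le> D * \<theta>_bound)}"
  have fin: "finite \<Phi>" unfolding \<Phi>_def by (rule finite_bounded_integers)
  define G where "G = (\<lambda>\<Psi>. {w + f / of_nat D | w f. f \<in> \<Psi> \<and> w \<in> range (\<lambda>c. comb (\<lambda>j. of_int (c j)))})"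
  have "J = G {f \<in> \<Phi>. f / of_nat D \<in> J}"
    if J: "rad y" "algebraic_int y" "J = cond_ideal y" "\<forall>l\<in>J. algebraic_int (of_nat D * l)" for y J
  proof (intro equalityI subsetI)
    fix l assume l: "l \<in> J"
    then have lK: "l \<in> K" and ly: "algebraic_int (l * y)" using J(3) by (auto simp: cond_ideal_def)
    obtain q where q: "l = comb q" using K_basis[OF lK] unfolding comb_def by blast
    define w where "w = comb (\<lambda>j. of_int \<lfloor>q j\<rfloor>)"
    define f where "f = of_nat D * (l - w)"
    have w: "w \<in> K" "algebraic_int w" unfolding w_def by (rule comb_K, rule comb_int)
    have lw: "l - w = comb (\<lambda>j. frac (q j))" by (simp add: q w_def frac_def comb_diff)
    have feq: "f = comb (\<lambda>j. of_nat D * frac (q j))" unfolding f_def lw comb_scale by simp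
    have "algebraic_int (of_nat D * l - of_nat D * w)"
      by (rule algebraic_int_diff[OF _ algebraic_int_mult[OF algebraic_int_of_nat w(2)]]) (use J(4) l in blast)
    then have "algebraic_int f" by (simp add: f_def right_diff_distrib)
    moreover have "cmod (\<rho> f) \<le> D * \<theta>_bound" if \<rho>: "\<rho> \<in> emb" for \<rho>
    proof -
      have "\<bar>of_nat D * frac (q j)\<bar> \<le> (of_nat D :: rat)" for j
        using frac_lt_1[of "q j"] frac_ge_0[of "q j"] by (simp add: abs_mult mult_left_le)
      then have "cmod (\<rho> f) \<le> of_rat (of_nat D) * \<theta>_bound" unfolding feq by (intro norm_comb_le[OF \<rho>]) auto
      then show ?thesis by simp
    qed
    ultimately have "f \<in> \<Phi>" using comb_K feq unfolding \<Phi>_def by auto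
    moreover have fD: "f / of_nat D = l - w" using D by (simp add: f_def)
    moreover have "l - w \<in> J"
    proof -
      have "algebraic_int ((l - w) * y)" using ly w(2) J(2) by (auto simp: left_diff_distrib)
      then show ?thesis unfolding J(3) cond_ideal_def using alg_field_diff[OF alg_field_K lK w(1)] by simp
    qed
    moreover have "l = w + f / of_nat D" using fD by simp
    moreover have "w \<in> range (\<lambda>c. comb (\<lambda>j. of_int (c j)))" unfolding w_def by (rule rangeI)
    ultimately show "l \<in> G {f \<in> \<Phi>. f / of_nat D \<in> J}" unfolding G_def by auto
  next
    fix l assume "l \<in> G {f \<in> \<Phi>. f / of_nat D \<in> J}"
    then obtain c f where l: "l = comb (\<lambda>j. of_int (c j)) + f / of_nat D" "f / of_nat D \<in> J"
      by (auto simp: G_def)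
    then have f: "f / of_nat D \<in> K" "algebraic_int (f / of_nat D * y)" using J(3) by (auto simp: cond_ideal_def)
    have "l \<in> K" unfolding l(1) by (rule alg_field_add[OF alg_field_K comb_K f(1)])
    moreover have "algebraic_int (l * y)"
      unfolding l(1) distrib_right by (rule algebraic_int_add[OF algebraic_int_mult[OF comb_int J(2)] f(2)])
    ultimately show "l \<in> J" by (simp add: J(3) cond_ideal_def)
  qed
  then have "{J. \<exists>y. rad y \<and> algebraic_int y \<and> J = cond_ideal y \<and> (\<forall>l\<in>J. algebraic_int (of_nat D * l))} \<subseteq> G ` Pow \<Phi>"
    by blast
  then show ?thesis using fin finite_subset by blast
qed

text \<open>The denominator comes from localising \<open>\<rho> (y ^ m)\<close> inside
  \<open>K\<close> and is pulled back along the inverse of \<rho>. What clears the denominator of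
  \<open>y ^ m\<close> also clears that of \<open>y\<close>, as
  \<open>(c * y) ^ m = c ^ (m - 1) * (c * y ^ m)\<close>.\<close>

lemma localize_radical:
  assumes av: "padic_abs p av" and \<rho>: "\<rho> \<in> Gal \<rat>" and y: "rad y" "av (\<rho> y) \<le> 1"
  shows "\<exists>c\<in>K. algebraic_int (c * y) \<and> av (\<rho> (c * y)) = av (\<rho> y)"
proof -
  interpret padic_abs p av by fact
  have alg: "algebraic y" using y(1) by (rule rad_algebraic)
  have b: "y ^ m \<in> K" using y(1) by (simp add: rad_def)
  have \<rho>b: "\<rho> (y ^ m) \<in> K" by (rule Gal_K_image[OF \<rho> b])
  have "av (\<rho> (y ^ m)) = av (\<rho> y) ^ m"
    using Gal_power[OF \<rho> alg] av_power[OF Gal_algebraic[OF \<rho> alg]] by simp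
  then have "av (\<rho> (y ^ m)) \<le> 1"
    using y(2) av_nonneg[OF Gal_algebraic[OF \<rho> alg]] by (simp add: power_le_one)
  then obtain c' where c': "algebraic_int c'" "av c' = 1" "algebraic_int (c' * \<rho> (y ^ m))" "c' \<in> K"
    using av_localize[OF K_algebraic[OF \<rho>b]] \<rho>b alg_field_K by blast
  obtain \<tau> where \<tau>: "\<tau> \<in> Gal \<rat>" "\<And>x. algebraic x \<Longrightarrow> \<rho> (\<tau> x) = x" "\<And>x. algebraic x \<Longrightarrow> \<tau> (\<rho> x) = x"
    using Gal_inverse_exists[OF \<rho>] rat_imp_algebraic by blast
  define c where "c = \<tau> c'"
  have cK: "c \<in> K" unfolding c_def by (rule Gal_K_image[OF \<tau>(1) c'(4)])
  have c_int: "algebraic_int c" unfolding c_def by (rule Gal_algebraic_int[OF \<tau>(1) c'(1)])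
  have c'_alg: "algebraic c'" using c'(1) by blast
  have "c * y ^ m = \<tau> (c' * \<rho> (y ^ m))"
    using Gal_mult[OF \<tau>(1) c'_alg K_algebraic[OF \<rho>b]] \<tau>(3)[OF K_algebraic[OF b]] by (simp add: c_def)
  then have cb: "algebraic_int (c * y ^ m)" using Gal_algebraic_int[OF \<tau>(1) c'(3)] by simp
  have "(c * y) ^ m = c ^ (m - 1) * (c * y ^ m)"
    using m_pos by (cases m) (simp_all add: power_mult_distrib mult_ac)
  then have "algebraic_int ((c * y) ^ m)" using cb c_int by auto
  then have "algebraic_int (c * y)" by (rule algebraic_int_power_iff[OF m_pos])
  moreover have "av (\<rho> (c * y)) = av (\<rho> c) * av (\<rho> y)"
    using Gal_mult[OF \<rho> K_algebraic[OF cK] alg] av_mult[OF Gal_algebraic[OF \<rho> K_algebraic[OF cK]] Gal_algebraic[OF \<rho> alg]]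
    by simp
  moreover have "\<rho> c = c'" unfolding c_def by (rule \<tau>(2)[OF c'_alg])
  ultimately show ?thesis using cK c'(2) by auto
qed

text \<open>Minkowski's theorem with weights \<open>cmod (\<rho> y)\<close>. These are symmetric
  under complex conjugation because their \<open>m\<close>-th powers belong to
  \<open>y ^ m \<in> K\<close>.\<close>

lemma bounded_multiple:
  assumes D: "D \<ge> 1"
  obtains C where "\<And>y. rad y \<Longrightarrow> cmod (radNm y) \<le> D \<Longrightarrow>
    \<exists>z\<in>K. z \<noteq> 0 \<and> algebraic_int z \<and> (\<forall>\<rho>\<in>emb. cmod (\<rho> (z * y)) \<le> C)"
proof -
  have "\<exists>z\<in>K. z \<noteq> 0 \<and> algebraic_int z \<and> (\<forall>\<rho>\<in>emb. cmod (\<rho> (z * y)) \<le> 14 * \<theta>_bound * (D + 1))"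
    if y: "rad y" "cmod (radNm y) \<le> D" for y
  proof -
    define a where "a = (\<lambda>\<rho>::complex \<Rightarrow> complex. cmod (\<rho> y))"
    have alg: "algebraic y" "y \<noteq> 0" using y(1) by (auto simp: rad_def)
    have a: "a \<rho> > 0" if "\<rho> \<in> emb" for \<rho>
      using Gal_eq_0_iff[OF emb_Gal[OF that] alg(1)] alg(2) by (simp add: a_def)
    have "(\<Prod>\<rho>\<in>emb. a \<rho>) ^ m = cmod (radNm y)"
      by (simp add: radNm_eq[OF y(1)] a_def norm_power prod_norm)
    then have Dm: "(\<Prod>\<rho>\<in>emb. a \<rho>) ^ m \<le> D" using y(2) by simp
    have prod: "(\<Prod>\<rho>\<in>emb. a \<rho>) \<le> D"
    proof (rule ccontr)
      assume "\<not> (\<Prod>\<rho>\<in>emb. a \<rho>) \<le> D"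
      then have gt: "(\<Prod>\<rho>\<in>emb. a \<rho>) > D" by simp
      then have "(\<Prod>\<rho>\<in>emb. a \<rho>) \<le> (\<Prod>\<rho>\<in>emb. a \<rho>) ^ m" using D m_pos by (intro self_le_power) auto
      then show False using gt Dm by linarith
    qed
    have sym: "a \<rho>' = a \<rho>" if \<rho>: "\<rho> \<in> emb" "\<rho>' \<in> emb" "\<And>z. z \<in> K \<Longrightarrow> \<rho>' z = cnj (\<rho> z)" for \<rho> \<rho>'
    proof -
      have "y ^ m \<in> K" using y(1) by (simp add: rad_def)
      then have "cmod (\<rho>' (y ^ m)) = cmod (\<rho> (y ^ m))" using \<rho>(3) by simp
      then have "a \<rho>' ^ m = a \<rho> ^ m"
        using Gal_power[OF emb_Gal[OF \<rho>(1)] alg(1)] Gal_power[OF emb_Gal[OF \<rho>(2)] alg(1)]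
        by (simp add: a_def norm_power)
      then show ?thesis using power_eq_imp_eq_base[of "a \<rho>'" m "a \<rho>"] a[OF \<rho>(1)] a[OF \<rho>(2)] m_pos by simp
    qed
    obtain z where z: "z \<in> K" "z \<noteq> 0" "algebraic_int z" "\<forall>\<rho>\<in>emb. cmod (\<rho> z) * a \<rho> \<le> 14 * \<theta>_bound * (D + 1)"
      using minkowski[of a D, OF a prod D sym] by blast
    have "cmod (\<rho> (z * y)) = cmod (\<rho> z) * a \<rho>" if "\<rho> \<in> emb" for \<rho>
      using Gal_mult[OF emb_Gal[OF that] K_algebraic[OF z(1)] alg(1)] by (simp add: a_def norm_mult)
    then show ?thesis using z by auto
  qed
  then show ?thesis using that by blast
qed

text \<open>At each of these places the value of \<open>y\<close> is the value of an element of
  \<open>K\<close>, namely of \<open>inverse z\<close>. Composition with \<rho> moves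
  \<open>av\<close> to other places above the same prime.\<close>

definition unramified_above :: "nat \<Rightarrow> complex \<Rightarrow> bool" where
  "unramified_above P1 y \<longleftrightarrow> (\<forall>p av. padic_abs p av \<longrightarrow> p > P1 \<longrightarrow>
     (\<forall>\<rho>\<in>Gal \<rat>. \<exists>z\<in>K. z \<noteq> 0 \<and> av (\<rho> (z * y)) = 1))"

text \<open>At a prime up to \<open>P1\<close>, the power of \<open>p\<close> obtained by rounding
  up the logarithm of the value brings it between \<open>1 / p\<close> and 1. Localisation then
  makes the multiple integral everywhere without changing this value.\<close>

lemma integral_multiple_with_large_value:
  assumes av: "padic_abs p av" and \<rho>: "\<rho> \<in> Gal \<rat>" and y: "rad y" and un: "unramified_above P1 y"
  shows "\<exists>k\<in>K. algebraic_int (k * y) \<and> av (\<rho> (k * y)) \<ge> (if p > P1 then 1 else 1 / p)"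
proof -
  interpret padic_abs p av by fact
  have "\<exists>z\<in>K. z \<noteq> 0 \<and> av (\<rho> (z * y)) \<le> 1 \<and> av (\<rho> (z * y)) \<ge> (if p > P1 then 1 else 1 / p)"
  proof (cases "p > P1")
    case True
    then obtain z where "z \<in> K" "z \<noteq> 0" "av (\<rho> (z * y)) = 1"
      using un av \<rho> unfolding unramified_above_def by blast
    then show ?thesis using True by auto
  next
    case False
    define v where "v = av (\<rho> y)"
    have alg: "algebraic (\<rho> y)" by (rule Gal_algebraic[OF \<rho> rad_algebraic[OF y]])
    have "\<rho> y \<noteq> 0" using Gal_eq_0_iff[OF \<rho> rad_algebraic[OF y]] rad_nonzero[OF y] by simp
    then have v: "v > 0" unfolding v_def by (rule av_pos[OF alg])
    define n where "n = \<lceil>log p v\<rceil>"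
    define z where "z = (of_nat p :: complex) powi n"
    have z0: "z \<noteq> 0" using prime_p by (auto simp: z_def)
    have zrat: "z \<in> \<rat>" by (simp add: z_def power_int_def)
    have avz: "av z = p powr (- n)"
    proof (cases "n \<ge> 0")
      case True
      then have "av z = (1 / p) ^ nat n"
        by (simp add: z_def power_int_def av_power av_p rat_imp_algebraic)
      also have "\<dots> = p powr (- real (nat n))"
        using p_gt_1 by (simp add: powr_minus powr_realpow power_one_over inverse_eq_divide)
      finally show ?thesis using True by simp
    next
      case False
      then have "av z = inverse ((1 / p) ^ nat (- n))"
        using av_inverse[of "of_nat p ^ nat (- n)"]
        by (simp add: z_def power_int_def av_power av_p rat_imp_algebraic algebraic_power flip: power_inverse)
      also have "\<dots> = p powr (real (nat (- n)))"
        using p_gt_1 by (simp add: powr_realpow power_one_over)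
      finally show ?thesis using False by simp
    qed
    have "\<rho> (z * y) = z * \<rho> y"
      using Gal_mult[OF \<rho> rat_imp_algebraic[OF zrat] rad_algebraic[OF y]] Gal_rat[OF \<rho> zrat] by simp
    then have "av (\<rho> (z * y)) = p powr (- n) * v"
      using av_mult[OF rat_imp_algebraic[OF zrat] alg] avz by (simp add: v_def)
    also have "\<dots> = p powr (log p v - n)"
      using v p_gt_1 by (simp add: powr_diff powr_minus divide_inverse)
    finally have eq: "av (\<rho> (z * y)) = p powr (log p v - n)" .
    have "log p v - n \<le> 0" "log p v - n \<ge> -1" unfolding n_def by linarith+
    then have "p powr (log p v - n) \<le> p powr 0" "p powr (-1) \<le> p powr (log p v - n)"
      using p_gt_1 powr_mono[of "log p v - n" 0 "real p"] powr_mono[of "-1" "log p v - n" "real p"]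
      by linarith+
    then show ?thesis using eq z0 K_rat[OF zrat] False p_gt_1
      by (intro bexI[of _ z]) (auto simp: powr_minus divide_inverse)
  qed
  then obtain z where z: "z \<in> K" "z \<noteq> 0" "av (\<rho> (z * y)) \<le> 1" "av (\<rho> (z * y)) \<ge> (if p > P1 then 1 else 1 / p)"
    by blast
  obtain c where "c \<in> K" "algebraic_int (c * (z * y))" "av (\<rho> (c * (z * y))) = av (\<rho> (z * y))"
    using localize_radical[OF av \<rho> rad_mult[OF rad_K[OF z(1,2)] y] z(3)] by blast
  then show ?thesis using z alg_field_mult[OF alg_field_K, of c z]
    by (intro bexI[of _ "c * z"]) (auto simp: mult.assoc)
qed

lemma unramified_above_scale:
  assumes "unramified_above P1 y" "k \<in> K" "k \<noteq> 0"
  shows "unramified_above P1 (k * y)"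
  unfolding unramified_above_def
proof (intro allI impI ballI)
  fix p av \<rho> assume "padic_abs p av" "p > P1" "\<rho> \<in> Gal \<rat>"
  then obtain z where "z \<in> K" "z \<noteq> 0" "av (\<rho> (z * y)) = 1"
    using assms(1) unfolding unramified_above_def by blast
  then show "\<exists>z\<in>K. z \<noteq> 0 \<and> av (\<rho> (z * (k * y))) = 1"
    using assms(2,3) alg_field_divide[OF alg_field_K, of z k] by (intro bexI[of _ "z / k"]) auto
qed

text \<open>A multiplier \<open>k\<close> for which \<open>k * \<beta>\<close> is integral and of
  large value at a place also makes \<open>k * \<beta>'\<close> integral, so the quotient
  \<open>y\<close> has value at least 1 there, or at least \<open>1 / p\<close> if
  \<open>p \<le> P1\<close>. All these exceptional \<open>p\<close> divide \<open>fact P1\<close>.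
  Hence \<open>fact P1 ^ (m * deg)\<close> divided by the norm of \<open>y\<close> is integral at
  every prime, that is, a nonzero integer, and has absolute value at least 1.\<close>

lemma same_ideal_norm_bound:
  assumes \<beta>: "rad \<beta>" "unramified_above P1 \<beta>" and \<beta>': "rad \<beta>'" "algebraic_int \<beta>'"
    and eq: "cond_ideal \<beta> = cond_ideal \<beta>'"
  shows "cmod (radNm (\<beta> / \<beta>')) \<le> real (fact P1) ^ (m * deg)"
proof -
  define y where "y = \<beta> / \<beta>'"
  have y: "rad y" unfolding y_def by (rule rad_divide[OF \<beta>(1) \<beta>'(1)])
  define Dn where "Dn = (fact P1 :: nat) ^ (m * deg)"
  have small: "av (radNm y) \<ge> av (of_nat Dn)" if av: "padic_abs p av" for p av
  proof -
    interpret padic_abs p av by fact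
    define e :: real where "e = (if p > P1 then 1 else 1 / p)"
    have "av (\<rho> y) \<ge> e" if "\<rho> \<in> emb" for \<rho>
    proof -
      note \<rho> = emb_Gal[OF that]
      obtain k where k: "k \<in> K" "algebraic_int (k * \<beta>)" "av (\<rho> (k * \<beta>)) \<ge> e"
        using integral_multiple_with_large_value[OF av \<rho> \<beta>] unfolding e_def by blast
      then have "k \<in> cond_ideal \<beta>'" using eq by (auto simp: cond_ideal_def)
      then have int: "algebraic_int (k * \<beta>')" by (simp add: cond_ideal_def)
      have "k * \<beta> = y * (k * \<beta>')" using rad_nonzero[OF \<beta>'(1)] by (simp add: y_def)
      then have "\<rho> (k * \<beta>) = \<rho> y * \<rho> (k * \<beta>')"
        using Gal_mult[OF \<rho> rad_algebraic[OF y] algebraic_int_imp_algebraic[OF int]] by (simp only:)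
      then have "av (\<rho> (k * \<beta>)) = av (\<rho> y) * av (\<rho> (k * \<beta>'))"
        using av_mult[of "\<rho> y" "\<rho> (k * \<beta>')"] Gal_algebraic[OF \<rho>] rad_algebraic[OF y] int by auto
      also have "\<dots> \<le> av (\<rho> y) * 1"
        using av_nonneg[OF Gal_algebraic[OF \<rho> rad_algebraic[OF y]]] av_integral[OF Gal_algebraic_int[OF \<rho> int]]
        by (intro mult_left_mono) auto
      finally show ?thesis using k(3) by simp
    qed
    moreover have e0: "e \<ge> 0" by (simp add: e_def)
    ultimately have "(\<Prod>\<rho>\<in>emb. e) \<le> (\<Prod>\<rho>\<in>emb. av (\<rho> y))" by (intro prod_mono) auto
    also have "\<dots> = av (\<Prod>\<rho>\<in>emb. \<rho> y)"
      using Gal_algebraic[OF emb_Gal rad_algebraic[OF y]] by (intro av_prod[symmetric])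
    finally have "(e ^ deg) ^ m \<le> av (\<Prod>\<rho>\<in>emb. \<rho> y) ^ m" using e0 by (intro power_mono) (auto simp: card_emb)
    also have "\<dots> = av (radNm y)"
      using av_power[of "\<Prod>\<rho>\<in>emb. \<rho> y" m] Gal_algebraic[OF emb_Gal rad_algebraic[OF y]]
        alg_field_prod[OF alg_field_algebraics, of emb "\<lambda>\<rho>. \<rho> y"] by (simp add: radNm_eq[OF y])
    finally have lower: "e ^ (m * deg) \<le> av (radNm y)" by (simp add: mult.commute flip: power_mult)
    have "av (of_nat (fact P1)) \<le> e"
    proof (cases "p > P1")
      case True
      then show ?thesis using av_integral[OF algebraic_int_of_nat[of "fact P1"]] by (simp add: e_def)
    next
      case False
      then have "p dvd fact P1" using dvd_fact[of p P1] prime_ge_1_nat[OF prime_p] by simp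
      then obtain c where c: "fact P1 = p * c" by (auto elim: dvdE)
      have "av (of_nat (fact P1)) = av (of_nat p) * av (of_nat c)"
        using av_mult[of "of_nat p" "of_nat c"] by (simp only: c of_nat_mult) (simp add: rat_imp_algebraic)
      also have "\<dots> \<le> (1 / p) * 1" unfolding av_p by (intro mult_left_mono av_integral) auto
      finally show ?thesis using False by (simp add: e_def)
    qed
    then have "av (of_nat (fact P1)) ^ (m * deg) \<le> e ^ (m * deg)"
      by (rule power_mono) (rule av_nonneg[OF algebraic_int_imp_algebraic[OF algebraic_int_of_nat]])
    moreover have "av (of_nat Dn) = av (of_nat (fact P1)) ^ (m * deg)"
      unfolding Dn_def of_nat_power by (rule av_power[OF algebraic_int_imp_algebraic[OF algebraic_int_of_nat]])
    ultimately show ?thesis using lower by linarith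
  qed
  have nz: "radNm y \<noteq> 0" by (rule radNm_nonzero[OF y])
  define r where "r = of_nat Dn / radNm y"
  have "r \<in> \<int>"
  proof (rule rat_p_integral_imp_int)
    show "r \<in> \<rat>" unfolding r_def using radNm_rat[OF y] by simp
    fix p av assume av: "padic_abs p av"
    interpret padic_abs p av by fact
    have "av r = av (of_nat Dn) / av (radNm y)"
      unfolding r_def using radNm_rat[OF y] by (intro av_divide rat_imp_algebraic) auto
    moreover have "av (radNm y) > 0" using radNm_rat[OF y] nz by (intro av_pos rat_imp_algebraic)
    ultimately show "av r \<le> 1" using small[OF av] by simp
  qed
  then obtain n where n: "r = of_int n" by (auto elim: Ints_cases)
  moreover have "r \<noteq> 0" using nz by (simp add: r_def Dn_def)
  ultimately have "\<bar>real_of_int n\<bar> \<ge> 1" by auto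
  then have "cmod r \<ge> 1" using n by simp
  then have "cmod (radNm y) \<le> real Dn" using nz by (simp add: r_def norm_divide field_simps)
  then show ?thesis by (simp add: y_def Dn_def)
qed

text \<open>The radical is scaled to an almost generator \<beta> and divided by a fixed
  representative \<beta>' of the same multiplier ideal. The quotient \<open>u\<close> has bounded
  norm, hence a multiple \<open>z * u\<close> with bounded embeddings, and \<open>num J\<close>
  clears the denominator stemming from \<beta>'. The result is a radical whose \<open>m\<close>-th
  power is one of finitely many integers of \<open>K\<close>.\<close>

theorem finite_radical_classes:
  obtains \<Psi> where "finite \<Psi>" "\<And>w. w \<in> \<Psi> \<Longrightarrow> algebraic w"
    "\<And>y. rad y \<Longrightarrow> algebraic_int y \<Longrightarrow> unramified_above P1 y \<Longrightarrow> \<exists>k\<in>K. \<exists>w\<in>\<Psi>. y = k * w"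
proof -
  obtain D :: nat where D: "D > 0" "\<And>y. rad y \<Longrightarrow> algebraic_int y \<Longrightarrow>
    \<exists>k\<in>K. k \<noteq> 0 \<and> algebraic_int (k * y) \<and> (\<forall>l\<in>cond_ideal (k * y). algebraic_int (of_nat D * l))"
    using almost_generator by blast
  define \<J> where "\<J> = {J. \<exists>y. rad y \<and> algebraic_int y \<and> J = cond_ideal y \<and> (\<forall>l\<in>J. algebraic_int (of_nat D * l))}"
  have finJ: "finite \<J>" unfolding \<J>_def by (rule finite_cond_ideals[OF D(1)])
  define rep where "rep = (\<lambda>J. SOME y. rad y \<and> algebraic_int y \<and> J = cond_ideal y)"
  have rep: "rad (rep J)" "algebraic_int (rep J)" "J = cond_ideal (rep J)" if J: "J \<in> \<J>" for J
  proof -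
    have "\<exists>y. rad y \<and> algebraic_int y \<and> J = cond_ideal y" using J by (auto simp: \<J>_def)
    from someI_ex[OF this] show "rad (rep J)" "algebraic_int (rep J)" "J = cond_ideal (rep J)"
      by (auto simp: rep_def)
  qed
  have "\<exists>n::nat. n > 0 \<and> algebraic_int (of_nat n * inverse (rep J))" if "J \<in> \<J>" for J
    using algebraic_int_multiple[OF algebraic_inverse[OF rad_algebraic[OF rep(1)[OF that]]]] by metis
  then obtain num :: "complex set \<Rightarrow> nat"
    where num: "\<And>J. J \<in> \<J> \<Longrightarrow> num J > 0" "\<And>J. J \<in> \<J> \<Longrightarrow> algebraic_int (of_nat (num J) * inverse (rep J))"
    by metis
  define D1 where "D1 = real (fact P1) ^ (m * deg)"
  have "D1 \<ge> 1" unfolding D1_def by (intro one_le_power) (simp add: fact_ge_1)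
  then obtain C where C: "\<And>y. rad y \<Longrightarrow> cmod (radNm y) \<le> D1 \<Longrightarrow>
    \<exists>z\<in>K. z \<noteq> 0 \<and> algebraic_int z \<and> (\<forall>\<rho>\<in>emb. cmod (\<rho> (z * y)) \<le> C)"
    using bounded_multiple by blast
  define B where "B = (\<lambda>J. {z \<in> K. algebraic_int z \<and> (\<forall>\<rho>\<in>emb. cmod (\<rho> z) \<le> (real (num J) * C) ^ m)})"
  define \<Psi> where "\<Psi> = (\<Union>J\<in>\<J>. (\<lambda>w. w * rep J) ` (\<Union>b\<in>B J. {w. w ^ m = b}))"
  have "finite {w :: complex. w ^ m = b}" for b
  proof -
    have "Polynomial.monom 1 m - [:b:] \<noteq> 0"
      using m_pos by (auto simp: poly_eq_iff coeff_pCons intro!: exI[of _ m] split: nat.splits)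
    moreover have "{w. w ^ m = b} = {w. poly (Polynomial.monom 1 m - [:b:]) w = 0}" by (simp add: poly_monom)
    ultimately show ?thesis using poly_roots_finite by metis
  qed
  then have "finite \<Psi>"
    unfolding \<Psi>_def B_def using finJ finite_bounded_integers by (intro finite_UN_I finite_imageI) auto
  moreover have "algebraic w" if w: "w \<in> \<Psi>" for w
  proof -
    obtain J v where J: "J \<in> \<J>" "v ^ m \<in> B J" "w = v * rep J" using w by (auto simp: \<Psi>_def)
    then have "algebraic_int (v ^ m)" by (simp add: B_def)
    then have "algebraic_int v" by (rule algebraic_int_power_iff[OF m_pos])
    then show ?thesis using J rad_algebraic[OF rep(1)[OF J(1)]] by auto
  qed
  moreover have "\<exists>k\<in>K. \<exists>w\<in>\<Psi>. y = k * w" if y: "rad y" "algebraic_int y" "unramified_above P1 y" for y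
  proof -
    obtain k where k: "k \<in> K" "k \<noteq> 0" "algebraic_int (k * y)" "\<forall>l\<in>cond_ideal (k * y). algebraic_int (of_nat D * l)"
      using D(2)[OF y(1,2)] by blast
    define \<beta> where "\<beta> = k * y"
    define J where "J = cond_ideal \<beta>"
    have \<beta>: "rad \<beta>" "algebraic_int \<beta>" "unramified_above P1 \<beta>"
      unfolding \<beta>_def using rad_mult[OF rad_K[OF k(1,2)] y(1)] k(3) unramified_above_scale[OF y(3) k(1,2)] by auto
    have J: "J \<in> \<J>" unfolding \<J>_def J_def using \<beta> k(4) by (auto simp: \<beta>_def)
    define \<beta>' where "\<beta>' = rep J"
    have \<beta>': "rad \<beta>'" "algebraic_int \<beta>'" "cond_ideal \<beta> = cond_ideal \<beta>'"
      using rep[OF J] by (simp_all add: \<beta>'_def J_def)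
    define u where "u = \<beta> / \<beta>'"
    have u: "rad u" unfolding u_def by (rule rad_divide[OF \<beta>(1) \<beta>'(1)])
    have "cmod (radNm u) \<le> D1"
      unfolding u_def D1_def by (rule same_ideal_norm_bound[OF \<beta>(1,3) \<beta>'])
    then obtain z where z: "z \<in> K" "z \<noteq> 0" "algebraic_int z" "\<forall>\<rho>\<in>emb. cmod (\<rho> (z * u)) \<le> C"
      using C[OF u] by blast
    define n where "n = num J"
    have n: "n > 0" "algebraic_int (of_nat n * inverse \<beta>')" using num[OF J] by (simp_all add: n_def \<beta>'_def)
    define w where "w = of_nat n * (z * u)"
    have w_int: "algebraic_int w"
      using algebraic_int_mult[OF algebraic_int_mult[OF z(3) \<beta>(2)] n(2)] by (simp add: w_def u_def divide_inverse mult_ac)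
    have zu: "rad (z * u)" by (rule rad_mult[OF rad_K[OF z(1,2)] u])
    have nK: "of_nat n \<in> K" by (rule K_rat) simp
    have w_rad: "rad w" unfolding w_def using n(1) by (intro rad_mult[OF rad_K[OF nK] zu]) simp
    have "w ^ m \<in> B J"
      unfolding B_def
    proof (intro CollectI conjI ballI)
      show "w ^ m \<in> K" using w_rad by (simp add: rad_def)
      show "algebraic_int (w ^ m)" using w_int by blast
      fix \<rho> assume \<rho>: "\<rho> \<in> emb"
      have "\<rho> w = of_nat n * \<rho> (z * u)"
        unfolding w_def using Gal_mult[OF emb_Gal[OF \<rho>] K_algebraic[OF nK] rad_algebraic[OF zu]] Gal_of_nat[OF emb_Gal[OF \<rho>]] by simp
      then have "cmod (\<rho> w) \<le> real n * C" using z(4) \<rho> by (simp add: norm_mult mult_left_mono)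
      then show "cmod (\<rho> (w ^ m)) \<le> (real (num J) * C) ^ m"
        using Gal_power[OF emb_Gal[OF \<rho>] rad_algebraic[OF w_rad], of m]
        by (simp add: norm_power power_mono n_def)
    qed
    then have "w * rep J \<in> \<Psi>" unfolding \<Psi>_def using J by blast
    define c where "c = k * of_nat n * z"
    have "c \<noteq> 0" using k(2) z(2) n(1) by (simp add: c_def)
    moreover have "w * rep J = c * y"
      using rad_nonzero[OF \<beta>'(1)] by (simp add: w_def u_def \<beta>_def c_def flip: \<beta>'_def)
    ultimately have "y = inverse c * (w * rep J)" by simp
    moreover have "inverse c \<in> K"
      unfolding c_def by (rule alg_field_inverse[OF alg_field_K alg_field_mult[OF alg_field_K alg_field_mult[OF alg_field_K k(1) nK] z(1)]])
    ultimately show ?thesis using \<open>w * rep J \<in> \<Psi>\<close> by blast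
  qed
  ultimately show ?thesis by (rule that)
qed

text \<open>The Northcott property, in the form that the elements of bounded house generate a finite extension.\<close>

theorem bounded_house_finite:
  assumes T: "T \<ge> 1"
  obtains \<Psi> where "finite \<Psi>" "\<And>w. w \<in> \<Psi> \<Longrightarrow> algebraic w"
    "\<And>x F. x \<in> abelian_part \<Longrightarrow> algebraic_int x \<Longrightarrow> (\<And>\<gamma>. \<gamma> \<in> Gal \<rat> \<Longrightarrow> cmod (\<gamma> x) \<le> T) \<Longrightarrow>
      alg_field F \<Longrightarrow> K \<subseteq> F \<Longrightarrow> \<Psi> \<subseteq> F \<Longrightarrow> x \<in> F"
proof -
  \<comment> \<open>A prime beyond \<open>P1\<close> exceeds both \<open>m\<close> and the threshold
    excluding ramification.\<close>
  define P1 where "P1 = max m (nat \<lceil>(2 * T) ^ (m * deg\<^sup>2)\<rceil>)"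
  obtain \<Psi> where \<Psi>: "finite \<Psi>" "\<And>w. w \<in> \<Psi> \<Longrightarrow> algebraic w"
    "\<And>y. rad y \<Longrightarrow> algebraic_int y \<Longrightarrow> unramified_above P1 y \<Longrightarrow> \<exists>k\<in>K. \<exists>w\<in>\<Psi>. y = k * w"
    using finite_radical_classes by blast
  have "x \<in> F"
    if x: "x \<in> abelian_part" "algebraic_int x" "\<And>\<gamma>. \<gamma> \<in> Gal \<rat> \<Longrightarrow> cmod (\<gamma> x) \<le> T"
      and F: "alg_field F" "K \<subseteq> F" "\<Psi> \<subseteq> F" for x F
  proof -
    obtain r Y where Y: "finite Y" "\<And>y. y \<in> Y \<Longrightarrow> rad y" "\<And>y. y \<in> Y \<Longrightarrow> algebraic_int y"
      "distinct_chars Y" "of_nat (m ^ r) * x = \<Sum>Y"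
      using radical_decomposition[OF x(1,2)] by metis
    have "y \<in> F" if y: "y \<in> Y" for y
    proof -
      have "unramified_above P1 y"
        unfolding unramified_above_def
      proof (intro allI impI ballI)
        fix p av \<rho> assume av: "padic_abs p av" "p > P1" and \<rho>: "\<rho> \<in> Gal \<rat>"
        have p: "p > m" "real p > (2 * T) ^ (m * deg\<^sup>2)" using av(2) unfolding P1_def by linarith+
        show "\<exists>z\<in>K. z \<noteq> 0 \<and> av (\<rho> (z * y)) = 1"
          by (rule unramified_components[where x = x and Y = Y and r = r and T = T]) (fact av(1) \<rho> x T Y p y)+
      qed
      then obtain k w where "k \<in> K" "w \<in> \<Psi>" "y = k * w" using \<Psi>(3)[OF Y(2,3)[OF y]] by blast
      then show ?thesis using F alg_field_mult[OF F(1)] by blast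
    qed
    then have "\<Sum>Y \<in> F" using alg_field_sum[OF F(1), of Y "\<lambda>y. y"] by simp
    then have "inverse (of_nat (m ^ r)) * \<Sum>Y \<in> F"
      by (intro alg_field_mult[OF F(1) alg_field_rat[OF F(1)]]) auto
    moreover have "inverse (of_nat (m ^ r)) * \<Sum>Y = x"
      using m_pos by (simp flip: Y(5))
    ultimately show ?thesis by simp
  qed
  then show ?thesis using that \<Psi>(1,2) by blast
qed

end

section \<open>Universal lattices force generation by elements of bounded house\<close>

lemma totally_positive_iff:
  "totally_positive x \<longleftrightarrow> algebraic x \<and> (\<forall>\<gamma>\<in>Gal \<rat>. \<gamma> x \<in> \<real> \<and> 0 < Re (\<gamma> x))"
  using conjugates_eq_orbit by (auto simp: totally_positive_def)

lemma totally_real_iff: "totally_real x \<longleftrightarrow> algebraic x \<and> (\<forall>\<gamma>\<in>Gal \<rat>. \<gamma> x \<in> \<real>)"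
  using conjugates_eq_orbit by (auto simp: totally_real_def)

text \<open>The bound is a natural number so that the descent can choose a least one.\<close>

lemma orbit_bounded:
  assumes "algebraic x"
  obtains bd :: nat where "\<And>\<gamma>. \<gamma> \<in> Gal \<rat> \<Longrightarrow> cmod (\<gamma> x) \<le> bd"
proof -
  have "finite (cmod ` (\<lambda>\<gamma>. \<gamma> x) ` Gal \<rat>)"
    using finite_rat_poly_orbit[OF assms] by (rule finite_imageI)
  then have "finite ((\<lambda>\<gamma>. cmod (\<gamma> x)) ` Gal \<rat>)" by (simp only: image_image)
  then have "bdd_above ((\<lambda>\<gamma>. cmod (\<gamma> x)) ` Gal \<rat>)" by (rule bdd_above_finite)
  then obtain M where M: "\<And>\<gamma>. \<gamma> \<in> Gal \<rat> \<Longrightarrow> cmod (\<gamma> x) \<le> M" by (auto simp: bdd_above_def)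
  obtain bd :: nat where bd: "M \<le> bd" using real_arch_simple by blast
  show ?thesis by (rule that[of bd]) (use M bd order_trans in blast)
qed

section \<open>Gram-Schmidt and Cauchy-Schwarz inside a positive definite lattice\<close>

locale real_lattice =
  fixes L :: "complex set" and V :: "(complex, 'v) module" (structure) and \<Lambda> :: "'v set" and Q :: "'v \<Rightarrow> complex"
  assumes L_real: "totally_real_field L" and pos: "positive_definite_lattice L V \<Lambda> Q"
begin

abbreviation "\<O> \<equiv> ring_of_integers L"
abbreviation "B \<equiv> polar_form V Q"

lemma subfield_L: "subfield L complex_ring"
  using L_real by (simp add: totally_real_field_def algebraic_extension_def)

lemmas L_closed = subfield_closed[OF subfield_L]

lemma L_algebraic: "x \<in> L \<Longrightarrow> algebraic x"
  and L_totally_real: "x \<in> L \<Longrightarrow> \<gamma> \<in> Gal \<rat> \<Longrightarrow> \<gamma> x \<in> \<real>"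
  using L_real by (auto simp: totally_real_field_def totally_real_iff)

lemma L_of_nat: "of_nat n \<in> L"
  using L_closed by (induction n) simp_all

lemma O_iff: "x \<in> \<O> \<longleftrightarrow> x \<in> L \<and> algebraic_int x"
  by (simp add: ring_of_integers_def)

lemma O_mult: "x \<in> \<O> \<Longrightarrow> y \<in> \<O> \<Longrightarrow> x * y \<in> \<O>"
  and O_add: "x \<in> \<O> \<Longrightarrow> y \<in> \<O> \<Longrightarrow> x + y \<in> \<O>"
  and O_uminus: "x \<in> \<O> \<Longrightarrow> - x \<in> \<O>"
  and O_of_nat: "of_nat n \<in> \<O>"
  using L_closed L_of_nat by (auto simp: O_iff)

lemma O_1: "1 \<in> \<O>" and O_0: "0 \<in> \<O>" and O_2: "2 \<in> \<O>"
  using O_of_nat[of 1] O_of_nat[of 0] O_of_nat[of 2] by simp_all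

lemma Q_integral: "v \<in> \<Lambda> \<Longrightarrow> Q v \<in> \<O>"
  and Q_positive: "v \<in> \<Lambda> \<Longrightarrow> v \<noteq> \<zero> \<Longrightarrow> totally_positive (Q v)"
  and Q_quadratic: "quadratic_map L V Q"
  and lattice: "O_lattice L V \<Lambda>"
  using pos by (auto simp: positive_definite_lattice_def integral_quadratic_lattice_def quadratic_lattice_def)

lemma submod: "LinearCombinations.submodule (ring_on \<O>) \<Lambda> V"
  using lattice by (simp add: O_lattice_def)

lemma mod: "module (ring_on \<O>) V"
  using submod by (rule LinearCombinations.submodule.module)

lemma \<Lambda>_carrier: "v \<in> \<Lambda> \<Longrightarrow> v \<in> carrier V"
  using LinearCombinations.submodule.subset[OF submod] by blast

lemma \<Lambda>_add: "v \<in> \<Lambda> \<Longrightarrow> w \<in> \<Lambda> \<Longrightarrow> v \<oplus> w \<in> \<Lambda>"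
  by (rule LinearCombinations.submodule.m_closed[OF submod])

lemma \<Lambda>_zero: "\<zero> \<in> \<Lambda>"
  by (rule LinearCombinations.submodule.zero_closed[OF submod])

lemma \<Lambda>_smult: "a \<in> \<O> \<Longrightarrow> v \<in> \<Lambda> \<Longrightarrow> a \<odot> v \<in> \<Lambda>"
  using LinearCombinations.submodule.smult_closed[OF submod, of a v] by simp

lemma B_add_left: "u \<in> \<Lambda> \<Longrightarrow> v \<in> \<Lambda> \<Longrightarrow> w \<in> \<Lambda> \<Longrightarrow> B (u \<oplus> v) w = B u w + B v w"
  and B_smult_left: "a \<in> \<O> \<Longrightarrow> v \<in> \<Lambda> \<Longrightarrow> w \<in> \<Lambda> \<Longrightarrow> B (a \<odot> v) w = a * B v w"
  using Q_quadratic \<Lambda>_carrier by (auto simp: quadratic_map_def bilinear_on_def O_iff)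

lemma Q_smult: "a \<in> \<O> \<Longrightarrow> v \<in> \<Lambda> \<Longrightarrow> Q (a \<odot> v) = a\<^sup>2 * Q v"
  using Q_quadratic \<Lambda>_carrier by (auto simp: quadratic_map_def O_iff)

lemma B_sym: "v \<in> \<Lambda> \<Longrightarrow> w \<in> \<Lambda> \<Longrightarrow> B v w = B w v"
proof -
  interpret module "ring_on \<O>" V by (rule mod)
  assume "v \<in> \<Lambda>" "w \<in> \<Lambda>"
  then show ?thesis using \<Lambda>_carrier M.a_comm[of v w] by (simp add: polar_form_def)
qed

lemma B_self: "v \<in> \<Lambda> \<Longrightarrow> B v v = Q v"
proof -
  interpret module "ring_on \<O>" V by (rule mod)
  assume v: "v \<in> \<Lambda>"
  have "(1 + 1) \<odot> v = 1 \<odot> v \<oplus> 1 \<odot> v"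
    using smult_l_distr[of 1 1 v] \<Lambda>_carrier[OF v] O_1 by simp
  moreover have "1 \<odot> v = v" using smult_one[OF \<Lambda>_carrier[OF v]] by simp
  ultimately have "v \<oplus> v = 2 \<odot> v" by simp
  then have "Q (v \<oplus> v) = 4 * Q v" using Q_smult[OF O_2 v] by simp
  then show ?thesis by (simp add: polar_form_def)
qed

lemma zero_smult: "0 \<odot> \<zero> = \<zero>"
proof -
  interpret module "ring_on \<O>" V by (rule mod)
  show ?thesis using smult_l_null[of \<zero>] by simp
qed

lemma B_zero: "w \<in> \<Lambda> \<Longrightarrow> B \<zero> w = 0"
  using B_smult_left[OF O_0 \<Lambda>_zero] zero_smult by simp

lemma Q_zero: "Q \<zero> = 0"
  using Q_smult[OF O_0 \<Lambda>_zero] zero_smult by simp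

text \<open>Integrality of \<open>Q\<close> makes only twice the bilinear form integral; this is
  where the factors 2 in the auxiliary vectors come from.\<close>

lemma B_double_integral: "v \<in> \<Lambda> \<Longrightarrow> w \<in> \<Lambda> \<Longrightarrow> 2 * B v w \<in> \<O>"
  using O_add[OF Q_integral[OF \<Lambda>_add] O_uminus[OF O_add[OF Q_integral Q_integral]], of v w v w]
  by (simp add: polar_form_def algebra_simps)

lemma B_algebraic: "v \<in> \<Lambda> \<Longrightarrow> w \<in> \<Lambda> \<Longrightarrow> algebraic (B v w)"
  and B_L: "v \<in> \<Lambda> \<Longrightarrow> w \<in> \<Lambda> \<Longrightarrow> B v w \<in> L"
proof -
  assume vw: "v \<in> \<Lambda>" "w \<in> \<Lambda>"
  have "inverse 2 * (2 * B v w) \<in> L"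
    using B_double_integral[OF vw] L_closed(4,5) L_of_nat[of 2] by (simp only: O_iff of_nat_numeral)
  then show "B v w \<in> L" by simp
  then show "algebraic (B v w)" by (rule L_algebraic)
qed

lemma Q_nonzero: "v \<in> \<Lambda> \<Longrightarrow> v \<noteq> \<zero> \<Longrightarrow> Q v \<noteq> 0"
  using Q_positive[of v] id_Gal[of \<rat>] by (force simp: totally_positive_iff)

lemma combine:
  assumes "a \<in> \<O>" "b \<in> \<O>" "v \<in> \<Lambda>" "w \<in> \<Lambda>"
  shows "a \<odot> v \<oplus> b \<odot> w \<in> \<Lambda>"
    and "u \<in> \<Lambda> \<Longrightarrow> B (a \<odot> v \<oplus> b \<odot> w) u = a * B v u + b * B w u"
  using assms by (simp_all add: \<Lambda>_add \<Lambda>_smult B_add_left B_smult_left)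

text \<open>For orthogonal \<open>es\<close> this is the bilinear form of the components of
  \<open>v\<close> and \<open>w\<close> orthogonal to \<open>es\<close>. If it vanishes for all
  \<open>w\<close>, then \<open>v\<close> is expanded along \<open>es\<close>.\<close>

definition defect :: "'v list \<Rightarrow> 'v \<Rightarrow> 'v \<Rightarrow> complex" where
  "defect es v w = B v w - (\<Sum>e\<leftarrow>es. B v e * B w e / Q e)"

lemma defect_Cons: "defect (e # es) v w = defect es v w - B v e * B w e / Q e"
  by (simp add: defect_def)

lemma defect_sym: "v \<in> \<Lambda> \<Longrightarrow> w \<in> \<Lambda> \<Longrightarrow> defect es v w = defect es w v"
  by (simp add: defect_def B_sym[of v w] mult.commute)

text \<open>
  The multiple by \<open>s\<close> of the component of \<open>v\<close> orthogonal to the vectors \<open>es\<close> is a lattice vector.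
\<close>

lemma residual:
  assumes "set es \<subseteq> \<Lambda>" "\<And>e. e \<in> set es \<Longrightarrow> Q e \<noteq> 0" "v \<in> \<Lambda>"
  shows "\<exists>s r. s \<in> \<O> \<and> s \<noteq> 0 \<and> r \<in> \<Lambda> \<and> (\<forall>w\<in>\<Lambda>. B r w = s * defect es v w)"
  using assms
proof (induction es)
  case Nil
  then show ?case using O_1 by (intro exI[of _ 1] exI[of _ v]) (simp add: defect_def)
next
  case (Cons e es)
  then obtain s r where s: "s \<in> \<O>" "s \<noteq> 0" "r \<in> \<Lambda>" "\<And>w. w \<in> \<Lambda> \<Longrightarrow> B r w = s * defect es v w" by auto
  have e: "e \<in> \<Lambda>" "Q e \<noteq> 0" using Cons.prems by auto
  define a where "a = 2 * Q e"
  define b where "b = - (s * (2 * B v e))"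
  have ab: "a \<in> \<O>" "b \<in> \<O>"
    using e(1) s(1) Cons.prems(3) by (auto simp: a_def b_def intro!: O_mult O_uminus O_2 Q_integral B_double_integral)
  show ?case
  proof (intro exI[of _ "s * a"] exI[of _ "a \<odot> r \<oplus> b \<odot> e"] conjI ballI)
    show "s * a \<in> \<O>" using s(1) ab(1) by (rule O_mult)
    show "s * a \<noteq> 0" using s(2) e(2) by (simp add: a_def)
    show "a \<odot> r \<oplus> b \<odot> e \<in> \<Lambda>" by (rule combine(1)[OF ab s(3) e(1)])
    fix w assume w: "w \<in> \<Lambda>"
    have "B (a \<odot> r \<oplus> b \<odot> e) w = a * (s * defect es v w) + b * B e w"
      using combine(2)[OF ab s(3) e(1) w] s(4)[OF w] by simp
    also have "\<dots> = s * a * defect (e # es) v w"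
      using e(2) by (simp add: defect_Cons a_def b_def B_sym[OF w e(1)] field_simps)
    finally show "B (a \<odot> r \<oplus> b \<odot> e) w = s * a * defect (e # es) v w" .
  qed
qed

text \<open>Orthogonality of \<open>es\<close> is carried in the form that the defect vanishes at
  its members. If the residual \<open>r\<close> of a new vector is zero, the vector is already
  expanded; otherwise definiteness makes \<open>Q r\<close> nonzero and \<open>r\<close> joins the
  family. Clearing denominators keeps \<open>r\<close> in the lattice.\<close>

lemma gram_schmidt:
  assumes "set vs \<subseteq> \<Lambda>"
  shows "\<exists>es. set es \<subseteq> \<Lambda> \<and> (\<forall>e\<in>set es. Q e \<noteq> 0) \<and> (\<forall>v\<in>set es \<union> set vs. \<forall>w\<in>\<Lambda>. defect es v w = 0)"
  using assms
proof (induction vs)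
  case Nil
  then show ?case by (intro exI[of _ "[]"]) simp
next
  case (Cons v vs)
  then obtain es where es: "set es \<subseteq> \<Lambda>" "\<And>e. e \<in> set es \<Longrightarrow> Q e \<noteq> 0"
    "\<And>u w. u \<in> set es \<union> set vs \<Longrightarrow> w \<in> \<Lambda> \<Longrightarrow> defect es u w = 0" by auto
  have v: "v \<in> \<Lambda>" and vs: "set vs \<subseteq> \<Lambda>" using Cons.prems by auto
  obtain s r where s: "s \<in> \<O>" "s \<noteq> 0" "r \<in> \<Lambda>" "\<And>w. w \<in> \<Lambda> \<Longrightarrow> B r w = s * defect es v w"
    using residual[OF es(1,2) v] by blast
  show ?case
  proof (cases "r = \<zero>")
    case True
    then have "defect es v w = 0" if "w \<in> \<Lambda>" for w using s(4)[OF that] B_zero[OF that] s(2) by simp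
    then show ?thesis using es by (intro exI[of _ es]) auto
  next
    case False
    have Qr: "Q r \<noteq> 0" by (rule Q_nonzero[OF s(3) False])
    have r_orth: "B r e = 0" if e: "e \<in> set es" for e
    proof -
      have "e \<in> \<Lambda>" using e es(1) by blast
      then show ?thesis using s(4)[of e] defect_sym[OF v, of e es] es(3)[of e v] e v by simp
    qed
    have Dr: "defect es r w = s * defect es v w" if "w \<in> \<Lambda>" for w
    proof -
      have "(\<Sum>e\<leftarrow>es. B r e * B w e / Q e) = (\<Sum>e\<leftarrow>es. 0)"
        using r_orth by (intro arg_cong[of _ _ sum_list] map_cong) auto
      then show ?thesis using s(4)[OF that] by (simp add: defect_def)
    qed
    have Br: "B u r = s * defect es v u" if "u \<in> \<Lambda>" for u
      using s(4)[OF that] B_sym[OF that s(3)] by simp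
    have Qr_eq: "Q r = s\<^sup>2 * defect es v v"
      using B_self[OF s(3)] s(4)[OF s(3)] defect_sym[OF v s(3), of es] Dr[OF v] by (simp add: power2_eq_square mult.assoc)
    have D0: "defect (r # es) u w = 0" if u: "u \<in> \<Lambda>" "\<And>w. w \<in> \<Lambda> \<Longrightarrow> defect es u w = 0" and w: "w \<in> \<Lambda>" for u w
      using u(2)[OF w] Br[OF u(1)] defect_sym[OF v u(1), of es] u(2)[OF v] by (simp add: defect_Cons)
    have Dv: "defect (r # es) v w = 0" if w: "w \<in> \<Lambda>" for w
    proof -
      have "B v r * B w r / Q r = defect es v w"
        using Br[OF v] Br[OF w] Qr Qr_eq by (simp add: power2_eq_square)
      then show ?thesis by (simp add: defect_Cons)
    qed
    have Drr: "defect (r # es) r w = 0" if w: "w \<in> \<Lambda>" for w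
      using Dr[OF w] B_self[OF s(3)] Br[OF w] Qr by (simp add: defect_Cons)
    show ?thesis
    proof (intro exI[of _ "r # es"] conjI ballI)
      show "set (r # es) \<subseteq> \<Lambda>" using es(1) s(3) by simp
      show "Q e \<noteq> 0" if "e \<in> set (r # es)" for e using that Qr es(2) by auto
      show "defect (r # es) u w = 0" if "u \<in> set (r # es) \<union> set (v # vs)" "w \<in> \<Lambda>" for u w
        using that D0[of u w] Dv Drr es vs by auto
    qed
  qed
qed

text \<open>The vectors of vanishing defect form a submodule containing generators of \<Lambda>,
  hence all of \<Lambda>; taking both arguments equal gives Parseval's identity.\<close>

lemma orthogonal_expansion:
  obtains es where "set es \<subseteq> \<Lambda>" "\<And>e. e \<in> set es \<Longrightarrow> Q e \<noteq> 0"
    "\<And>v. v \<in> \<Lambda> \<Longrightarrow> Q v = (\<Sum>e\<leftarrow>es. (B v e)\<^sup>2 / Q e)"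
proof -
  interpret module "ring_on \<O>" V by (rule mod)
  obtain S where S: "finite S" "S \<subseteq> \<Lambda>" "span S = \<Lambda>"
    using lattice by (auto simp: O_lattice_def)
  obtain vs where vs: "set vs = S" using finite_list[OF S(1)] by blast
  obtain es where es: "set es \<subseteq> \<Lambda>" "\<And>e. e \<in> set es \<Longrightarrow> Q e \<noteq> 0"
    "\<And>v w. v \<in> S \<Longrightarrow> w \<in> \<Lambda> \<Longrightarrow> defect es v w = 0"
    using gram_schmidt[of vs] vs S(2) by auto
  define N where "N = {v \<in> \<Lambda>. \<forall>w\<in>\<Lambda>. defect es v w = 0}"
  have sum0: "(\<Sum>e\<leftarrow>es. f e) = (\<Sum>e\<leftarrow>es. g e)" if "\<And>e. e \<in> \<Lambda> \<Longrightarrow> f e = g e" for f g :: "'v \<Rightarrow> complex"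
    using that es(1) by (intro arg_cong[of _ _ sum_list] map_cong) auto
  have "LinearCombinations.submodule (ring_on \<O>) N V"
  proof
    show "N \<subseteq> carrier V" using \<Lambda>_carrier by (auto simp: N_def)
    fix v w assume vw: "v \<in> N" "w \<in> N"
    have "defect es (v \<oplus> w) u = defect es v u + defect es w u" if u: "u \<in> \<Lambda>" for u
    proof -
      have "(\<Sum>e\<leftarrow>es. B (v \<oplus> w) e * B u e / Q e) = (\<Sum>e\<leftarrow>es. B v e * B u e / Q e + B w e * B u e / Q e)"
        by (rule sum0) (use vw in \<open>simp add: N_def B_add_left add_divide_distrib distrib_right\<close>)
      then show ?thesis using vw u by (simp add: defect_def sum_list_addf N_def B_add_left)
    qed
    then show "v \<oplus> w \<in> N" using vw \<Lambda>_add by (simp add: N_def)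
  next
    have "(\<Sum>e\<leftarrow>es. B \<zero> e * B u e / Q e) = (\<Sum>e\<leftarrow>es. 0)" for u
      by (rule sum0) (simp add: B_zero)
    then show "\<zero> \<in> N" using \<Lambda>_zero B_zero by (simp add: N_def defect_def)
  next
    fix c v assume c: "c \<in> carrier (ring_on \<O>)" and v: "v \<in> N"
    have "defect es (c \<odot> v) u = c * defect es v u" if u: "u \<in> \<Lambda>" for u
    proof -
      have "(\<Sum>e\<leftarrow>es. B (c \<odot> v) e * B u e / Q e) = c * (\<Sum>e\<leftarrow>es. B v e * B u e / Q e)"
        unfolding sum_list_const_mult[symmetric]
        by (rule sum0) (use c v in \<open>simp add: N_def B_smult_left\<close>)
      then show ?thesis using c v u by (simp add: defect_def N_def B_smult_left right_diff_distrib)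
    qed
    then show "c \<odot> v \<in> N" using c v \<Lambda>_smult by (simp add: N_def)
  qed
  then have "span S \<subseteq> N" using S(2) es(3) by (intro span_is_subset) (auto simp: N_def)
  then have "defect es v v = 0" if "v \<in> \<Lambda>" for v using that S(3) by (auto simp: N_def)
  then have "Q v = (\<Sum>e\<leftarrow>es. (B v e)\<^sup>2 / Q e)" if "v \<in> \<Lambda>" for v
    using that B_self[OF that] by (simp add: defect_def power2_eq_square)
  then show ?thesis using that es(1,2) by blast
qed

text \<open>The classical proof with denominators cleared: \<open>r = 2 Q(w) v - 2 B(v, w) w\<close>
  is a lattice vector with \<open>Q(r) = 4 Q(w) (Q(w) Q(v) - B(v, w)^2)\<close>, and all conjugates
  of \<open>Q(r)\<close> are nonnegative.\<close>

lemma cauchy_schwarz: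
  assumes v: "v \<in> \<Lambda>" and w: "w \<in> \<Lambda>" and \<gamma>: "\<gamma> \<in> Gal \<rat>"
  shows "(cmod (\<gamma> (B v w)))\<^sup>2 \<le> cmod (\<gamma> (Q v)) * cmod (\<gamma> (Q w))"
proof (cases "w = \<zero>")
  case True
  then have "B v w = 0" using B_zero[OF v] B_sym[OF v w] by simp
  then show ?thesis by (simp add: Gal_0[OF \<gamma>])
next
  case False
  define a where "a = 2 * Q w"
  define b where "b = - (2 * B v w)"
  have ab: "a \<in> \<O>" "b \<in> \<O>"
    using v w by (auto simp: a_def b_def intro!: O_mult O_uminus O_2 Q_integral B_double_integral)
  define r where "r = a \<odot> v \<oplus> b \<odot> w"
  have r: "r \<in> \<Lambda>" unfolding r_def by (rule combine(1)[OF ab v w])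
  have Bru: "B r u = a * B v u + b * B w u" if "u \<in> \<Lambda>" for u
    unfolding r_def by (rule combine(2)[OF ab v w that])
  have "B r w = 0" using Bru[OF w] B_self[OF w] by (simp add: a_def b_def)
  then have "B w r = 0" using B_sym[OF r w] by simp
  then have "Q r = a * B r v" using B_self[OF r] Bru[OF r] B_sym[OF v r] by simp
  also have "B r v = 2 * (Q w * Q v - (B v w)\<^sup>2)"
    unfolding Bru[OF v] B_self[OF v] B_sym[OF w v] a_def b_def by (simp add: algebra_simps power2_eq_square)
  also have "a * (2 * (Q w * Q v - (B v w)\<^sup>2)) = 4 * Q w * (Q w * Q v - (B v w)\<^sup>2)" by (simp add: a_def)
  finally have Qr: "Q r = 4 * Q w * (Q w * Q v - (B v w)\<^sup>2)" .
  have real: "\<gamma> x = of_real (Re (\<gamma> x))" if "x \<in> L" for x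
    using L_totally_real[OF that \<gamma>] by (simp add: of_real_Re)
  have Lm: "Q v \<in> L" "Q w \<in> L" "B v w \<in> L" "Q r \<in> L"
    using Q_integral[OF v] Q_integral[OF w] Q_integral[OF r] B_L[OF v w] by (auto simp: O_iff)
  define qv qw b where "qv = Re (\<gamma> (Q v))" and "qw = Re (\<gamma> (Q w))" and "b = Re (\<gamma> (B v w))"
  have eqs: "\<gamma> (Q v) = of_real qv" "\<gamma> (Q w) = of_real qw" "\<gamma> (B v w) = of_real b"
    using real Lm by (simp_all add: qv_def qw_def b_def)
  have alg: "algebraic (Q v)" "algebraic (Q w)" "algebraic (B v w)" using Lm L_algebraic by auto
  have four: "\<gamma> 4 = 4" using Gal_of_nat[OF \<gamma>, of 4] by simp
  have "\<gamma> (Q r) = \<gamma> (4 * Q w) * \<gamma> (Q w * Q v - (B v w)\<^sup>2)"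
    unfolding Qr using alg by (intro Gal_mult[OF \<gamma>] algebraic_mult algebraic_diff algebraic_power) (auto intro: rat_imp_algebraic)
  also have "\<gamma> (4 * Q w) = of_real (4 * qw)"
    using Gal_mult[OF \<gamma> _ alg(2), of 4] four eqs by (simp add: rat_imp_algebraic)
  also have "\<gamma> (Q w * Q v - (B v w)\<^sup>2) = of_real (qw * qv - b\<^sup>2)"
    using Gal_diff[OF \<gamma> algebraic_mult[OF alg(2,1)] algebraic_power[OF alg(3), of 2]]
      Gal_mult[OF \<gamma> alg(2,1)] Gal_power[OF \<gamma> alg(3), of 2] eqs by simp
  finally have \<gamma>Qr: "Re (\<gamma> (Q r)) = 4 * qw * (qw * qv - b\<^sup>2)"
    by (simp only: of_real_mult[symmetric] Re_complex_of_real)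
  have "Re (\<gamma> (Q r)) \<ge> 0"
    using Q_positive[OF r] Q_zero \<gamma> by (cases "r = \<zero>") (auto simp: totally_positive_iff Gal_0[OF \<gamma>] less_imp_le)
  moreover have qw: "qw > 0" using Q_positive[OF w False] \<gamma> by (simp add: totally_positive_iff qw_def)
  ultimately have "qw * qv - b\<^sup>2 \<ge> 0" using \<gamma>Qr by (simp add: zero_le_mult_iff)
  then have "b\<^sup>2 \<le> qv * qw" by (simp add: mult.commute)
  also have "\<dots> \<le> \<bar>qv\<bar> * \<bar>qw\<bar>" by (metis abs_ge_self abs_mult)
  finally show ?thesis by (simp add: eqs)
qed

text \<open>Let \<open>bd\<close> be the least bound for the conjugates of a totally positive
  integer of \<open>L\<close> outside \<open>F\<close>. Representing such an integer by
  \<open>Q\<close> yields some \<open>2 * B v e\<close> outside \<open>F\<close> with conjugates at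
  most \<open>2 * sqrt (c * bd)\<close>. Adding an integer just above this makes it totally positive
  again and at most doubles the bound. Minimality gives
  \<open>bd \<le> 4 * sqrt (c * bd) + 2\<close>, hence \<open>bd \<le> T\<close>, against the
  assumption on \<open>F\<close>.\<close>

lemma descent:
  assumes univ: "\<And>a. a \<in> \<O> \<Longrightarrow> totally_positive a \<Longrightarrow> \<exists>v\<in>\<Lambda>. Q v = a"
  obtains T Qs where "T \<ge> 1" "finite Qs" "Qs \<subseteq> L"
    "\<And>F. alg_field F \<Longrightarrow> Qs \<subseteq> F \<Longrightarrow>
      (\<And>x. x \<in> L \<Longrightarrow> algebraic_int x \<Longrightarrow> (\<And>\<gamma>. \<gamma> \<in> Gal \<rat> \<Longrightarrow> cmod (\<gamma> x) \<le> T) \<Longrightarrow> x \<in> F) \<Longrightarrow> L \<subseteq> F"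
proof -
  obtain es where es: "set es \<subseteq> \<Lambda>" "\<And>e. e \<in> set es \<Longrightarrow> Q e \<noteq> 0"
    "\<And>v. v \<in> \<Lambda> \<Longrightarrow> Q v = (\<Sum>e\<leftarrow>es. (B v e)\<^sup>2 / Q e)"
    using orthogonal_expansion by blast
  have Q_alg: "algebraic (Q e)" if "e \<in> set es" for e
    using that es(1) Q_integral L_algebraic by (auto simp: O_iff)
  have "\<exists>bd::nat. \<forall>\<gamma>\<in>Gal \<rat>. cmod (\<gamma> (Q e)) \<le> bd" if "e \<in> set es" for e
    using orbit_bounded[OF Q_alg[OF that]] by metis
  then obtain h :: "'v \<Rightarrow> nat" where h: "\<And>e \<gamma>. e \<in> set es \<Longrightarrow> \<gamma> \<in> Gal \<rat> \<Longrightarrow> cmod (\<gamma> (Q e)) \<le> h e"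
    by metis
  define c where "c = (\<Sum>e\<in>set es. real (h e)) + 1"
  have c1: "c \<ge> 1" unfolding c_def by (simp add: sum_nonneg)
  have c: "cmod (\<gamma> (Q e)) \<le> c" if "e \<in> set es" "\<gamma> \<in> Gal \<rat>" for e \<gamma>
  proof -
    have "cmod (\<gamma> (Q e)) \<le> h e" by (rule h[OF that])
    also have "real (h e) \<le> (\<Sum>e\<in>set es. real (h e))" by (rule member_le_sum[OF that(1)]) auto
    finally show ?thesis by (simp add: c_def)
  qed
  define T where "T = (4 * sqrt c + 2)\<^sup>2"
  have "sqrt c \<ge> 1" using c1 by simp
  then have T1: "T \<ge> 1" unfolding T_def by (intro one_le_power) linarith
  have "L \<subseteq> F" if F: "alg_field F" "Q ` set es \<subseteq> F"
    "\<And>x. x \<in> L \<Longrightarrow> algebraic_int x \<Longrightarrow> (\<And>\<gamma>. \<gamma> \<in> Gal \<rat> \<Longrightarrow> cmod (\<gamma> x) \<le> T) \<Longrightarrow> x \<in> F" for F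
  proof (rule ccontr)
    assume "\<not> L \<subseteq> F"
    then obtain x where x: "x \<in> L" "x \<notin> F" by blast
    define W where "W = (\<lambda>bd::nat. \<exists>a. a \<in> \<O> \<and> totally_positive a \<and> a \<notin> F \<and> (\<forall>\<gamma>\<in>Gal \<rat>. cmod (\<gamma> a) \<le> bd))"
    have shift: "W Y" if b: "b \<in> \<O>" "b \<notin> F" and n: "\<And>\<gamma>. \<gamma> \<in> Gal \<rat> \<Longrightarrow> cmod (\<gamma> b) < real n" and Y: "2 * n \<le> Y" for b n Y
    proof -
      define a where "a = b + of_nat n"
      have aO: "a \<in> \<O>" unfolding a_def by (rule O_add[OF b(1) O_of_nat])
      have b_alg: "algebraic b" using b(1) L_algebraic by (simp add: O_iff)
      have \<gamma>a: "\<gamma> a = \<gamma> b + of_nat n" if "\<gamma> \<in> Gal \<rat>" for \<gamma>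
        unfolding a_def using Gal_add[OF that b_alg, of "of_nat n"] Gal_of_nat[OF that] by (simp add: rat_imp_algebraic)
      have "totally_positive a"
        unfolding totally_positive_iff
      proof (intro conjI ballI)
        show "algebraic a" using aO L_algebraic by (simp add: O_iff)
        fix \<gamma> assume \<gamma>: "\<gamma> \<in> Gal \<rat>"
        show "\<gamma> a \<in> \<real>" using L_totally_real[OF _ \<gamma>] aO by (simp add: O_iff)
        have "\<bar>Re (\<gamma> b)\<bar> < real n" using n[OF \<gamma>] abs_Re_le_cmod[of "\<gamma> b"] by linarith
        then show "0 < Re (\<gamma> a)" by (simp add: \<gamma>a[OF \<gamma>])
      qed
      moreover have "a \<notin> F"
      proof
        assume "a \<in> F"
        then have "a - of_nat n \<in> F" by (rule alg_field_diff[OF F(1) _ alg_field_rat[OF F(1)]]) simp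
        then show False using b(2) by (simp add: a_def)
      qed
      moreover have "cmod (\<gamma> a) \<le> Y" if \<gamma>: "\<gamma> \<in> Gal \<rat>" for \<gamma>
      proof -
        have "cmod (\<gamma> a) \<le> cmod (\<gamma> b) + real n"
          unfolding \<gamma>a[OF \<gamma>] using norm_triangle_ineq[of "\<gamma> b" "of_nat n"] by simp
        also have "\<dots> \<le> real (2 * n)" using n[OF \<gamma>] by simp
        also have "\<dots> \<le> real Y" using Y by (simp only: of_nat_le_iff)
        finally show ?thesis .
      qed
      ultimately show ?thesis unfolding W_def using aO by blast
    qed
    have "\<exists>bd. W bd"
    proof -
      obtain n :: nat where n: "n > 0" "algebraic_int (of_nat n * x)"
        using algebraic_int_multiple[OF L_algebraic[OF x(1)]] .
      define b where "b = of_nat n * x"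
      have "b \<in> \<O>" using n(2) L_closed(4)[OF L_of_nat x(1)] by (simp add: O_iff b_def)
      moreover have "b \<notin> F"
      proof
        assume "b \<in> F"
        then have "b / of_nat n \<in> F" by (rule alg_field_divide[OF F(1) _ alg_field_rat[OF F(1)]]) simp
        then show False using x(2) n(1) by (simp add: b_def)
      qed
      moreover obtain bd :: nat where "\<And>\<gamma>. \<gamma> \<in> Gal \<rat> \<Longrightarrow> cmod (\<gamma> b) \<le> bd"
        using orbit_bounded[of b] n(2) by (auto simp: b_def)
      ultimately have "W (2 * Suc bd)" by (intro shift[of b "Suc bd"]) fastforce+
      then show ?thesis by blast
    qed
    then obtain bd where bd: "W bd" and min: "\<And>Y. W Y \<Longrightarrow> bd \<le> Y"
      using LeastI_ex[of W] Least_le[of W] by metis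
    obtain a where a: "a \<in> \<O>" "totally_positive a" "a \<notin> F" "\<And>\<gamma>. \<gamma> \<in> Gal \<rat> \<Longrightarrow> cmod (\<gamma> a) \<le> bd"
      using bd unfolding W_def by blast
    obtain v where v: "v \<in> \<Lambda>" "Q v = a" using univ[OF a(1,2)] by blast
    have "\<exists>e\<in>set es. B v e \<notin> F"
    proof (rule ccontr)
      assume "\<not> (\<exists>e\<in>set es. B v e \<notin> F)"
      then have "(B v e)\<^sup>2 / Q e \<in> F" if "e \<in> set es" for e
        using that F(2) by (intro alg_field_divide[OF F(1)] alg_field_power[OF F(1)]) auto
      then have "(\<Sum>e\<leftarrow>es. (B v e)\<^sup>2 / Q e) \<in> F"
        by (induction es) (auto intro: alg_field_add[OF F(1)] alg_field_rat[OF F(1)])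
      then show False using es(3)[OF v(1)] v(2) a(3) by simp
    qed
    then obtain e where e: "e \<in> set es" "B v e \<notin> F" by blast
    have e\<Lambda>: "e \<in> \<Lambda>" using e(1) es(1) by blast
    define b where "b = 2 * B v e"
    have bO: "b \<in> \<O>" unfolding b_def by (rule B_double_integral[OF v(1) e\<Lambda>])
    have bF: "b \<notin> F"
    proof
      assume "b \<in> F"
      then have "b / 2 \<in> F" by (rule alg_field_divide[OF F(1) _ alg_field_rat[OF F(1)]]) simp
      then show False using e(2) by (simp add: b_def)
    qed
    define n where "n = nat \<lfloor>2 * sqrt (c * bd)\<rfloor> + 1"
    have cX: "c * bd \<ge> 0" using c1 by simp
    have n: "real n > 2 * sqrt (c * bd)" "real n \<le> 2 * sqrt (c * bd) + 1"
      using cX unfolding n_def by simp_all linarith+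
    have small: "cmod (\<gamma> b) < n" if \<gamma>: "\<gamma> \<in> Gal \<rat>" for \<gamma>
    proof -
      have "(cmod (\<gamma> (B v e)))\<^sup>2 \<le> cmod (\<gamma> a) * cmod (\<gamma> (Q e))"
        using cauchy_schwarz[OF v(1) e\<Lambda> \<gamma>] v(2) by simp
      also have "\<dots> \<le> bd * c" using a(4)[OF \<gamma>] c[OF e(1) \<gamma>] by (intro mult_mono) auto
      finally have "cmod (\<gamma> (B v e)) \<le> sqrt (c * bd)" by (simp add: real_le_rsqrt mult.commute)
      moreover have "\<gamma> b = 2 * \<gamma> (B v e)"
        unfolding b_def using Gal_mult[OF \<gamma> _ B_algebraic[OF v(1) e\<Lambda>], of 2] Gal_of_nat[OF \<gamma>, of 2]
        by (simp add: rat_imp_algebraic)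
      ultimately show ?thesis using n(1) by (simp add: norm_mult)
    qed
    have "W (2 * n)" by (rule shift[OF bO bF]) (use small in auto)
    then have "bd \<le> 2 * n" by (rule min)
    then have "real bd \<le> 4 * sqrt (c * bd) + 2" using n(2) by linarith
    moreover have "0 < Re (id a)" using a(2) id_Gal unfolding totally_positive_iff by blast
    then have "bd \<noteq> 0" using a(4)[OF id_Gal] complex_Re_le_cmod[of a] by auto
    then have "sqrt bd \<ge> 1" by simp
    moreover have "4 * sqrt (c * bd) = 4 * sqrt c * sqrt bd" by (simp add: real_sqrt_mult)
    \<comment> \<open>\<open>sqrt bd \<ge> 1\<close> turns the additive 2 into a multiple of
      \<open>sqrt bd\<close>; cancelling \<open>sqrt bd\<close> and squaring gives the constant
      \<open>T\<close>.\<close>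
    ultimately have "real bd \<le> 4 * sqrt c * sqrt bd + 2 * sqrt bd" by linarith
    then have "sqrt bd * sqrt bd \<le> (4 * sqrt c + 2) * sqrt bd" by (simp add: distrib_right)
    then have "sqrt bd \<le> 4 * sqrt c + 2"
      by (rule mult_right_le_imp_le) (use \<open>sqrt bd \<ge> 1\<close> in linarith)
    then have "(sqrt bd)\<^sup>2 \<le> T" unfolding T_def by (intro power_mono) auto
    then have "real bd \<le> T" by simp
    then have "a \<in> F" using a(1,4) by (intro F(3)) (auto simp: O_iff intro: order_trans)
    then show False using a(3) by simp
  qed
  moreover have "finite (Q ` set es)" "Q ` set es \<subseteq> L" using es(1) Q_integral by (auto simp: O_iff)
  ultimately show ?thesis using that T1 by blast
qed

end

section \<open>Fields in the sense of the algebra library\<close>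

lemma domain_complex_ring: "domain complex_ring"
  by (rule field.axioms(1)[OF field_complex_ring])

lemma complex_ring_pow: "x [^]\<^bsub>complex_ring\<^esub> (n :: nat) = x ^ n"
  by (induction n) (simp_all add: class_ring_simps)

lemma poly_Poly_snoc: "poly (Poly (xs @ [a])) x = poly (Poly xs) x + a * (x :: complex) ^ length xs"
  by (induction xs) (simp_all add: algebra_simps)

text \<open>In \<open>ring.eval\<close> coefficient lists start with the leading coefficient, in
  \<open>Poly\<close> with the constant one; hence \<open>rev\<close>.\<close>

lemma eval_complex_ring: "ring.eval complex_ring p x = poly (Poly (rev p)) x"
proof -
  note [simp] = ring.eval.simps[OF ring_complex_ring]
  show ?thesis by (induction p) (simp_all add: poly_Poly_snoc complex_ring_pow class_ring_simps)
qed

lemma combine_complex_ring: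
  "ring.combine complex_ring ks (map (\<lambda>i. x [^]\<^bsub>complex_ring\<^esub> i) (rev [0..<length ks])) = poly (Poly (rev ks)) x"
proof -
  note [simp] = ring.combine.simps[OF ring_complex_ring]
  show ?thesis by (induction ks) (simp_all add: poly_Poly_snoc complex_ring_pow class_ring_simps)
qed

lemma Poly_eq_0_iff: "Poly xs = 0 \<longleftrightarrow> set xs \<subseteq> {0}"
  by (induction xs) auto

lemma coeff_Poly_in: "set xs \<subseteq> F \<Longrightarrow> 0 \<in> F \<Longrightarrow> coeff (Poly xs) i \<in> F"
  by (auto simp: coeff_Poly_eq nth_default_def)

lemma subfield_Rats: "subfield \<rat> complex_ring"
proof -
  have "subcring \<rat> complex_ring"
    by (intro ring.subcringI[OF ring_complex_ring] ring.subringI[OF ring_complex_ring]) (auto simp: a_inv_complex)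
  then show ?thesis
  proof (rule ring.subfieldI[OF ring_complex_ring])
    show "Units (complex_ring\<lparr>carrier := \<rat>\<rparr>) = \<rat> - {\<zero>\<^bsub>complex_ring\<^esub>}"
      by (auto simp: Units_def intro!: bexI[of _ "inverse _"])
  qed
qed

lemma algebraic_over_imp_root:
  assumes F: "subfield F complex_ring" and x: "(ring.algebraic complex_ring over F) x"
  obtains f where "f \<noteq> 0" "\<And>i. coeff f i \<in> F" "poly f x = 0"
proof -
  obtain p where p: "p \<in> carrier (univ_poly complex_ring F)" "p \<noteq> []" "ring.eval complex_ring p x = 0"
    using domain.algebraicE[OF domain_complex_ring subfieldE(1)[OF F] _ x] by auto
  then have pF: "set p \<subseteq> F" "hd p \<noteq> 0"
    by (auto simp: univ_poly_def polynomial_def)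
  have "Poly (rev p) \<noteq> 0" using p(2) pF(2) by (cases p) (auto simp: Poly_eq_0_iff)
  moreover have "coeff (Poly (rev p)) i \<in> F" for i
    using pF subfield_closed(6)[OF F] by (intro coeff_Poly_in) auto
  ultimately show ?thesis using that p(3) by (simp add: eval_complex_ring)
qed

lemma algebraic_over_Rats_iff: "(ring.algebraic complex_ring over \<rat>) x \<longleftrightarrow> Polynomial.algebraic x"
proof
  assume "(ring.algebraic complex_ring over \<rat>) x"
  then obtain f where "f \<noteq> 0" "\<And>i. coeff f i \<in> \<rat>" "poly f x = 0"
    using algebraic_over_imp_root[OF subfield_Rats] by blast
  then show "Polynomial.algebraic x" by (intro algebraicI')
next
  assume "Polynomial.algebraic x"
  then obtain f where f: "\<And>i. coeff f i \<in> \<int>" "f \<noteq> 0" "poly f x = 0" by (metis Polynomial.algebraicE)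
  define p where "p = rev (coeffs f)"
  have "set (coeffs f) \<subseteq> \<rat>"
    using f(1) Ints_subset_Rats by (auto simp: coeffs_def split: if_splits)
  moreover have "hd p = lead_coeff f" using f(2) by (simp add: p_def hd_rev last_coeffs_eq_coeff_degree)
  ultimately have "p \<in> carrier (univ_poly complex_ring \<rat>)"
    using f(2) by (simp add: univ_poly_def polynomial_def p_def)
  moreover have "p \<noteq> []" using f(2) by (simp add: p_def)
  moreover have "ring.eval complex_ring p x = \<zero>\<^bsub>complex_ring\<^esub>" using f(3) by (simp add: eval_complex_ring p_def)
  ultimately show "(ring.algebraic complex_ring over \<rat>) x" by (rule ring.algebraicI[OF ring_complex_ring])
qed

text \<open>The \<open>n + 1\<close> powers of \<open>y\<close> up to \<open>y ^ n\<close> are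
  linearly dependent over \<open>F\<close>.\<close>

lemma dimension_imp_root:
  assumes F: "subfield F complex_ring" and E: "subfield E complex_ring"
    and dim: "ring.dimension complex_ring n F E" and y: "y \<in> E"
  obtains f where "f \<noteq> 0" "\<And>i. coeff f i \<in> F" "degree f \<le> n" "poly f y = 0"
proof -
  let ?Us = "map (\<lambda>i. y [^]\<^bsub>complex_ring\<^esub> i) (rev [0..<Suc n])"
  have "y ^ i \<in> E" for i
    using y subfield_closed[OF E] by (induction i) auto
  then have Us: "set ?Us \<subseteq> E" by (auto simp: complex_ring_pow)
  have "\<not> ring.independent complex_ring F ?Us"
    using ring.independent_length_le_dimension[OF ring_complex_ring F dim _ Us] by auto
  then obtain ks where ks: "length ks = Suc n" "ring.combine complex_ring ks ?Us = 0" "set ks \<subseteq> F" "set ks \<noteq> {0}"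
    using ring.dependent_imp_non_trivial_combine[OF ring_complex_ring F, of ?Us] by auto
  define f where "f = Poly (rev ks)"
  have "poly f y = 0" using combine_complex_ring[of ks y] ks(1,2) by (simp only: f_def)
  moreover have "f \<noteq> 0"
    using ks(1,4) unfolding f_def Poly_eq_0_iff by (metis set_rev subset_singletonD set_empty length_0_conv nat.simps(3))
  moreover have "coeff f i \<in> F" for i
    unfolding f_def using ks(3) subfield_closed(6)[OF F] by (intro coeff_Poly_in) auto
  moreover have "degree f \<le> n"
    using ks(1) by (auto simp: f_def coeff_Poly_eq nth_default_def intro!: degree_le)
  ultimately show ?thesis using that by blast
qed

section \<open>Number fields and the action of automorphisms on the abelian compositum\<close>

lemma algebraic_over_number_field:
  assumes K: "number_field K" and x: "(ring.algebraic complex_ring over K) x"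
  shows "Polynomial.algebraic x"
proof -
  have sK: "subfield K complex_ring" and fK: "ring.finite_dimension complex_ring \<rat> K"
    using K by (auto simp: number_field_def)
  have sE: "subfield (ring.simple_extension complex_ring K x) complex_ring"
    using domain.simple_extension_is_subfield[OF domain_complex_ring sK, of x] x by simp
  have "ring.finite_dimension complex_ring K (ring.simple_extension complex_ring K x)"
    using domain.finite_dimension_simple_extension[OF domain_complex_ring sK, of x] x by simp
  then have "ring.finite_dimension complex_ring \<rat> (ring.simple_extension complex_ring K x)"
    by (rule ring.telescopic_base_dim(1)[OF ring_complex_ring subfield_Rats sK fK])
  moreover have "x \<in> ring.simple_extension complex_ring K x"
    using ring.simple_extension_mem[OF ring_complex_ring subfieldE(1)[OF sK], of x] by simp
  ultimately have "(ring.algebraic complex_ring over \<rat>) x"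
    using ring.finite_dimension_imp_algebraic[OF ring_complex_ring subfield_Rats subfieldE(1)[OF sE]] by blast
  then show ?thesis by (simp add: algebraic_over_Rats_iff)
qed

lemma number_field_algebraic:
  assumes "number_field K" "x \<in> K"
  shows "Polynomial.algebraic x"
proof -
  show ?thesis
    using algebraic_over_number_field[OF assms(1)] domain.algebraic_self[OF domain_complex_ring subfieldE(1) assms(2)] assms(1)
    by (simp add: number_field_def)
qed

lemma number_field_generators:
  assumes K: "number_field K"
  obtains G where "finite G" "\<And>b. b \<in> G \<Longrightarrow> Polynomial.algebraic b" "\<And>F. alg_field F \<Longrightarrow> G \<subseteq> F \<Longrightarrow> K \<subseteq> F"
proof -
  obtain n where "ring.dimension complex_ring n \<rat> K" using K by (auto simp: number_field_def ring.finite_dimension_def[OF ring_complex_ring])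
  then obtain Us where Us: "set Us \<subseteq> carrier complex_ring" "ring.Span complex_ring \<rat> Us = K"
    using ring.exists_base[OF ring_complex_ring subfield_Rats] by blast
  have UK: "set Us \<subseteq> K" using ring.Span_base_incl[OF ring_complex_ring subfield_Rats Us(1)] Us(2) by simp
  have "K \<subseteq> F" if F: "alg_field F" "set Us \<subseteq> F" for F
  proof -
    have "ring.combine complex_ring ks Us \<in> F" if "set ks \<subseteq> \<rat>" for ks
      using that F(2)
    proof (induction ks Us rule: ring.combine.induct[OF ring_complex_ring])
      case (1 k ks u us)
      then show ?case
        using alg_field_add[OF F(1) alg_field_mult[OF F(1) alg_field_rat[OF F(1)]]]
        by (simp add: ring.combine.simps[OF ring_complex_ring])
    qed (use alg_field_rat[OF F(1), of 0] in \<open>auto simp: ring.combine.simps[OF ring_complex_ring]\<close>)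
    then show ?thesis
      using ring.Span_eq_combine_set[OF ring_complex_ring subfield_Rats Us(1)] Us(2) by auto
  qed
  then show ?thesis using that[of "set Us"] number_field_algebraic[OF K] UK by blast
qed

lemma adjoin_finite_dimension:
  assumes \<theta>: "Polynomial.algebraic \<theta>" and L: "subfield L complex_ring" "L \<subseteq> adjoin \<theta>"
  shows "ring.finite_dimension complex_ring \<rat> L"
proof -
  have alg: "(ring.algebraic complex_ring over \<rat>) \<theta>" using \<theta> by (simp add: algebraic_over_Rats_iff)
  define E where "E = ring.simple_extension complex_ring \<rat> \<theta>"
  have sE: "subfield E complex_ring"
    using domain.simple_extension_is_subfield[OF domain_complex_ring subfield_Rats, of \<theta>] alg by (simp add: E_def)
  have fin: "ring.finite_dimension complex_ring \<rat> E"
    using domain.finite_dimension_simple_extension[OF domain_complex_ring subfield_Rats, of \<theta>] alg by (simp add: E_def)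
  have QE: "\<rat> \<subseteq> E" unfolding E_def by (rule ring.simple_extension_incl[OF ring_complex_ring]) auto
  have "\<theta> \<in> E"
    using ring.simple_extension_mem[OF ring_complex_ring subfieldE(1)[OF subfield_Rats], of \<theta>] by (simp add: E_def)
  have "alg_field E"
    unfolding alg_field_def
  proof (intro conjI ballI QE)
    fix x assume "x \<in> E"
    then show "Polynomial.algebraic x"
      using ring.finite_dimension_imp_algebraic[OF ring_complex_ring subfield_Rats subfieldE(1)[OF sE] fin] by (simp add: algebraic_over_Rats_iff)
  qed (use subfield_closed[OF sE] in auto)
  then have "L \<subseteq> E" using adjoin_least[of E \<theta>] \<open>\<theta> \<in> E\<close> L(2) by blast
  have "\<rat> \<subseteq> L"
  proof
    have nat: "of_nat n \<in> L" for n
      using subfield_closed[OF L(1)] by (induction n) auto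
    have int: "of_int n \<in> L" for n
      using nat subfield_closed(2)[OF L(1)] by (cases n) (auto simp del: of_nat_Suc)
    fix q :: complex assume "q \<in> \<rat>"
    then show "q \<in> L"
      using subfield_closed(4)[OF L(1) int subfield_closed(5)[OF L(1) int]]
      by (auto elim!: Rats_cases' simp: divide_inverse)
  qed
  have "subalgebra \<rat> L complex_ring"
  proof (rule subalgebra.intro)
    show "subgroup L (add_monoid complex_ring)"
      using subring.axioms(1)[OF subfieldE(1)[OF L(1)]] .
    show "subalgebra_axioms \<rat> L complex_ring"
      using \<open>\<rat> \<subseteq> L\<close> subfield_closed(4)[OF L(1)] by unfold_locales auto
  qed
  then show ?thesis
    using ring.subalbegra_incl_imp_finite_dimension[OF ring_complex_ring subfield_Rats fin _ \<open>L \<subseteq> E\<close>] by blast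
qed

text \<open>The iterates of \<sigma> at \<open>y\<close> stay among the at most \<open>d\<close>
  roots of \<open>f\<close>, so \<open>(\<sigma> ^^ k) y = y\<close> for some positive
  \<open>k \<le> d\<close>, and \<open>k\<close> divides \<open>fact d\<close>.\<close>

lemma Gal_exponent:
  assumes \<sigma>: "\<sigma> \<in> Gal F" and F: "\<And>x. x \<in> F \<Longrightarrow> Polynomial.algebraic x" and y: "Polynomial.algebraic y"
    and f: "f \<noteq> 0" "\<And>i. coeff f i \<in> F" "degree f \<le> d" "poly f y = 0"
  shows "(\<sigma> ^^ fact d) y = y"
proof -
  have iter: "(\<sigma> ^^ i) y \<in> {z. poly f z = 0}" for i
  proof -
    note \<sigma>i = Gal_funpow[OF \<sigma>, of i]
    have "(\<sigma> ^^ i) (poly f y) = (\<Sum>j\<le>degree f. (\<sigma> ^^ i) (coeff f j * y ^ j))"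
      unfolding poly_altdef using F f(2) y by (intro Gal_sum[OF \<sigma>i] algebraic_mult algebraic_power) auto
    also have "\<dots> = (\<Sum>j\<le>degree f. coeff f j * ((\<sigma> ^^ i) y) ^ j)"
    proof (intro sum.cong refl)
      fix j
      show "(\<sigma> ^^ i) (coeff f j * y ^ j) = coeff f j * (\<sigma> ^^ i) y ^ j"
        using Gal_mult[OF \<sigma>i F[OF f(2)] algebraic_power[OF y]] Gal_fix[OF \<sigma>i f(2)] Gal_power[OF \<sigma>i y] by simp
    qed
    finally show ?thesis using f(4) Gal_0[OF \<sigma>i] by (simp add: poly_altdef)
  qed
  have "card ((\<lambda>i. (\<sigma> ^^ i) y) ` {..d}) \<le> card {z. poly f z = 0}"
    using iter by (intro card_mono poly_roots_finite[OF f(1)]) auto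
  also have "\<dots> \<le> d" using card_poly_roots_bound[OF f(1)] f(3) by simp
  also have "\<dots> < card {..d}" by simp
  finally have "\<not> inj_on (\<lambda>i. (\<sigma> ^^ i) y) {..d}" by (rule pigeonhole)
  then obtain i j where ij: "i < j" "j \<le> d" "(\<sigma> ^^ i) y = (\<sigma> ^^ j) y"
    unfolding inj_on_def by (metis atMost_iff linorder_neqE_nat)
  define k where "k = j - i"
  have "(\<sigma> ^^ j) y = (\<sigma> ^^ i) ((\<sigma> ^^ k) y)"
    using ij(1) by (simp add: k_def flip: funpow_add[unfolded fun_eq_iff o_apply, rule_format])
  then have k: "(\<sigma> ^^ k) y = y"
    using ij(3) Gal_inj[OF Gal_funpow[OF \<sigma>] y Gal_algebraic[OF Gal_funpow[OF \<sigma>] y]] by metis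
  have "0 < k" "k \<le> d" using ij by (auto simp: k_def)
  then obtain c where c: "fact d = c * k" using dvd_fact[of k d] by (auto elim!: dvdE simp: mult.commute)
  have "((\<sigma> ^^ k) ^^ c) y = y" by (induction c) (simp_all add: k)
  then show ?thesis by (simp add: c funpow_mult mult.commute)
qed

lemma restrict_Gal_embedding:
  assumes "\<sigma> \<in> Gal K" "\<And>x. x \<in> F \<Longrightarrow> Polynomial.algebraic x"
  shows "\<sigma> \<in> embeddings K F"
proof -
  have "\<sigma> \<in> Ring.ring_hom (ring_on F) complex_ring"
    by (rule ring_hom_memI) (use assms in \<open>auto simp: Gal_add Gal_mult Gal_1\<close>)
  then show ?thesis using Gal_fix[OF assms(1)] by (simp add: embeddings_def)
qed

lemma restrict_Gal_galois_group:
  assumes \<sigma>: "\<sigma> \<in> Gal K" and F: "\<And>x. x \<in> F \<Longrightarrow> Polynomial.algebraic x" and gal: "galois_extension K F"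
  shows "\<sigma> \<in> galois_group K F"
proof -
  have im: "\<sigma> ` F = F"
    using gal restrict_Gal_embedding[OF \<sigma> F] by (simp add: galois_extension_def)
  have "\<sigma> \<in> Ring.ring_hom (ring_on F) (ring_on F)"
    by (rule ring_hom_memI) (use im F \<sigma> in \<open>auto simp: Gal_add[OF \<sigma>] Gal_mult[OF \<sigma>] Gal_1[OF \<sigma>]\<close>)
  moreover have "inj_on \<sigma> F" using Gal_inj[OF \<sigma> F F] by (auto intro!: inj_onI)
  ultimately show ?thesis
    using im Gal_fix[OF \<sigma>] by (auto simp: galois_group_def ring_iso_def bij_betw_def)
qed

text \<open>Commutativity comes from the abelian extension, the exponent from the larger compositum:
  \<open>\<sigma> ^^ fact d\<close> fixes each of the generating fields of degree at most
  \<open>d\<close> pointwise, hence all of it.\<close>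

lemma bounded_degree_abelian_compositum_Gal:
  assumes d: "d > 0" and K: "number_field K" and z: "z \<in> bounded_degree_abelian_compositum d K"
  shows "Polynomial.algebraic z"
    and "\<sigma> \<in> Gal K \<Longrightarrow> \<sigma> z \<in> bounded_degree_abelian_compositum d K"
    and "\<sigma> \<in> Gal K \<Longrightarrow> \<tau> \<in> Gal K \<Longrightarrow> \<sigma> (\<tau> z) = \<tau> (\<sigma> z)"
    and "\<sigma> \<in> Gal K \<Longrightarrow> (\<sigma> ^^ fact d) z = z"
proof -
  let ?\<E> = "{E. subfield E complex_ring \<and> K \<subseteq> E \<and> (\<exists>n\<le>d. ring.dimension complex_ring n K E)}"
  define M where "M = bounded_degree_abelian_compositum d K"
  define E where "E = bounded_degree_compositum d K"
  have sK: "subfield K complex_ring" using K by (simp add: number_field_def)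
  have "K \<in> ?\<E>" using sK ring.dimension_one[OF ring_complex_ring sK] d by (auto intro!: exI[of _ 1])
  then have "K \<subseteq> E" unfolding E_def bounded_degree_compositum_def by (rule compositum_upper)
  moreover have "subfield E complex_ring"
    unfolding E_def bounded_degree_compositum_def by (rule subfield_compositum)
  ultimately have ab: "abelian_extension K M" and ME: "M \<subseteq> E"
    using maximal_abelian_subextension_greatest(1,2)[OF sK, of E]
    by (simp_all add: M_def E_def bounded_degree_abelian_compositum_def)
  have gal: "galois_extension K M" using ab by (simp add: abelian_extension_def)
  have alg: "Polynomial.algebraic x" if "x \<in> M" for x
    using gal that algebraic_over_number_field[OF K] by (auto simp: galois_extension_def algebraic_extension_def)
  have zM: "z \<in> M" using z by (simp add: M_def)
  then show "Polynomial.algebraic z" by (rule alg)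
  have G: "\<sigma> \<in> galois_group K M" if "\<sigma> \<in> Gal K" for \<sigma>
    using that alg gal by (rule restrict_Gal_galois_group)
  show "\<sigma> z \<in> bounded_degree_abelian_compositum d K" if "\<sigma> \<in> Gal K"
    using galois_groupD(2)[OF G[OF that]] zM by (auto simp: M_def)
  show "\<sigma> (\<tau> z) = \<tau> (\<sigma> z)" if "\<sigma> \<in> Gal K" "\<tau> \<in> Gal K"
    using ab G[OF that(1)] G[OF that(2)] zM by (simp add: abelian_extension_def)
  show "(\<sigma> ^^ fact d) z = z" if \<sigma>: "\<sigma> \<in> Gal K"
  proof -
    note \<sigma>d = Gal_funpow[OF \<sigma>, of "fact d"]
    have "z \<in> compositum ?\<E>" using zM ME by (auto simp: E_def bounded_degree_compositum_def)
    then have "Polynomial.algebraic z \<and> (\<sigma> ^^ fact d) z = z"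
    proof (induction rule: compositum_induct)
      case one
      then show ?case using Gal_1[OF \<sigma>d] by (auto intro: rat_imp_algebraic)
    next
      case (incl F x)
      then obtain n where n: "n \<le> d" "ring.dimension complex_ring n K F" and F: "subfield F complex_ring" by auto
      have "(ring.algebraic complex_ring over K) x"
        using ring.finite_dimension_imp_algebraic[OF ring_complex_ring sK subfieldE(1)[OF F] ring.finite_dimensionI[OF ring_complex_ring n(2)] incl(2)] .
      then have x: "Polynomial.algebraic x" by (rule algebraic_over_number_field[OF K])
      obtain f where f: "f \<noteq> 0" "\<And>i. coeff f i \<in> K" "Polynomial.degree f \<le> n" "poly f x = 0"
        using dimension_imp_root[OF sK F n(2) incl(2)] by blast
      then have "Polynomial.degree f \<le> d" using n(1) by simp
      then show ?case
        using Gal_exponent[OF \<sigma> number_field_algebraic[OF K] x f(1,2) _ f(4)] x by blast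
    next
      case (minus x)
      then show ?case using Gal_uminus[OF \<sigma>d] by auto
    next
      case (inverse x)
      then show ?case using Gal_inverse[OF \<sigma>d] by auto
    next
      case (add x y)
      then show ?case using Gal_add[OF \<sigma>d] by auto
    next
      case (mult x y)
      then show ?case using Gal_mult[OF \<sigma>d] by auto
    qed
    then show ?thesis by simp
  qed
qed

text \<open>The element \<theta> generates the field of all conjugates of generators of
  \<open>K\<close> together with the roots of unity. It is normal: the algebraic numbers that
  \<sigma> maps into it form a field containing the generating set, since \<sigma> maps this set
  into itself.\<close>

lemma normal_closure_with_unity:
  assumes K: "number_field K" and m: "m > 0"
  obtains \<theta> where "kummer \<theta> m" "K \<subseteq> adjoin \<theta>"
proof -
  obtain G where G: "finite G" "\<And>b. b \<in> G \<Longrightarrow> Polynomial.algebraic b" "\<And>F. alg_field F \<Longrightarrow> G \<subseteq> F \<Longrightarrow> K \<subseteq> F"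
    using number_field_generators[OF K] by blast
  define R where "R = {z :: complex. z ^ m = 1}"
  define G' where "G' = (\<Union>b\<in>G \<union> R. (\<lambda>\<sigma>. \<sigma> b) ` Gal \<rat>)"
  have R: "algebraic_int z" if "z \<in> R" for z
    using algebraic_int_power_iff[OF m, of z] that by (simp add: R_def)
  have algR: "Polynomial.algebraic b" if "b \<in> G \<union> R" for b using that G(2) R by auto
  have finR: "finite R" unfolding R_def using finite_roots_unity[of m] m by simp
  have "finite G'" unfolding G'_def using G(1) finR algR by (intro finite_UN_I finite_rat_poly_orbit) auto
  moreover have algG': "Polynomial.algebraic b" if "b \<in> G'" for b
    using that algR Gal_algebraic unfolding G'_def by blast
  ultimately obtain \<theta> where \<theta>: "algebraic_int \<theta>" "G' \<subseteq> adjoin \<theta>" "\<And>F. alg_field F \<Longrightarrow> G' \<subseteq> F \<Longrightarrow> adjoin \<theta> \<subseteq> F"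
    using primitive_element[of G'] by blast
  note fld = alg_field_adjoin[OF algebraic_int_imp_algebraic[OF \<theta>(1)]]
  have sub: "G \<union> R \<subseteq> G'"
  proof
    fix b assume "b \<in> G \<union> R"
    moreover have "b \<in> (\<lambda>\<sigma>. \<sigma> b) ` Gal \<rat>" using imageI[OF id_Gal, of "\<lambda>\<sigma>. \<sigma> b" \<rat>] by simp
    ultimately show "b \<in> G'" unfolding G'_def by blast
  qed
  have "kummer \<theta> m"
  proof
    show "algebraic_int \<theta>" by (rule \<theta>(1))
    show "m > 0" by (rule m)
    show "\<sigma> \<theta> \<in> adjoin \<theta>" if \<sigma>: "\<sigma> \<in> Gal \<rat>" for \<sigma>
    proof -
      define F where "F = {z. Polynomial.algebraic z \<and> \<sigma> z \<in> adjoin \<theta>}"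
      have "alg_field F"
        unfolding alg_field_def F_def
      proof (intro conjI subsetI ballI)
        fix x :: complex assume "x \<in> \<rat>"
        then show "x \<in> {z. Polynomial.algebraic z \<and> \<sigma> z \<in> adjoin \<theta>}"
          using Gal_rat[OF \<sigma>, of x] alg_field_rat[OF fld, of x] rat_imp_algebraic[of x] by simp
      next
        fix x assume "x \<in> {z. Polynomial.algebraic z \<and> \<sigma> z \<in> adjoin \<theta>}"
        then show "Polynomial.algebraic x" by simp
      next
        fix x y assume "x \<in> {z. Polynomial.algebraic z \<and> \<sigma> z \<in> adjoin \<theta>}"
          and "y \<in> {z. Polynomial.algebraic z \<and> \<sigma> z \<in> adjoin \<theta>}"
        then show "x + y \<in> {z. Polynomial.algebraic z \<and> \<sigma> z \<in> adjoin \<theta>}"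
          and "x * y \<in> {z. Polynomial.algebraic z \<and> \<sigma> z \<in> adjoin \<theta>}"
          using Gal_add[OF \<sigma>, of x y] Gal_mult[OF \<sigma>, of x y]
            alg_field_add[OF fld, of "\<sigma> x" "\<sigma> y"] alg_field_mult[OF fld, of "\<sigma> x" "\<sigma> y"] by auto
      qed
      moreover have "G' \<subseteq> F"
      proof
        fix b assume b: "b \<in> G'"
        then obtain b0 where b0: "b0 \<in> G \<union> R" "b \<in> (\<lambda>\<sigma>. \<sigma> b0) ` Gal \<rat>"
          unfolding G'_def by (rule UN_E)
        obtain \<tau> where \<tau>: "\<tau> \<in> Gal \<rat>" "b = \<tau> b0" using b0(2) by (rule imageE) blast
        have "(\<sigma> \<circ> \<tau>) b0 \<in> (\<lambda>\<sigma>. \<sigma> b0) ` Gal \<rat>" by (rule imageI) (rule Gal_comp[OF \<sigma> \<tau>(1)])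
        then have "\<sigma> b \<in> G'" unfolding G'_def using b0(1) \<tau>(2) by (intro UN_I) (auto simp: comp_def)
        then show "b \<in> F" using algG'[OF b] \<theta>(2) by (auto simp: F_def)
      qed
      ultimately have "adjoin \<theta> \<subseteq> F" by (rule \<theta>(3))
      then show ?thesis using adjoin_self[of \<theta>] by (auto simp: F_def)
    qed
    then interpret normal_field \<theta> using \<theta>(1) by unfold_locales
    show "z \<in> normal_field.K \<theta>" if "z ^ m = 1" for z
      using that sub \<theta>(2) by (auto simp: R_def K_def)
  qed
  moreover have "K \<subseteq> adjoin \<theta>" using G(3)[OF fld] sub \<theta>(2) by blast
  ultimately show ?thesis by (rule that)
qed

theorem theorem3p2:
  fixes d :: nat and K L :: "complex set"
  assumes "d > 0"
    and "number_field K"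
    and "totally_real_field L"
    and "L \<subseteq> bounded_degree_abelian_compositum d K"
    and "\<not> ring.finite_dimension complex_ring \<rat> L"
  shows "\<not> (\<exists>(V :: (complex, 'v) module) \<Lambda> Q. universal_lattice L V \<Lambda> Q)"
proof
  assume "\<exists>(V :: (complex, 'v) module) \<Lambda> Q. universal_lattice L V \<Lambda> Q"
  then obtain V :: "(complex, 'v) module" and \<Lambda> Q where univ: "universal_lattice L V \<Lambda> Q" by blast
  interpret real_lattice L V \<Lambda> Q
    using univ assms(3) by unfold_locales (auto simp: universal_lattice_def)
  obtain T Qs where T: "T \<ge> 1" and Qs: "finite Qs" "Qs \<subseteq> L"
    and gen: "\<And>F. alg_field F \<Longrightarrow> Qs \<subseteq> F \<Longrightarrow>
      (\<And>x. x \<in> L \<Longrightarrow> algebraic_int x \<Longrightarrow> (\<And>\<gamma>. \<gamma> \<in> Gal \<rat> \<Longrightarrow> cmod (\<gamma> x) \<le> T) \<Longrightarrow> x \<in> F) \<Longrightarrow> L \<subseteq> F"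
    using descent univ unfolding universal_lattice_def by metis
  obtain \<theta> where kum: "kummer \<theta> (fact d)" and K\<theta>: "K \<subseteq> adjoin \<theta>"
    using normal_closure_with_unity[OF assms(2), of "fact d"] by auto
  interpret k: kummer \<theta> "fact d" by (rule kum)
  note M = bounded_degree_abelian_compositum_Gal[OF assms(1,2)]
  \<comment> \<open>Enlarging the base field shrinks the Galois group, so commutativity and exponent
    survive the passage from \<open>K\<close> to the normal field.\<close>
  have Gal_K: "\<sigma> \<in> Gal K" if "\<sigma> \<in> Gal k.K" for \<sigma>
    using Gal_mono[OF that] K\<theta> by (simp add: k.K_def)
  have L_ab: "L \<subseteq> k.abelian_part"
  proof
    fix z assume "z \<in> L"
    then have z: "z \<in> bounded_degree_abelian_compositum d K" using assms(4) by blast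
    show "z \<in> k.abelian_part"
      unfolding k.abelian_part_def
      using M(1)[OF z] M(3)[OF M(2)[OF z Gal_K] Gal_K Gal_K] M(4)[OF M(2)[OF z Gal_K] Gal_K] by blast
  qed
  obtain \<Psi> where \<Psi>: "finite \<Psi>" "\<And>w. w \<in> \<Psi> \<Longrightarrow> Polynomial.algebraic w"
    "\<And>x F. x \<in> k.abelian_part \<Longrightarrow> algebraic_int x \<Longrightarrow> (\<And>\<gamma>. \<gamma> \<in> Gal \<rat> \<Longrightarrow> cmod (\<gamma> x) \<le> T) \<Longrightarrow>
      alg_field F \<Longrightarrow> k.K \<subseteq> F \<Longrightarrow> \<Psi> \<subseteq> F \<Longrightarrow> x \<in> F"
    using k.bounded_house_finite[OF T] by blast
  \<comment> \<open>A single number field containing \<theta>, the radical representatives and the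
    numbers \<open>Qs\<close> will contain \<open>L\<close>, against its infinite degree.\<close>
  have "finite (insert \<theta> (\<Psi> \<union> Qs))" using \<Psi>(1) Qs(1) by simp
  moreover have "Polynomial.algebraic b" if "b \<in> insert \<theta> (\<Psi> \<union> Qs)" for b
    using that \<Psi>(2) Qs(2) L_algebraic k.\<theta>_alg by blast
  ultimately obtain \<eta> where \<eta>: "algebraic_int \<eta>" "insert \<theta> (\<Psi> \<union> Qs) \<subseteq> adjoin \<eta>"
    using primitive_element by metis
  note F = alg_field_adjoin[OF algebraic_int_imp_algebraic[OF \<eta>(1)]]
  have KF: "k.K \<subseteq> adjoin \<eta>" unfolding k.K_def using \<eta>(2) by (intro adjoin_least[OF F]) simp
  have "L \<subseteq> adjoin \<eta>"
  proof (rule gen[OF F])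
    show "Qs \<subseteq> adjoin \<eta>" using \<eta>(2) by simp
    fix x assume "x \<in> L" "algebraic_int x" "\<And>\<gamma>. \<gamma> \<in> Gal \<rat> \<Longrightarrow> cmod (\<gamma> x) \<le> T"
    then show "x \<in> adjoin \<eta>" using \<Psi>(3)[OF _ _ _ F KF] L_ab \<eta>(2) by blast
  qed
  then show False
    using adjoin_finite_dimension[OF algebraic_int_imp_algebraic[OF \<eta>(1)] subfield_L] assms(5) by blast
qed

end
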